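(* Let $p<q<r$ be prime numbers with $pq\neq 6$, and let $G$ be a non-abelian group of order $p^{2}qr$. Then one of the following cases occurs, and in each case the structure of $G\otimes G$ is as stated: (i) If $|G'|=q$, or $|G'|=r$, or $|G'|=qr$ with $q\nmid r-1$, then $G\otimes G\cong\mathbb{Z}_{p^{2}qr}$ when $G^{ab}$ is cyclic, and $G\otimes G\cong(\mathbb{Z}_{p})^{4}\times\mathbb{Z}_{qr}$ otherwise. (ii) If $|G'|=qr$ with $q\mid r-1$, then $G\otimes G\cong\mathbb{Z}_{p^{2}}\times G'$ when $G^{ab}$ is cyclic, and $G\otimes G\cong(\mathbb{Z}_{p})^{4}\times G'$ otherwise.
   Context: $G\otimes G$ denotes the non-abelian tensor square of $G$: the group generated by symbols $g\otimes h$ ($g,h\in G$) subject to the relations \[g_1g\otimes h=({}^{g_1}g\otimes {}^{g_1}h)(g_1\otimes h),\qquad g\otimes h_1h=(g\otimes h_1)({}^{h_1}g\otimes {}^{h_1}h)\] for all $g,g_1,h,h_1\in G$, where ${}^{x}y=xyx^{-1}$. $G'$ is the commutator subgroup of $G$ and $G^{ab}=G/G'$ its abelianization. $\mathbb{Z}_m$ denotes the cyclic group of order $m$, and $(\mathbb{Z}_m)^k$ the direct product of $k$ copies of it. *)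

theory Defs
  imports "HOL-Algebra.Algebra" "HOL-Computational_Algebra.Primes"
begin

section \<open>Groups given by generators and relations\<close>

text \<open>A letter \<open>(x, True)\<close> stands for the generator \<open>x\<close> and \<open>(x, False)\<close> for its formal inverse.
  A relation is a pair of words that are to be identified.\<close>

type_synonym 'x gword = "('x \<times> bool) list"

definition gwords :: "'x set \<Rightarrow> 'x gword set" where
  "gwords S = lists (S \<times> UNIV)"

inductive_set pres_rel :: "'x set \<Rightarrow> ('x gword \<times> 'x gword) set \<Rightarrow> ('x gword \<times> 'x gword) set"
  for S :: "'x set" and R :: "('x gword \<times> 'x gword) set"
where
  refl: "u \<in> gwords S \<Longrightarrow> (u, u) \<in> pres_rel S R"
| sym: "(u, v) \<in> pres_rel S R \<Longrightarrow> (v, u) \<in> pres_rel S R"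
| trans: "(u, v) \<in> pres_rel S R \<Longrightarrow> (v, w) \<in> pres_rel S R \<Longrightarrow> (u, w) \<in> pres_rel S R"
| append: "(u, u') \<in> pres_rel S R \<Longrightarrow> (v, v') \<in> pres_rel S R \<Longrightarrow> (u @ v, u' @ v') \<in> pres_rel S R"
| cancel: "x \<in> S \<Longrightarrow> ([(x, b), (x, \<not> b)], []) \<in> pres_rel S R"
| relator: "(u, v) \<in> R \<Longrightarrow> u \<in> gwords S \<Longrightarrow> v \<in> gwords S \<Longrightarrow> (u, v) \<in> pres_rel S R"

definition presented_group ::
  "'x set \<Rightarrow> ('x gword \<times> 'x gword) set \<Rightarrow> 'x gword set monoid" where
  "presented_group S R =
     \<lparr>carrier = gwords S // pres_rel S R,
      monoid.mult = (\<lambda>A B. \<Union>u\<in>A. \<Union>v\<in>B. pres_rel S R `` {u @ v}),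
      one = pres_rel S R `` {[]}\<rparr>"

lemma gwords_append [simp]: "u @ v \<in> gwords S \<longleftrightarrow> u \<in> gwords S \<and> v \<in> gwords S"
  by (auto simp: gwords_def)

lemma gwords_Nil [simp]: "[] \<in> gwords S"
  by (auto simp: gwords_def)

lemma gwords_Cons [simp]: "(x, b) # u \<in> gwords S \<longleftrightarrow> x \<in> S \<and> u \<in> gwords S"
  by (auto simp: gwords_def)

lemma pres_rel_gwords: "(u, v) \<in> pres_rel S R \<Longrightarrow> u \<in> gwords S \<and> v \<in> gwords S"
  by (induction rule: pres_rel.induct) auto

lemma equiv_pres_rel: "equiv (gwords S) (pres_rel S R)"
  by (rule equivI)
    (auto intro!: refl_onI symI transI intro: pres_rel.intros dest: pres_rel_gwords)

lemma pres_class_in_carrier: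
  "u \<in> gwords S \<Longrightarrow> pres_rel S R `` {u} \<in> carrier (presented_group S R)"
  by (simp add: presented_group_def quotientI)

lemma pres_class_mult:
  assumes "u \<in> gwords S" "v \<in> gwords S"
  shows "(pres_rel S R `` {u}) \<otimes>\<^bsub>presented_group S R\<^esub> (pres_rel S R `` {v})
           = pres_rel S R `` {u @ v}"
proof -
  have "congruent2 (pres_rel S R) (pres_rel S R) (\<lambda>u v. pres_rel S R `` {u @ v})"
    by (rule congruent2I')
      (metis equiv_class_eq equiv_pres_rel pres_rel.append)
  from UN_equiv_class2[OF equiv_pres_rel equiv_pres_rel this assms] show ?thesis
    by (simp add: presented_group_def)
qed

lemma pres_class_inverse:
  "u \<in> gwords S \<Longrightarrow> \<exists>v\<in>gwords S. (v @ u, []) \<in> pres_rel S R"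
proof (induction u)
  case Nil
  then show ?case by (intro bexI[of _ "[]"]) (auto intro: pres_rel.refl)
next
  case (Cons a u)
  obtain x b where a: "a = (x, b)" by (cases a)
  with Cons.prems have x: "x \<in> S" and u: "u \<in> gwords S" by auto
  from Cons.IH[OF u] obtain v where v: "v \<in> gwords S" "(v @ u, []) \<in> pres_rel S R" by auto
  have c: "([(x, \<not> b), (x, b)], []) \<in> pres_rel S R"
    using pres_rel.cancel[OF x, of "\<not> b"] by simp
  have "(v @ [(x, \<not> b), (x, b)] @ u, v @ [] @ u) \<in> pres_rel S R"
    by (intro pres_rel.append pres_rel.refl c v u)
  with v have "((v @ [(x, \<not> b)]) @ (a # u), []) \<in> pres_rel S R"
    by (auto simp: a intro: pres_rel.trans)
  then show ?case using v x by (intro bexI[of _ "v @ [(x, \<not> b)]"]) auto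
qed

lemma group_presented_group: "group (presented_group S R)"
proof (rule groupI)
  let ?P = "presented_group S R" and ?c = "\<lambda>u. pres_rel S R `` {u}"
  have one: "\<one>\<^bsub>?P\<^esub> = ?c []" by (simp add: presented_group_def)
  have ex: "\<exists>u\<in>gwords S. A = ?c u" if "A \<in> carrier ?P" for A
    using that by (auto simp: presented_group_def elim: quotientE)
  show "A \<otimes>\<^bsub>?P\<^esub> B \<in> carrier ?P" if "A \<in> carrier ?P" "B \<in> carrier ?P" for A B
    using ex[OF that(1)] ex[OF that(2)] by (auto simp: pres_class_mult pres_class_in_carrier)
  show "\<one>\<^bsub>?P\<^esub> \<in> carrier ?P"
    by (simp add: one pres_class_in_carrier)
  show "A \<otimes>\<^bsub>?P\<^esub> B \<otimes>\<^bsub>?P\<^esub> C = A \<otimes>\<^bsub>?P\<^esub> (B \<otimes>\<^bsub>?P\<^esub> C)"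
    if "A \<in> carrier ?P" "B \<in> carrier ?P" "C \<in> carrier ?P" for A B C
    using ex[OF that(1)] ex[OF that(2)] ex[OF that(3)] by (auto simp: pres_class_mult)
  show "\<one>\<^bsub>?P\<^esub> \<otimes>\<^bsub>?P\<^esub> A = A" if "A \<in> carrier ?P" for A
    using ex[OF that] by (auto simp: one pres_class_mult)
  show "\<exists>B\<in>carrier ?P. B \<otimes>\<^bsub>?P\<^esub> A = \<one>\<^bsub>?P\<^esub>" if "A \<in> carrier ?P" for A
  proof -
    from ex[OF that] obtain u where u: "u \<in> gwords S" "A = ?c u" by blast
    obtain v where v: "v \<in> gwords S" "(v @ u, []) \<in> pres_rel S R"
      using pres_class_inverse[OF u(1)] by blast
    have "?c v \<otimes>\<^bsub>?P\<^esub> A = \<one>\<^bsub>?P\<^esub>"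
      using u v by (simp add: one pres_class_mult equiv_class_eq[OF equiv_pres_rel])
    with v(1) show ?thesis by (intro bexI[of _ "?c v"]) (auto intro: pres_class_in_carrier)
  qed
qed

text \<open>Evaluation of words in a group, and the universal property of the presentation.\<close>

fun gword_eval :: "('b, 'c) monoid_scheme \<Rightarrow> ('x \<Rightarrow> 'b) \<Rightarrow> 'x gword \<Rightarrow> 'b" where
  "gword_eval H f [] = \<one>\<^bsub>H\<^esub>"
| "gword_eval H f ((x, b) # u) = (if b then f x else inv\<^bsub>H\<^esub> f x) \<otimes>\<^bsub>H\<^esub> gword_eval H f u"

lemma gword_eval_closed:
  assumes "group H" "f \<in> S \<rightarrow> carrier H"
  shows "u \<in> gwords S \<Longrightarrow> gword_eval H f u \<in> carrier H"
proof (induction u)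
  case Nil
  then show ?case using assms by (simp add: group.is_monoid)
next
  case (Cons a u)
  obtain x b where a: "a = (x, b)" by (cases a)
  interpret group H by fact
  show ?case using Cons assms(2) by (auto simp: a)
qed

lemma gword_eval_append:
  assumes "group H" "f \<in> S \<rightarrow> carrier H" "v \<in> gwords S"
  shows "u \<in> gwords S \<Longrightarrow> gword_eval H f (u @ v) = gword_eval H f u \<otimes>\<^bsub>H\<^esub> gword_eval H f v"
proof (induction u)
  case Nil
  then show ?case using assms gword_eval_closed[OF assms] by (simp add: group.is_monoid)
next
  case (Cons a u)
  obtain x b where a: "a = (x, b)" by (cases a)
  interpret group H by fact
  have "f x \<in> carrier H" "gword_eval H f u \<in> carrier H" "gword_eval H f v \<in> carrier H"
    using Cons.prems assms gword_eval_closed[OF assms(1,2)] by (auto simp: a)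
  then show ?case using Cons by (auto simp: a m_assoc)
qed

lemma gword_eval_respects:
  assumes "group H" "f \<in> S \<rightarrow> carrier H"
    and "\<And>u v. (u, v) \<in> R \<Longrightarrow> u \<in> gwords S \<Longrightarrow> v \<in> gwords S \<Longrightarrow>
           gword_eval H f u = gword_eval H f v"
  shows "(u, v) \<in> pres_rel S R \<Longrightarrow> gword_eval H f u = gword_eval H f v"
proof (induction rule: pres_rel.induct)
  case (append u u' v v')
  then show ?case
    using gword_eval_append[OF assms(1,2)] pres_rel_gwords[OF append.hyps(1)]
      pres_rel_gwords[OF append.hyps(2)] by simp
next
  case (cancel x b)
  interpret group H by fact
  have "f x \<in> carrier H" using cancel assms(2) by auto
  then show ?case by auto
qed (use assms(3) in auto)

lemma presented_group_universal:
  assumes "group H" "f \<in> S \<rightarrow> carrier H"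
    and "\<And>u v. (u, v) \<in> R \<Longrightarrow> u \<in> gwords S \<Longrightarrow> v \<in> gwords S \<Longrightarrow>
           gword_eval H f u = gword_eval H f v"
  shows "\<exists>\<phi>\<in>hom (presented_group S R) H. \<forall>x\<in>S. \<phi> (pres_rel S R `` {[(x, True)]}) = f x"
proof -
  let ?P = "presented_group S R" and ?c = "\<lambda>u. pres_rel S R `` {u}"
  interpret group H by fact
  define \<phi> where "\<phi> A = gword_eval H f (SOME u. u \<in> A)" for A
  have \<phi>: "\<phi> (?c u) = gword_eval H f u" if "u \<in> gwords S" for u
  proof -
    have "u \<in> ?c u" using that by (auto intro: pres_rel.refl)
    then have "(SOME w. w \<in> ?c u) \<in> ?c u" by (rule someI)
    then show ?thesis
      using gword_eval_respects[OF assms] unfolding \<phi>_def by fastforce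
  qed
  have ex: "\<exists>u\<in>gwords S. A = ?c u" if "A \<in> carrier ?P" for A
    using that by (auto simp: presented_group_def elim: quotientE)
  have "\<phi> \<in> hom ?P H"
  proof (rule homI)
    show "\<phi> A \<in> carrier H" if "A \<in> carrier ?P" for A
      using ex[OF that] \<phi> gword_eval_closed[OF assms(1,2)] by auto
    show "\<phi> (A \<otimes>\<^bsub>?P\<^esub> B) = \<phi> A \<otimes>\<^bsub>H\<^esub> \<phi> B" if "A \<in> carrier ?P" "B \<in> carrier ?P" for A B
      using ex[OF that(1)] ex[OF that(2)] \<phi> gword_eval_append[OF assms(1,2)]
      by (auto simp: pres_class_mult)
  qed
  moreover have "\<forall>x\<in>S. \<phi> (?c [(x, True)]) = f x"
    using \<phi> funcset_mem[OF assms(2)] by simp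
  ultimately show ?thesis by blast
qed


section \<open>The non-abelian tensor square\<close>

definition conj_by :: "('a, 'b) monoid_scheme \<Rightarrow> 'a \<Rightarrow> 'a \<Rightarrow> 'a" where
  "conj_by G x y = x \<otimes>\<^bsub>G\<^esub> y \<otimes>\<^bsub>G\<^esub> inv\<^bsub>G\<^esub> x"

text \<open>The pair \<open>(g, h)\<close> is the symbol \<open>g \<otimes> h\<close>.\<close>

definition tensor_square_relations ::
  "('a, 'b) monoid_scheme \<Rightarrow> (('a \<times> 'a) gword \<times> ('a \<times> 'a) gword) set" where
  "tensor_square_relations G =
     {([((g1 \<otimes>\<^bsub>G\<^esub> g, h), True)],
       [((conj_by G g1 g, conj_by G g1 h), True), ((g1, h), True)]) | g g1 h.
        g \<in> carrier G \<and> g1 \<in> carrier G \<and> h \<in> carrier G}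
   \<union> {([((g, h1 \<otimes>\<^bsub>G\<^esub> h), True)],
       [((g, h1), True), ((conj_by G h1 g, conj_by G h1 h), True)]) | g h h1.
        g \<in> carrier G \<and> h \<in> carrier G \<and> h1 \<in> carrier G}"

definition tensor_square :: "('a, 'b) monoid_scheme \<Rightarrow> ('a \<times> 'a) gword set monoid" where
  "tensor_square G = presented_group (carrier G \<times> carrier G) (tensor_square_relations G)"


section \<open>Commutator subgroup, abelianization and powers of groups\<close>

abbreviation commutator_subgroup :: "('a, 'b) monoid_scheme \<Rightarrow> 'a set" where
  "commutator_subgroup G \<equiv> derived G (carrier G)"

abbreviation abelianization :: "('a, 'b) monoid_scheme \<Rightarrow> 'a set monoid" where
  "abelianization G \<equiv> G Mod commutator_subgroup G"

definition group_power :: "('a, 'b) monoid_scheme \<Rightarrow> nat \<Rightarrow> (nat \<Rightarrow> 'a) monoid" where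
  "group_power G k = product_group {..<k} (\<lambda>_. G)"

end

theory Submission
  imports Defs
begin

text \<open>Write \<open>D\<close> for the commutator subgroup of \<open>G\<close>, \<open>A = G / D\<close> for the abelianization and \<open>T\<close> for the
  tensor square. Two facts give the theorem: a group whose \<open>D\<close> is cyclic of order coprime to
  \<open>\<bar>A\<bar>\<close> has \<open>T \<cong> (A \<otimes> A) \<times> D\<close>, and the groups of the theorem are of this kind.

  The structure of \<open>G\<close>. Let \<open>P\<close> be a Sylow \<open>p\<close>-subgroup; its order is \<open>p\<^sup>2\<close>, so it is abelian. An
  element of prime order \<open>l\<close> that normalizes \<open>P\<close> and moves some element of it would force \<open>l\<close> to
  divide \<open>p\<^sup>2 - 1\<close> or \<open>p - 1\<close>; for the primes \<open>l > p\<close> at hand this only happens for \<open>p = 2\<close>,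
  \<open>l = 3\<close>, that is, for \<open>p q = 6\<close>. Hence the normalizer of \<open>P\<close> centralizes \<open>P\<close>, elements of \<open>P\<close> that
  are conjugate in \<open>G\<close> are equal, and the transfer \<open>G \<rightarrow> P\<close> is the power map \<open>u \<mapsto> u\<^bsup>qr\<^esup>\<close> on \<open>P\<close>
  (Burnside's argument, \<open>transfer_hom\<close>). So \<open>D\<close> lies in a normal subgroup of order \<open>q r\<close>
  (\<open>derived_card_dvd_complement\<close>). If \<open>\<bar>D\<bar> = q r\<close>, then the Sylow \<open>r\<close>-subgroup of \<open>D\<close> is normal in
  \<open>G\<close> and cyclic, so its automorphism group is abelian and \<open>D\<close> acts trivially on it; hence \<open>D\<close> is
  cyclic in every case (\<open>derived_cyclic_two_primes\<close>).

  The splitting. \<open>G\<close> acts on \<open>T\<close> by conjugation in both arguments, and \<open>\<kappa> (g \<otimes> h) = [g, h]\<close> defines a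
  homomorphism \<open>\<kappa>\<close> (\<open>comm_map\<close>) from \<open>T\<close> onto \<open>D\<close> with kernel \<open>J\<close>, say. The identities
  \<open>t s t\<^sup>-\<^sup>1 = \<kappa> t \<cdot> s\<close> (\<open>peiffer\<close>) and \<open>\<kappa> t \<otimes> x = t (x \<cdot> t)\<^sup>-\<^sup>1\<close> (\<open>tensor_comm_map\<close>) show that \<open>J\<close> is
  central and that \<open>G\<close> acts trivially on it. As \<open>T / J \<cong> D\<close> is cyclic, \<open>T\<close> is abelian. Let \<open>K\<close> (\<open>coinv_ker\<close>) be
  generated by all \<open>t (x \<cdot> t)\<^sup>-\<^sup>1\<close>. Modulo \<open>K\<close> the symbol \<open>g \<otimes> h\<close> is bimultiplicative, so
  \<open>T / K \<cong> A \<otimes> A\<close>, and coprimality gives \<open>\<kappa> K = D\<close>. From this one builds an equivariant endomorphism of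
  \<open>T\<close> that kills \<open>J\<close> and induces the identity on \<open>T / J\<close>; it is the identity on \<open>K\<close>, so \<open>K\<close> meets \<open>J\<close>
  trivially (\<open>coinv_ker_inter_kernel\<close>) and \<open>T\<close> embeds into \<open>T / K \<times> D\<close>.

  The factor \<open>A \<otimes> A\<close>. If \<open>A \<cong> \<int>\<^sub>n \<times> \<int>\<^sub>d\<close> with \<open>d\<close> dividing \<open>n\<close>, it is
  \<open>\<int>\<^sub>n \<times> \<int>\<^sub>d \<times> \<int>\<^sub>d \<times> \<int>\<^sub>d\<close>, with the products of the two coordinates as coordinates
  (\<open>tensor_square_iso\<close>). Here \<open>n = \<bar>A\<bar>\<close>, \<open>d = 1\<close> if \<open>A\<close> is cyclic, and \<open>n = \<bar>A\<bar> / p\<close>, \<open>d = p\<close>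
  otherwise. The Chinese remainder theorem regroups the cyclic factors into the stated form.\<close>

section \<open>Fixed points, Sylow conjugacy and groups of prime square order\<close>

text \<open>Orbits have \<open>l\<close>-power length, so every orbit that is not a single fixed point has length divisible
  by \<open>l\<close>. The action is given by a plain function on \<open>E\<close>; restricting it to \<open>E\<close> makes it a homomorphism
  into the group of bijections.\<close>

lemma p_group_fixed_points:
  assumes "group H" and ord: "order H = l ^ k" and l: "Factorial_Ring.prime (l::nat)" and fin: "finite E"
    and cl: "\<And>h x. h \<in> carrier H \<Longrightarrow> x \<in> E \<Longrightarrow> f h x \<in> E"
    and one: "\<And>x. x \<in> E \<Longrightarrow> f \<one>\<^bsub>H\<^esub> x = x"
    and comp: "\<And>g h x. g \<in> carrier H \<Longrightarrow> h \<in> carrier H \<Longrightarrow> x \<in> E \<Longrightarrow> f (g \<otimes>\<^bsub>H\<^esub> h) x = f g (f h x)"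
  shows "card E mod l = card {x \<in> E. \<forall>h\<in>carrier H. f h x = x} mod l"
proof -
  interpret H: group H by fact
  define \<phi> where "\<phi> h = restrict (f h) E" for h
  have inv1: "f (inv\<^bsub>H\<^esub> h) (f h x) = x" "f h (f (inv\<^bsub>H\<^esub> h) x) = x"
    if "h \<in> carrier H" "x \<in> E" for h x
    using comp[of "inv\<^bsub>H\<^esub> h" h x] comp[of h "inv\<^bsub>H\<^esub> h" x] that one by auto
  have bij: "\<phi> h \<in> Bij E" if "h \<in> carrier H" for h
  proof -
    have "bij_betw (f h) E E"
      by (rule bij_betw_byWitness[where f' = "f (inv\<^bsub>H\<^esub> h)"]) (use that inv1 cl in auto)
    then show ?thesis
      by (auto simp: Bij_def \<phi>_def extensional_def bij_betw_def inj_on_def)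
  qed
  interpret group_action H E \<phi>
  proof (rule group_action.intro, rule group_hom.intro, rule H.is_group, rule group_BijGroup,
      rule group_hom_axioms.intro, rule homI)
    show "\<phi> x \<in> carrier (BijGroup E)" if "x \<in> carrier H" for x
      using bij[OF that] by (simp add: BijGroup_def)
    show "\<phi> (x \<otimes>\<^bsub>H\<^esub> y) = \<phi> x \<otimes>\<^bsub>BijGroup E\<^esub> \<phi> y"
      if "x \<in> carrier H" "y \<in> carrier H" for x y
      using bij[OF that(1)] bij[OF that(2)] that comp cl
      by (auto simp: BijGroup_def compose_def \<phi>_def fun_eq_iff restrict_def)
  qed
  define F where "F = {x \<in> E. \<forall>h\<in>carrier H. f h x = x}"
  have "card (E - F) = (\<Sum>x\<in>E. if x \<in> F then 0 else 1)"
    using fin by (subst sum.If_cases) (auto simp: F_def Diff_eq)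
  also have "\<dots> = (\<Sum>orb\<in>orbits H E \<phi>. \<Sum>x\<in>orb. if x \<in> F then 0 else 1)"
    by (rule disjoint_sum[OF fin, symmetric])
  finally have *: "card (E - F) = \<dots>" .
  have "l dvd (\<Sum>x\<in>orb. if x \<in> F then 0 else (1::nat))" if orb: "orb \<in> orbits H E \<phi>" for orb
  proof -
    from orb obtain y where y: "y \<in> E" "orb = orbit H \<phi> y" by (auto simp: orbits_def)
    have sub: "orb \<subseteq> E" using y cl by (auto simp: orbit_def \<phi>_def)
    have "card orb dvd l ^ k"
      using orbit_stabilizer_theorem[OF y(1)] y(2) ord by (metis dvd_triv_left)
    then obtain j where j: "card orb = l ^ j"
      using l divides_primepow_nat by blast
    show ?thesis
    proof (cases "j = 0")
      case True
      have yo: "y \<in> orb" using orbit_refl y by simp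
      obtain z where "orb = {z}" using j True by (auto simp: card_1_singleton_iff)
      with yo have o: "orb = {y}" by auto
      have "y \<in> F"
        using o y unfolding F_def orbit_def \<phi>_def by auto
      then show ?thesis by (simp add: o)
    next
      case False
      have "orb \<inter> F = {}"
      proof (rule ccontr)
        assume "orb \<inter> F \<noteq> {}"
        then obtain x where x: "x \<in> orb" "x \<in> F" by blast
        then obtain g where g: "g \<in> carrier H" "x = f g y" using y by (auto simp: orbit_def \<phi>_def)
        have "f (inv\<^bsub>H\<^esub> g) x = y" using g inv1 y by simp
        then have xy: "x = y" using x g by (simp add: F_def)
        then have "orb = {y}" using x y unfolding F_def orbit_def \<phi>_def
          using H.one_closed one by fastforce
        then show False using j one_less_power[OF prime_gt_1_nat[OF l], of j] False by simp
      qed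
      then have "(\<Sum>x\<in>orb. if x \<in> F then 0 else (1::nat)) = card orb"
        by (subst sum.cong[of orb orb _ "\<lambda>_. 1"]) auto
      then show ?thesis using j False by simp
    qed
  qed
  then have "l dvd card (E - F)" unfolding * by (rule dvd_sum)
  then obtain c where "card (E - F) = l * c" ..
  moreover have "card E = card (E - F) + card F"
    using fin by (subst card_Diff_subset) (auto simp: F_def card_mono)
  ultimately show ?thesis unfolding F_def[symmetric] by simp
qed

context group
begin

lemma conj_mult:
  assumes "x \<in> carrier G" "g \<in> carrier G" "h \<in> carrier G"
  shows "x \<otimes> (g \<otimes> h) \<otimes> inv x = (x \<otimes> g \<otimes> inv x) \<otimes> (x \<otimes> h \<otimes> inv x)"
proof -
  have "inv x \<otimes> (x \<otimes> (h \<otimes> inv x)) = h \<otimes> inv x"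
    using assms by (simp flip: m_assoc)
  then show ?thesis using assms by (simp add: m_assoc)
qed

lemma conj_conj:
  assumes "x \<in> carrier G" "y \<in> carrier G" "h \<in> carrier G"
  shows "x \<otimes> (y \<otimes> h \<otimes> inv y) \<otimes> inv x = (x \<otimes> y) \<otimes> h \<otimes> inv (x \<otimes> y)"
  using assms by (simp add: m_assoc inv_mult_group)

lemma conj_eq_iff:
  assumes "x \<in> carrier G" "h \<in> carrier G"
  shows "x \<otimes> h \<otimes> inv x = h \<longleftrightarrow> x \<otimes> h = h \<otimes> x"
  using assms by (metis inv_solve_right m_closed)

lemma centralizer_subgroup:
  assumes "S \<subseteq> carrier G"
  shows "subgroup {g \<in> carrier G. \<forall>h\<in>S. g \<otimes> h \<otimes> inv g = h} G"
proof (rule subgroup.intro)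
  show "x \<otimes> y \<in> {g \<in> carrier G. \<forall>h\<in>S. g \<otimes> h \<otimes> inv g = h}"
    if "x \<in> {g \<in> carrier G. \<forall>h\<in>S. g \<otimes> h \<otimes> inv g = h}" "y \<in> {g \<in> carrier G. \<forall>h\<in>S. g \<otimes> h \<otimes> inv g = h}" for x y
    using that assms by (auto simp flip: conj_conj)
  show "inv x \<in> {g \<in> carrier G. \<forall>h\<in>S. g \<otimes> h \<otimes> inv g = h}"
    if x: "x \<in> {g \<in> carrier G. \<forall>h\<in>S. g \<otimes> h \<otimes> inv g = h}" for x
  proof -
    have "inv x \<otimes> h \<otimes> inv (inv x) = h" if h: "h \<in> S" for h
      using x h assms conj_conj[of "inv x" x h] by auto
    then show ?thesis using x by auto
  qed
qed (use assms in auto)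

text \<open>\<open>P\<close> acts on the cosets of \<open>Q\<close> by right multiplication. Their number is prime to \<open>p\<close>, so there is
  a fixed coset \<open>Q x\<close>, and fixing it means that \<open>x P x\<^sup>-\<^sup>1 \<subseteq> Q\<close>.\<close>

lemma sylow_conjugate:
  assumes fin: "finite (carrier G)" and P: "subgroup P G" "card P = p ^ k" "Factorial_Ring.prime p"
    and Q: "subgroup Q G" "\<not> p dvd card (rcosets Q)"
  shows "\<exists>x\<in>carrier G. \<forall>h\<in>P. x \<otimes> h \<otimes> inv x \<in> Q"
proof -
  have Pc: "P \<subseteq> carrier G" and Qc: "Q \<subseteq> carrier G" using P Q by (auto simp: subgroup.subset)
  have grP: "group (G\<lparr>carrier := P\<rparr>)" using P(1) by (rule subgroup_imp_group)
  let ?f = "\<lambda>h C. C #> inv h"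
  have cos: "C \<subseteq> carrier G" if "C \<in> rcosets Q" for C
    using that Q rcosets_part_G by blast
  have fE: "finite (rcosets Q)"
    using fin Qc by (simp add: RCOSETS_def)
  define F where "F = {C \<in> rcosets Q. \<forall>h\<in>P. C #> inv h = C}"
  have "card (rcosets Q) mod p = card {C \<in> rcosets Q. \<forall>h\<in>carrier (G\<lparr>carrier := P\<rparr>). ?f h C = C} mod p"
  proof (rule p_group_fixed_points[OF grP])
    show "order (G\<lparr>carrier := P\<rparr>) = p ^ k" by (simp add: order_def P)
    show "C #> inv h \<in> rcosets Q" if "h \<in> carrier (G\<lparr>carrier := P\<rparr>)" "C \<in> rcosets Q" for h C
      using that Pc Qc by (auto simp: RCOSETS_def coset_mult_assoc subset_iff intro!: bexI[of _ "_ \<otimes> inv h"])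
    show "C #> inv \<one>\<^bsub>G\<lparr>carrier := P\<rparr>\<^esub> = C" if "C \<in> rcosets Q" for C
      using cos[OF that] by simp
    show "C #> inv (g \<otimes>\<^bsub>G\<lparr>carrier := P\<rparr>\<^esub> h) = C #> inv h #> inv g"
      if "g \<in> carrier (G\<lparr>carrier := P\<rparr>)" "h \<in> carrier (G\<lparr>carrier := P\<rparr>)" "C \<in> rcosets Q" for g h C
      using that Pc cos[OF that(3)] by (simp add: coset_mult_assoc inv_mult_group subset_iff)
  qed (use fE P in auto)
  then have "card (rcosets Q) mod p = card F mod p" by (simp add: F_def)
  with Q(2) have "card F \<noteq> 0" by (intro notI) (simp add: dvd_eq_mod_eq_0)
  then have "F \<noteq> {}" by auto
  then obtain C where C: "C \<in> rcosets Q" "\<And>h. h \<in> P \<Longrightarrow> C #> inv h = C"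
    unfolding F_def by blast
  then obtain x where x: "x \<in> carrier G" "C = Q #> x" by (auto simp: RCOSETS_def)
  have "x \<otimes> h \<otimes> inv x \<in> Q" if h: "h \<in> P" for h
  proof -
    have hc: "h \<in> carrier G" "inv h \<in> P" using h Pc P(1) by (auto simp: subgroup.m_inv_closed)
    have "x \<otimes> h \<in> Q #> x"
      using C(2)[OF hc(2)] x hc rcos_self[of x Q] Q(1) Qc
      by (metis inv_inv rcosI rcos_self coset_mult_assoc m_closed)
    then obtain y where "y \<in> Q" "x \<otimes> h = y \<otimes> x" by (auto simp: r_coset_def)
    then show ?thesis using x hc Qc by (metis inv_solve_right m_closed subsetD)
  qed
  then show ?thesis using x(1) by blast
qed

text \<open>The center \<open>Z\<close> has order divisible by \<open>p\<close>. The centralizer of an element outside \<open>Z\<close> would contain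
  \<open>Z\<close> and that element, so it would have more than \<open>p\<close> elements and be the whole group.\<close>

lemma prime_squared_order_commute:
  assumes "order G = p\<^sup>2" "Factorial_Ring.prime p" "x \<in> carrier G" "y \<in> carrier G"
  shows "x \<otimes> y = y \<otimes> x"
proof -
  have fin: "finite (carrier G)"
    using assms(1,2) by (metis order_gt_0_iff_finite prime_gt_0_nat zero_less_power)
  define Z where "Z = {z \<in> carrier G. \<forall>g\<in>carrier G. g \<otimes> z \<otimes> inv g = z}"
  define C where "C = (\<lambda>w. {g \<in> carrier G. \<forall>h\<in>{w}. g \<otimes> h \<otimes> inv g = h})"
  have Z': "Z = {g \<in> carrier G. \<forall>h\<in>carrier G. g \<otimes> h \<otimes> inv g = h}"
    by (auto simp: Z_def conj_eq_iff)
  have "subgroup Z G" unfolding Z' by (rule centralizer_subgroup) simp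
  have "order G mod p = card Z mod p" unfolding order_def Z_def
    by (rule p_group_fixed_points[OF is_group]) (use assms fin in \<open>auto simp: conj_conj\<close>)
  then have pZ: "p dvd card Z" using assms by (simp add: power2_eq_square mod_eq_0_iff_dvd)
  have "0 < card Z" using \<open>subgroup Z G\<close> fin by (metis card_gt_0_iff finite_subset subgroup.subset subgroup.one_closed empty_iff)
  have all: "w \<in> Z" if w: "w \<in> carrier G" for w
  proof (rule ccontr)
    assume wZ: "w \<notin> Z"
    have sub: "subgroup (C w) G" unfolding C_def by (rule centralizer_subgroup) (use w in simp)
    have "insert w Z \<subseteq> C w" using w by (auto simp: C_def Z_def conj_eq_iff)
    moreover have "finite (C w)" using fin by (simp add: C_def)
    ultimately have "card Z < card (C w)"
      using wZ by (metis (no_types, lifting) insert_subset order_le_less psubsetI psubset_card_mono)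
    with pZ \<open>0 < card Z\<close> have "p < card (C w)" by (meson dvd_imp_le le_less_trans)
    have "card (C w) dvd p ^ 2" using lagrange[OF sub] assms by (metis dvd_triv_right)
    then obtain j where j: "j \<le> 2" "card (C w) = p ^ j"
      using divides_primepow_nat[OF assms(2)] by blast
    with \<open>p < card (C w)\<close> have "p ^ 1 < p ^ j" by simp
    then have "1 < j" by (rule power_less_imp_less_exp[OF prime_gt_1_nat[OF assms(2)]])
    with j have "card (C w) = p ^ 2" by (auto simp: numeral_2_eq_2 le_Suc_eq)
    then have "C w = carrier G" using fin assms(1) unfolding order_def
      by (metis card_subset_eq sub subgroup.subset)
    then have "w \<in> Z" using w unfolding Z_def C_def by auto
    with wZ show False ..
  qed
  show ?thesis using all[OF assms(4)] assms by (simp add: Z_def conj_eq_iff)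
qed

lemma card_subgroup_dvd:
  assumes "subgroup K G" "subgroup L G" "K \<subseteq> L"
  shows "card K dvd card L"
proof -
  interpret L: group "G\<lparr>carrier := L\<rparr>" using assms(2) by (rule subgroup_imp_group)
  have "subgroup K (G\<lparr>carrier := L\<rparr>)" by (rule subgroup_incl[OF assms])
  from L.lagrange[OF this] have "card (rcosets\<^bsub>G\<lparr>carrier := L\<rparr>\<^esub> K) * card K = card L"
    by (simp add: order_def)
  then show ?thesis by (metis dvd_triv_right)
qed

lemma normalizer_subgroup:
  assumes P: "subgroup P G" and fin: "finite P"
  shows "subgroup {g \<in> carrier G. \<forall>h\<in>P. g \<otimes> h \<otimes> inv g \<in> P} G" (is "subgroup ?N G")
proof (rule subgroup.intro)
  have Pc: "P \<subseteq> carrier G" using P by (rule subgroup.subset)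
  show "x \<otimes> y \<in> ?N" if "x \<in> ?N" "y \<in> ?N" for x y
    using that Pc by (auto simp: subset_iff simp flip: conj_conj)
  show "inv x \<in> ?N" if x: "x \<in> ?N" for x
  proof -
    have xc: "x \<in> carrier G" using x by simp
    have "inj_on (\<lambda>h. x \<otimes> h \<otimes> inv x) P"
      using xc Pc by (auto simp: inj_on_def subset_iff)
    moreover have "(\<lambda>h. x \<otimes> h \<otimes> inv x) ` P \<subseteq> P" using x by auto
    ultimately have surj: "(\<lambda>h. x \<otimes> h \<otimes> inv x) ` P = P" using fin by (simp add: endo_inj_surj)
    have "inv x \<otimes> h \<otimes> inv (inv x) \<in> P" if h: "h \<in> P" for h
    proof -
      obtain k where k: "k \<in> P" "h = x \<otimes> k \<otimes> inv x" using surj h by blast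
      have "inv x \<otimes> h \<otimes> inv (inv x) = k"
        unfolding k(2) using k(1) Pc xc conj_conj[of "inv x" x k] by (auto simp: subset_iff)
      with k show ?thesis by simp
    qed
    then show ?thesis using xc by auto
  qed
qed (use P in \<open>auto simp: subgroup.subset subgroup.one_closed subgroup.mem_carrier\<close>)

section \<open>Burnside transfer and the commutator subgroup\<close>

text \<open>If the normalizer \<open>N\<close> of \<open>P\<close> were larger than its centralizer \<open>C\<close>, it would contain an element of
  order \<open>l\<close> for a prime \<open>l\<close> dividing the index. Counting the fixed points of the subgroup that it generates
  on \<open>P\<close> modulo \<open>l\<close> shows that the subgroup lies in \<open>C\<close>; then \<open>l\<close> divides both the order of \<open>C\<close> and
  its index in \<open>N\<close>, so \<open>l\<^sup>2\<close> divides \<open>m\<close>.\<close>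

lemma normalizer_centralizes:
  assumes fin: "finite (carrier G)" and p: "Factorial_Ring.prime p"
    and ord: "order G = p\<^sup>2 * m" and P: "subgroup P G" "card P = p\<^sup>2"
    and primes: "\<And>l. Factorial_Ring.prime l \<Longrightarrow> l dvd m \<Longrightarrow>
       \<not> l dvd p\<^sup>2 - 1 \<and> \<not> l dvd p - 1 \<and> l \<noteq> p \<and> \<not> l * l dvd m"
    and comm: "\<And>x y. x \<in> P \<Longrightarrow> y \<in> P \<Longrightarrow> x \<otimes> y = y \<otimes> x"
    and g: "g \<in> carrier G" "\<And>h. h \<in> P \<Longrightarrow> g \<otimes> h \<otimes> inv g \<in> P" and h: "h \<in> P"
  shows "g \<otimes> h \<otimes> inv g = h"
proof (rule ccontr)
  assume neq: "g \<otimes> h \<otimes> inv g \<noteq> h"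
  have Pc: "P \<subseteq> carrier G" using P by (simp add: subgroup.subset)
  have finP: "finite P" using fin Pc by (rule finite_subset[rotated])
  define N where "N = {g \<in> carrier G. \<forall>h\<in>P. g \<otimes> h \<otimes> inv g \<in> P}"
  define C where "C = {g \<in> carrier G. \<forall>h\<in>P. g \<otimes> h \<otimes> inv g = h}"
  have N: "subgroup N G" unfolding N_def by (rule normalizer_subgroup[OF P(1) finP])
  have C: "subgroup C G" unfolding C_def by (rule centralizer_subgroup[OF Pc])
  have CN: "C \<subset> N" using g h neq by (auto simp: C_def N_def)
  have PC: "P \<subseteq> C" using Pc comm by (auto simp: C_def conj_eq_iff subset_iff)
  have finN: "finite N" using fin by (simp add: N_def)
  obtain k where k: "card N = card C * k" using card_subgroup_dvd[OF C N] CN by auto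
  obtain c where c: "card C = p\<^sup>2 * c" using card_subgroup_dvd[OF P(1) C PC] P(2) by auto
  have Nm: "card N dvd p\<^sup>2 * m" using lagrange[OF N] ord by (metis dvd_triv_right)
  have p0: "p\<^sup>2 > 0" using p by (simp add: prime_gt_0_nat)
  have ckm: "c * k dvd m" using Nm p0 unfolding k c by (simp add: mult.assoc)
  have "k \<noteq> 1" using psubset_card_mono[OF finN CN] k by auto
  then obtain l where l: "Factorial_Ring.prime l" "l dvd k" using prime_factor_nat by blast
  then have lm: "l dvd m" using ckm by (meson dvd_mult dvd_trans)
  note pl = primes[OF l(1) lm]
  interpret GN: group "G\<lparr>carrier := N\<rparr>" using N by (rule subgroup_imp_group)
  obtain t where t: "card N = l ^ 1 * t" using l k by (auto simp: mult.assoc)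
  have "\<exists>H. subgroup H (G\<lparr>carrier := N\<rparr>) \<and> card H = l ^ 1"
    by (rule sylow_thm[OF l(1)]) (use t finN in \<open>auto simp: order_def GN.is_group\<close>)
  then obtain L where L': "subgroup L (G\<lparr>carrier := N\<rparr>)" "card L = l" by auto
  then have L: "subgroup L G" "L \<subseteq> N"
    using incl_subgroup[OF N] subgroup.subset[OF L'(1)] by auto
  have Lc: "L \<subseteq> carrier G" using L(1) by (simp add: subgroup.subset)
  define F where "F = {h \<in> P. \<forall>g\<in>L. g \<otimes> h \<otimes> inv g = h}"
  have "card P mod l = card {x \<in> P. \<forall>h\<in>carrier (G\<lparr>carrier := L\<rparr>). h \<otimes> x \<otimes> inv h = x} mod l"
    by (rule p_group_fixed_points[where k = 1, OF subgroup_imp_group[OF L(1)]])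
      (use L L' l finP Lc Pc in \<open>auto simp: order_def N_def conj_conj subset_iff\<close>)
  then have mod: "p\<^sup>2 mod l = card F mod l" using P by (simp add: F_def)
  have F': "F = {g \<in> carrier G. \<forall>h\<in>L. g \<otimes> h \<otimes> inv g = h} \<inter> P"
    using Pc Lc by (auto simp: F_def conj_eq_iff subset_iff)
  have "subgroup F G" unfolding F'
    by (rule subgroups_Inter_pair[OF centralizer_subgroup[OF Lc] P(1)])
  then have "card F dvd p\<^sup>2" using card_subgroup_dvd[of F P] P by (auto simp: F_def)
  then obtain j where j: "j \<le> 2" "card F = p ^ j"
    using divides_primepow_nat[OF p] by blast
  have "j = 2"
  proof (rule ccontr)
    assume "j \<noteq> 2"
    then have "j = 0 \<or> j = 1" using j by auto
    then show False
    proof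
      assume "j = 0"
      with mod j have "p\<^sup>2 mod l = 1 mod l" by simp
      moreover have "1 \<le> p\<^sup>2" using p0 by simp
      ultimately have "l dvd p\<^sup>2 - 1" using mod_eq_dvd_iff_nat by blast
      with pl show False by simp
    next
      assume "j = 1"
      with mod j have "p\<^sup>2 mod l = p mod l" by simp
      moreover have "p \<le> p\<^sup>2" using p0 by (simp add: power2_eq_square)
      ultimately have "l dvd p\<^sup>2 - p" by (simp add: mod_eq_dvd_iff_nat)
      also have "p\<^sup>2 - p = p * (p - 1)" by (simp add: power2_eq_square diff_mult_distrib2)
      finally have "l dvd p" using pl prime_dvd_mult_iff[OF l(1)] by blast
      then show False using p l pl primes_dvd_imp_eq by blast
    qed
  qed
  then have "F = P" using j P finP by (intro card_subset_eq) (auto simp: F_def)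
  then have "L \<subseteq> C" using Lc by (auto simp: F_def C_def)
  then have "l dvd card C" using card_subgroup_dvd[OF L(1) C] L' by simp
  then have "l dvd c"
    using c prime_dvd_mult_iff[OF l(1)] pl p l prime_dvd_power primes_dvd_imp_eq by metis
  then have "l * l dvd m" using l ckm by (meson dvd_trans mult_dvd_mono)
  with pl show False by simp
qed

text \<open>Burnside's fusion lemma. For \<open>e = x d x\<^sup>-\<^sup>1 \<in> P\<close> both \<open>P\<close> and \<open>x P x\<^sup>-\<^sup>1\<close> lie in the centralizer of \<open>e\<close>,
  because \<open>P\<close> is abelian. Sylow conjugacy inside this centralizer yields \<open>c\<close>, commuting with \<open>e\<close>, such
  that \<open>c x\<close> normalizes \<open>P\<close>. Then \<open>c x\<close> centralizes \<open>d\<close>, while it also carries \<open>d\<close> to \<open>e\<close>.\<close>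

lemma fusion_controlled:
  assumes fin: "finite (carrier G)" and p: "Factorial_Ring.prime p"
    and P: "subgroup P G" "card P = p ^ k" "\<not> p dvd card (rcosets P)"
    and comm: "\<And>x y. x \<in> P \<Longrightarrow> y \<in> P \<Longrightarrow> x \<otimes> y = y \<otimes> x"
    and norm: "\<And>g h. g \<in> carrier G \<Longrightarrow> (\<And>h. h \<in> P \<Longrightarrow> g \<otimes> h \<otimes> inv g \<in> P) \<Longrightarrow> h \<in> P \<Longrightarrow>
        g \<otimes> h \<otimes> inv g = h"
    and x: "x \<in> carrier G" and d: "d \<in> P" and e: "x \<otimes> d \<otimes> inv x \<in> P"
  shows "x \<otimes> d \<otimes> inv x = d"
proof -
  have Pc: "P \<subseteq> carrier G" using P by (simp add: subgroup.subset)
  define e where "e = x \<otimes> d \<otimes> inv x"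
  have ec: "e \<in> carrier G" using assms Pc by (auto simp: e_def)
  define C where "C = {g \<in> carrier G. \<forall>h\<in>{e}. g \<otimes> h \<otimes> inv g = h}"
  have C: "subgroup C G" unfolding C_def by (rule centralizer_subgroup) (use ec in simp)
  interpret GC: group "G\<lparr>carrier := C\<rparr>" using C by (rule subgroup_imp_group)
  define P1 where "P1 = (\<lambda>h. x \<otimes> h \<otimes> inv x) ` P"
  have "(\<lambda>h. x \<otimes> h \<otimes> inv x) \<in> hom G G"
    by (rule homI) (use x in \<open>auto simp: conj_mult\<close>)
  then interpret c: group_hom G G "\<lambda>h. x \<otimes> h \<otimes> inv x" by unfold_locales
  have P1: "subgroup P1 G" unfolding P1_def using P(1) by (rule c.subgroup_img_is_subgroup)
  have "card P1 = p ^ k" unfolding P1_def P(2)[symmetric]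
    by (rule card_image) (use x Pc in \<open>auto simp: inj_on_def subset_iff\<close>)
  have PC: "P \<subseteq> C" using Pc ec comm e by (auto simp: C_def conj_eq_iff subset_iff e_def)
  have "x \<otimes> h \<otimes> inv x \<in> C" if h: "h \<in> P" for h
  proof -
    have hc: "h \<in> carrier G" "d \<in> carrier G" using h d Pc by auto
    have "(x \<otimes> h \<otimes> inv x) \<otimes> e = e \<otimes> (x \<otimes> h \<otimes> inv x)"
      using conj_mult[OF x hc] conj_mult[OF x hc(2,1)] comm[OF h d] by (simp add: e_def)
    then show ?thesis using hc x ec conj_eq_iff[of "x \<otimes> h \<otimes> inv x" e] by (simp add: C_def)
  qed
  then have P1C: "P1 \<subseteq> C" by (auto simp: P1_def)
  have "card (rcosets\<^bsub>G\<lparr>carrier := C\<rparr>\<^esub> P) * card P = card C"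
    using GC.lagrange[OF subgroup_incl[OF P(1) C PC]] by (simp add: order_def)
  moreover have "card C dvd card (rcosets P) * card P"
    using lagrange[OF C] lagrange[OF P(1)] by (metis dvd_triv_right)
  moreover have "card P > 0" using P p by (simp add: prime_gt_0_nat)
  ultimately have "card (rcosets\<^bsub>G\<lparr>carrier := C\<rparr>\<^esub> P) dvd card (rcosets P)"
    by (metis dvd_times_right_cancel_iff less_irrefl)
  then have "\<not> p dvd card (rcosets\<^bsub>G\<lparr>carrier := C\<rparr>\<^esub> P)" using P(3) dvd_trans by blast
  with GC.sylow_conjugate[of P1 p k P] have
    "\<exists>c\<in>carrier (G\<lparr>carrier := C\<rparr>). \<forall>h\<in>P1.
      c \<otimes>\<^bsub>G\<lparr>carrier := C\<rparr>\<^esub> h \<otimes>\<^bsub>G\<lparr>carrier := C\<rparr>\<^esub> inv\<^bsub>G\<lparr>carrier := C\<rparr>\<^esub> c \<in> P"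
    using fin subgroup_incl[OF P1 C P1C] subgroup_incl[OF P(1) C PC] \<open>card P1 = p ^ k\<close> p
    by (simp add: C_def)
  then obtain c where c: "c \<in> C" "\<And>h. h \<in> P1 \<Longrightarrow> c \<otimes> h \<otimes> inv c \<in> P"
    using m_inv_consistent[OF C] by auto
  have cc: "c \<in> carrier G" using c by (simp add: C_def)
  have "(c \<otimes> x) \<otimes> d \<otimes> inv (c \<otimes> x) = d"
  proof (rule norm[OF _ _ d])
    show "c \<otimes> x \<otimes> h \<otimes> inv (c \<otimes> x) \<in> P" if "h \<in> P" for h
      using c(2)[of "x \<otimes> h \<otimes> inv x"] that cc x Pc by (auto simp: P1_def conj_conj subset_iff)
  qed (use cc x in simp)
  moreover have "(c \<otimes> x) \<otimes> d \<otimes> inv (c \<otimes> x) = c \<otimes> e \<otimes> inv c"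
    using cc x d Pc by (auto simp: e_def conj_conj subset_iff)
  ultimately show ?thesis using c(1) by (simp add: C_def e_def)
qed


text \<open>The transfer of \<open>g\<close> is the product over all cosets \<open>C\<close> of \<open>s C \<cdot> g \<cdot> (s (C g))\<^sup>-\<^sup>1\<close>, where \<open>s\<close> picks a
  representative of each coset; it is multiplicative because \<open>C \<mapsto> C g\<close> permutes the cosets. The
  representatives are chosen as \<open>s C = x C \<cdot> w C\<close> with \<open>w C \<in> P\<close> and with \<open>x C\<close> depending only on the orbit
  of \<open>C\<close> under right multiplication by \<open>P\<close>. For \<open>u \<in> P\<close> the factor at \<open>C\<close> is then a conjugate
  by \<open>x C\<close> of \<open>w C \<cdot> u \<cdot> (w (C u))\<^sup>-\<^sup>1 \<in> P\<close>, so it equals that element, and in the product the factors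
  \<open>w C\<close> cancel. This evaluates the transfer on \<open>P\<close> without decomposing the cosets into cycles of \<open>u\<close>.\<close>

lemma transfer_hom:
  assumes P: "subgroup P G"
    and comm: "\<And>x y. x \<in> P \<Longrightarrow> y \<in> P \<Longrightarrow> x \<otimes> y = y \<otimes> x"
    and fusion: "\<And>x d. x \<in> carrier G \<Longrightarrow> d \<in> P \<Longrightarrow> x \<otimes> d \<otimes> inv x \<in> P \<Longrightarrow> x \<otimes> d \<otimes> inv x = d"
  shows "\<exists>V\<in>hom G (G\<lparr>carrier := P\<rparr>). \<forall>u\<in>P. V u = u [^] card (rcosets P)"
proof -
  have Pc: "P \<subseteq> carrier G" using P by (simp add: subgroup.subset)
  interpret K: comm_group "G\<lparr>carrier := P\<rparr>"
    by (rule group.group_comm_groupI[OF subgroup_imp_group[OF P]]) (simp add: comm)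
  let ?R = "rcosets P"
  have cos: "C \<subseteq> carrier G" if "C \<in> ?R" for C
    using that P rcosets_part_G by blast
  have act: "C #> g \<in> ?R" if "C \<in> ?R" "g \<in> carrier G" for C g
    using that Pc by (auto simp: RCOSETS_def coset_mult_assoc)
  have actm: "C #> g #> h = C #> (g \<otimes> h)" if "C \<in> ?R" "g \<in> carrier G" "h \<in> carrier G" for C g h
    using that cos by (simp add: coset_mult_assoc)
  have act1: "C #> g #> inv g = C" "C #> inv g #> g = C" if "C \<in> ?R" "g \<in> carrier G" for C g
    using that cos by (auto simp: coset_mult_assoc)
  have shift_inj: "inj_on (\<lambda>C. C #> g) ?R" if "g \<in> carrier G" for g
    by (rule inj_on_inverseI[of _ "\<lambda>C. C #> inv g"]) (use act1 that in auto)
  have shift_img: "(\<lambda>C. C #> g) ` ?R = ?R" if g: "g \<in> carrier G" for g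
  proof
    show "?R \<subseteq> (\<lambda>C. C #> g) ` ?R"
    proof
      fix C assume "C \<in> ?R"
      then show "C \<in> (\<lambda>C. C #> g) ` ?R"
        using act1(2)[of C g] act[of C "inv g"] g by (intro image_eqI[of _ _ "C #> inv g"]) auto
    qed
  qed (use act g in auto)
  \<comment> \<open>\<open>D C\<close> is the union of the \<open>P\<close>-orbit of \<open>C\<close>; choosing \<open>x C\<close> in it makes \<open>x\<close> constant on orbits.\<close>
  define D where "D C = (\<Union>u\<in>P. C #> u)" for C
  define x where "x C = (SOME y. y \<in> D C)" for C
  define w where "w C = (SOME v. v \<in> P \<and> x C \<otimes> v \<in> C)" for C
  have w: "w C \<in> P \<and> x C \<otimes> w C \<in> C" and xc: "x C \<in> carrier G" if C: "C \<in> ?R" for C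
  proof -
    obtain g where g: "g \<in> carrier G" "C = P #> g" using C by (auto simp: RCOSETS_def)
    have "g \<in> C" using g P by (simp add: rcos_self)
    moreover have "C #> \<one> = C" using cos[OF C] by simp
    ultimately have "g \<in> D C" using P unfolding D_def by (metis UN_I subgroup.one_closed)
    then have "x C \<in> D C" unfolding x_def by (rule someI)
    then obtain u y where u: "u \<in> P" "y \<in> C" "x C = y \<otimes> u" by (auto simp: D_def r_coset_def)
    have yu: "y \<in> carrier G" "u \<in> carrier G" using u cos[OF C] Pc by auto
    then show "x C \<in> carrier G" using u by simp
    have "inv u \<in> P \<and> x C \<otimes> inv u \<in> C"
      using u yu P by (simp add: m_assoc subgroup.m_inv_closed)
    then show "w C \<in> P \<and> x C \<otimes> w C \<in> C" unfolding w_def by (rule someI)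
  qed
  define s where "s C = x C \<otimes> w C" for C
  have sC: "s C \<in> C" and sc: "s C \<in> carrier G" if "C \<in> ?R" for C
    using w[OF that] cos[OF that] by (auto simp: s_def)
  have xu: "x (C #> u) = x C" if C: "C \<in> ?R" and u: "u \<in> P" for C u
  proof -
    have uc: "u \<in> carrier G" "inv u \<in> P" using u Pc P by (auto simp: subgroup.m_inv_closed)
    have "D (C #> u) = D C"
    proof (rule equalityI; rule subsetI)
      fix y assume "y \<in> D (C #> u)"
      then obtain v where "v \<in> P" "y \<in> C #> u #> v" by (auto simp: D_def)
      then show "y \<in> D C" using C u P Pc actm[of C u v] by (auto simp: D_def subgroup.m_closed intro!: bexI[of _ "u \<otimes> v"])
    next
      fix y assume "y \<in> D C"
      then obtain v where v: "v \<in> P" "y \<in> C #> v" by (auto simp: D_def)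
      then have "C #> u #> (inv u \<otimes> v) = C #> v"
        using C uc Pc actm act m_assoc[of u "inv u" v, symmetric] by (auto simp: subset_iff)
      then show "y \<in> D (C #> u)" using v uc P by (auto simp: D_def subgroup.m_closed intro!: bexI[of _ "inv u \<otimes> v"])
    qed
    then show ?thesis by (simp add: x_def)
  qed
  define T where "T g C = s C \<otimes> g \<otimes> inv (s (C #> g))" for g C
  have TP: "T g C \<in> P" if g: "g \<in> carrier G" and C: "C \<in> ?R" for g C
  proof -
    obtain y where y: "y \<in> carrier G" "C = P #> y" using C by (auto simp: RCOSETS_def)
    have "s C \<otimes> g \<in> C #> g" using sC[OF C] by (auto simp: r_coset_def)
    moreover have "s (C #> g) \<in> C #> g" using sC act C g by simp
    moreover have "C #> g = P #> (y \<otimes> g)" using y g Pc by (simp add: coset_mult_assoc)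
    ultimately have "s C \<otimes> g \<in> P #> (y \<otimes> g)" "s (C #> g) \<in> P #> (y \<otimes> g)" by simp_all
    then obtain a b where ab: "a \<in> P" "b \<in> P" "s C \<otimes> g = a \<otimes> (y \<otimes> g)" "s (C #> g) = b \<otimes> (y \<otimes> g)"
      unfolding r_coset_def by blast
    have abc: "a \<in> carrier G" "b \<in> carrier G" using ab Pc by auto
    define z where "z = y \<otimes> g"
    have z: "z \<in> carrier G" using y g by (simp add: z_def)
    have "T g C = (a \<otimes> z) \<otimes> inv (b \<otimes> z)"
      using ab(3,4) by (simp add: T_def z_def)
    also have "\<dots> = a \<otimes> (z \<otimes> inv z) \<otimes> inv b"
      using abc z by (simp only: inv_mult_group m_assoc m_closed inv_closed)
    also have "\<dots> = a \<otimes> inv b" using abc z by simp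
    finally have "T g C = a \<otimes> inv b" .
    then show ?thesis using ab P by (simp add: subgroup.m_closed subgroup.m_inv_closed)
  qed
  have TPf: "T g \<in> ?R \<rightarrow> P" if "g \<in> carrier G" for g using TP that by simp
  have Tm: "T (g \<otimes> h) C = T g C \<otimes> T h (C #> g)"
    if g: "g \<in> carrier G" "h \<in> carrier G" and C: "C \<in> ?R" for g h C
  proof -
    have "s (C #> g) \<in> carrier G" "s (C #> (g \<otimes> h)) \<in> carrier G" "s C \<in> carrier G"
      using sc act C g by auto
    moreover from this have "inv s (C #> g) \<otimes> (s (C #> g) \<otimes> (h \<otimes> inv s (C #> (g \<otimes> h)))) = h \<otimes> inv s (C #> (g \<otimes> h))"
      using g by (simp flip: m_assoc)
    ultimately show ?thesis using g C actm by (simp add: T_def m_assoc)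
  qed
  define V where "V g = finprod (G\<lparr>carrier := P\<rparr>) (T g) ?R" for g
  have "V \<in> hom G (G\<lparr>carrier := P\<rparr>)"
  proof (rule homI)
    show "V g \<in> carrier (G\<lparr>carrier := P\<rparr>)" if "g \<in> carrier G" for g
      unfolding V_def by (rule K.finprod_closed) (use TPf that in simp)
    show "V (g \<otimes> h) = V g \<otimes>\<^bsub>G\<lparr>carrier := P\<rparr>\<^esub> V h" if g: "g \<in> carrier G" "h \<in> carrier G" for g h
    proof -
      note inj = shift_inj[OF g(1)] and img = shift_img[OF g(1)]
      have "V h = finprod (G\<lparr>carrier := P\<rparr>) (T h) ((\<lambda>C. C #> g) ` ?R)" by (simp add: V_def img)
      also have "\<dots> = finprod (G\<lparr>carrier := P\<rparr>) (\<lambda>C. T h (C #> g)) ?R"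
        by (rule K.finprod_reindex[OF _ inj]) (use TPf g img in auto)
      finally have Vh: "V h = \<dots>" .
      have "V (g \<otimes> h) = finprod (G\<lparr>carrier := P\<rparr>) (\<lambda>C. T g C \<otimes>\<^bsub>G\<lparr>carrier := P\<rparr>\<^esub> T h (C #> g)) ?R"
        unfolding V_def by (rule K.finprod_cong) (use Tm TP g act P in \<open>auto simp: subgroup.m_closed simp_implies_def\<close>)
      also have "\<dots> = V g \<otimes>\<^bsub>G\<lparr>carrier := P\<rparr>\<^esub> V h"
        unfolding Vh by (subst K.finprod_multf) (use TP g act in \<open>auto simp: V_def\<close>)
      finally show ?thesis .
    qed
  qed
  moreover have "V u = u [^] card ?R" if u: "u \<in> P" for u
  proof -
    have uc: "u \<in> carrier G" using u Pc by auto
    have wP: "w \<in> ?R \<rightarrow> P" using w by auto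
    have wuP: "(\<lambda>C. inv w (C #> u)) \<in> ?R \<rightarrow> P" "(\<lambda>C. w (C #> u)) \<in> ?R \<rightarrow> P"
      using w act uc P by (auto simp: subgroup.m_inv_closed)
    have T: "T u C = w C \<otimes> inv w (C #> u) \<otimes> u" if C: "C \<in> ?R" for C
    proof -
      have wc: "w C \<in> P" "inv w (C #> u) \<in> P" "w (C #> u) \<in> P" using w[OF C] wuP C by auto
      have wc': "w C \<in> carrier G" "w (C #> u) \<in> carrier G" using wc Pc by auto
      have a: "w C \<otimes> u \<otimes> inv w (C #> u) \<in> P" using wc u P by (simp add: subgroup.m_closed)
      have "T u C = x C \<otimes> (w C \<otimes> u \<otimes> inv w (C #> u)) \<otimes> inv x C"
        using wc' uc xc[OF C] by (simp add: T_def s_def xu[OF C u] m_assoc inv_mult_group)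
      also have "\<dots> = w C \<otimes> u \<otimes> inv w (C #> u)"
        by (rule fusion[OF xc[OF C] a]) (use calculation TP[OF uc C] in simp)
      also have "\<dots> = w C \<otimes> inv w (C #> u) \<otimes> u"
        using wc' uc comm[OF u wc(2)] by (simp add: m_assoc)
      finally show ?thesis .
    qed
    let ?K = "G\<lparr>carrier := P\<rparr>"
    note inj = shift_inj[OF uc] and img = shift_img[OF uc]
    have eq: "finprod ?K (\<lambda>C. w (C #> u)) ?R = finprod ?K w ?R"
      using K.finprod_reindex[OF _ inj, of w] img w by auto
    have "finprod ?K (\<lambda>C. w (C #> u)) ?R \<otimes>\<^bsub>?K\<^esub> finprod ?K (\<lambda>C. inv w (C #> u)) ?R
        = finprod ?K (\<lambda>C. w (C #> u) \<otimes>\<^bsub>?K\<^esub> inv w (C #> u)) ?R"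
      by (rule K.finprod_multf[symmetric]) (use wuP in auto)
    also have "\<dots> = \<one>\<^bsub>?K\<^esub>"
      by (rule K.finprod_one_eqI) (use wuP Pc in \<open>auto simp: Pi_iff subset_iff\<close>)
    finally have eq1: "finprod ?K w ?R \<otimes>\<^bsub>?K\<^esub> finprod ?K (\<lambda>C. inv w (C #> u)) ?R = \<one>\<^bsub>?K\<^esub>"
      unfolding eq .
    have "V u = finprod ?K (\<lambda>C. w C \<otimes>\<^bsub>?K\<^esub> inv w (C #> u) \<otimes>\<^bsub>?K\<^esub> u) ?R"
      unfolding V_def by (rule K.finprod_cong)
        (use T TP uc wP wuP u P in \<open>auto simp: Pi_iff subgroup.m_closed simp_implies_def\<close>)
    also have "\<dots> = finprod ?K (\<lambda>C. w C \<otimes>\<^bsub>?K\<^esub> inv w (C #> u)) ?R \<otimes>\<^bsub>?K\<^esub> finprod ?K (\<lambda>C. u) ?R"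
      by (rule K.finprod_multf) (use wP wuP u P in \<open>auto simp: Pi_iff subgroup.m_closed\<close>)
    also have "finprod ?K (\<lambda>C. w C \<otimes>\<^bsub>?K\<^esub> inv w (C #> u)) ?R = \<one>\<^bsub>?K\<^esub>"
      using eq1 by (subst K.finprod_multf) (use wP wuP in auto)
    also have "finprod ?K (\<lambda>C. u) ?R = u [^] card ?R"
      using K.finprod_const[of u ?R] u by (simp add: nat_pow_consistent[symmetric])
    finally show ?thesis using uc by simp
  qed
  ultimately show ?thesis by blast
qed


text \<open>The transfer \<open>V : G \<rightarrow> P\<close> restricts to \<open>u \<mapsto> u\<^sup>m\<close> on \<open>P\<close>, and \<open>m\<close> is prime to \<open>\<bar>P\<bar>\<close>, so \<open>V\<close> is onto
  and its kernel has order \<open>m\<close>. The image is abelian, so the kernel contains all commutators.\<close>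

lemma derived_card_dvd_complement:
  assumes fin: "finite (carrier G)" and p: "Factorial_Ring.prime p"
    and ord: "order G = p\<^sup>2 * m"
    and primes: "\<And>l. Factorial_Ring.prime l \<Longrightarrow> l dvd m \<Longrightarrow>
       \<not> l dvd p\<^sup>2 - 1 \<and> \<not> l dvd p - 1 \<and> l \<noteq> p \<and> \<not> l * l dvd m"
  shows "card (derived G (carrier G)) dvd m"
proof -
  obtain P where P: "subgroup P G" "card P = p\<^sup>2"
    using sylow_thm[OF p is_group ord fin] by blast
  have p0: "p\<^sup>2 > 0" using p by (simp add: prime_gt_0_nat)
  have Pc: "P \<subseteq> carrier G" using P by (simp add: subgroup.subset)
  interpret P: group "G\<lparr>carrier := P\<rparr>" using P(1) by (rule subgroup_imp_group)
  have oP: "order (G\<lparr>carrier := P\<rparr>) = p\<^sup>2" using P by (simp add: order_def)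
  have comm: "x \<otimes> y = y \<otimes> x" if "x \<in> P" "y \<in> P" for x y
    using P.prime_squared_order_commute[OF oP p, of x y] that by simp
  have idx: "card (rcosets P) = m"
    using lagrange[OF P(1)] ord P(2) p0 by (simp add: mult.commute)
  have npm: "\<not> p dvd m" using primes[OF p] by blast
  have norm: "g \<otimes> h \<otimes> inv g = h"
    if "g \<in> carrier G" "\<And>h. h \<in> P \<Longrightarrow> g \<otimes> h \<otimes> inv g \<in> P" "h \<in> P" for g h
    by (rule normalizer_centralizes[OF fin p ord P primes comm that])
  have fusion: "x \<otimes> d \<otimes> inv x = d" if "x \<in> carrier G" "d \<in> P" "x \<otimes> d \<otimes> inv x \<in> P" for x d
    by (rule fusion_controlled[OF fin p P _ comm norm that]) (use idx npm in auto)
  obtain V where V: "V \<in> hom G (G\<lparr>carrier := P\<rparr>)" "\<And>u. u \<in> P \<Longrightarrow> V u = u [^] m"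
    using transfer_hom[OF P(1) comm fusion] idx by blast
  interpret V: group_hom G "G\<lparr>carrier := P\<rparr>" V by unfold_locales (rule V(1))
  have "coprime (p\<^sup>2) m" using npm p by (simp add: prime_imp_coprime)
  then obtain e f :: int where ef: "e * int m + f * int (p\<^sup>2) = 1"
    using bezout_int[of "int m" "int (p\<^sup>2)"] by (auto simp: coprime_commute)
  have surj: "V ` carrier G = P"
  proof
    show "V ` carrier G \<subseteq> P" using V.hom_closed by auto
    show "P \<subseteq> V ` carrier G"
    proof
      fix u assume u: "u \<in> P"
      have uc: "u \<in> carrier G" using u Pc by auto
      have "u [^] (p\<^sup>2) = \<one>" using P.pow_order_eq_1[of u] u oP
        by (simp add: nat_pow_consistent[symmetric])
      then have "u [^] (f * int (p\<^sup>2)) = \<one>"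
        using uc by (metis int_pow_int int_pow_one int_pow_pow mult.commute)
      moreover have "u = u [^] (e * int m + f * int (p\<^sup>2))" using uc ef by simp
      ultimately have "u = (u [^] e) [^] m"
        using uc by (simp add: int_pow_mult int_pow_pow flip: int_pow_int)
      moreover have "u [^] e \<in> P" using P(1) u by (rule subgroup_int_pow_closed)
      ultimately have "u = V (u [^] e)" using V(2) by simp
      then show "u \<in> V ` carrier G" using uc by blast
    qed
  qed
  let ?K = "kernel G (G\<lparr>carrier := P\<rparr>) V"
  have K: "subgroup ?K G" by (rule V.subgroup_kernel)
  have "G Mod ?K \<cong> G\<lparr>carrier := P\<rparr>" by (rule V.FactGroup_iso) (use surj in simp)
  then have "card (rcosets ?K) = p\<^sup>2"
    using iso_same_card[of "G Mod ?K" "G\<lparr>carrier := P\<rparr>"] P(2) by (simp add: FactGroup_def)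
  then have cK: "card ?K = m" using lagrange[OF K] ord p0 by simp
  have "derived G (carrier G) \<subseteq> ?K"
    unfolding derived_def
  proof (rule generate_subgroup_incl[OF _ K], safe)
    fix g h assume gh: "g \<in> carrier G" "h \<in> carrier G"
    have VP: "V g \<in> P" "V h \<in> P" using V.hom_closed gh by auto
    then have Vc: "V g \<in> carrier G" "V h \<in> carrier G" using Pc by auto
    have "V (g \<otimes> h \<otimes> inv g \<otimes> inv h) = V g \<otimes> V h \<otimes> inv (V g) \<otimes> inv (V h)"
      using gh VP m_inv_consistent[OF P(1)] by (simp add: V.hom_mult V.hom_inv)
    also have "\<dots> = V h \<otimes> (V g \<otimes> inv (V g)) \<otimes> inv (V h)"
      using Vc comm[OF VP] by (simp add: m_assoc)
    also have "\<dots> = \<one>" using Vc by simp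
    finally show "g \<otimes> h \<otimes> inv g \<otimes> inv h \<in> ?K" using gh by (simp add: kernel_def)
  qed
  then show ?thesis
    using card_subgroup_dvd[OF derived_is_subgroup K] cK by simp
qed

text \<open>Raising \<open>(x y)\<^sup>n = \<one>\<close> to the power \<open>ord y\<close> gives \<open>x\<^bsup>n ord y\<^esup> = \<one>\<close>, so \<open>ord x\<close> divides \<open>n\<close>; symmetrically
  for \<open>y\<close>.\<close>

lemma ord_mult_coprime:
  assumes x: "x \<in> carrier G" "y \<in> carrier G" "x \<otimes> y = y \<otimes> x"
    and co: "coprime (ord x) (ord y)"
  shows "ord (x \<otimes> y) = ord x * ord y"
proof (rule dvd_antisym)
  show "ord (x \<otimes> y) dvd ord x * ord y" using ord_mul_divides[OF x(3,1,2)] .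
  let ?n = "ord (x \<otimes> y)"
  have e: "x [^] n \<otimes> y [^] n = \<one>" if "?n dvd n" for n
    using that x by (metis pow_mult_distrib pow_eq_id m_closed)
  have "x [^] (?n * ord y) = \<one>" "y [^] (?n * ord x) = \<one>"
    using e[of "?n * ord y"] e[of "?n * ord x"] x pow_eq_id[of x "?n * ord x"] pow_eq_id[of y "?n * ord y"]
    by (auto simp del: pow_eq_id)
  then have 1: "ord x dvd ?n" and 2: "ord y dvd ?n"
    using x co by (auto simp: pow_eq_id coprime_dvd_mult_left_iff coprime_commute)
  show "ord x * ord y dvd ?n" using divides_mult[OF 1 2 co] .
qed

lemma subgroup_powers_of_full_order:
  assumes D: "subgroup D G" "finite D" and x: "x \<in> D" "ord x = card D" and c: "c \<in> D"
  shows "\<exists>k::int. c = x [^] k"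
proof -
  have xc: "x \<in> carrier G" using D x by (simp add: subgroup.mem_carrier)
  have "generate G {x} \<subseteq> D" using generate_subgroup_incl[OF _ D(1)] x by simp
  moreover have "card (generate G {x}) = card D" using generate_pow_card[OF xc] x by simp
  ultimately have "generate G {x} = D" using D(2) by (simp add: card_subset_eq)
  then show ?thesis using c generate_pow[OF xc] by auto
qed

lemma prime_order_subgroup_powers:
  assumes D: "subgroup D G" and p: "Factorial_Ring.prime (card D)"
  obtains x where "x \<in> D" "ord x = card D"
proof -
  have fin: "finite D" using p by (metis card.infinite not_prime_0)
  have "card D > 1" using p by (rule prime_gt_1_nat)
  then have "D \<noteq> {\<one>}" by auto
  then obtain x where x: "x \<in> D" "x \<noteq> \<one>" using subgroup.one_closed[OF D] by blast
  interpret D: group "G\<lparr>carrier := D\<rparr>" using D by (rule subgroup_imp_group)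
  have xc: "x \<in> carrier G" using D x by (simp add: subgroup.mem_carrier)
  have "x [^] card D = \<one>" using D.pow_order_eq_1[of x] x
    by (simp add: nat_pow_consistent[symmetric] order_def)
  then have "ord x dvd card D" using xc by (simp add: pow_eq_id)
  moreover have "ord x \<noteq> 1" using x xc ord_eq_1 by simp
  ultimately have "ord x = card D" using p prime_nat_iff by blast
  with x show ?thesis using that by blast
qed

text \<open>Two different subgroups of prime order \<open>r\<close> meet trivially, so their products would give
  \<open>r\<^sup>2 > q r\<close> elements of \<open>D\<close>.\<close>

lemma larger_prime_subgroup_unique:
  assumes D: "subgroup D G" "card D = q * r" "0 < q" "q < r" "Factorial_Ring.prime r"
    and R: "subgroup R G" "R \<subseteq> D" "card R = r" and S: "subgroup S G" "S \<subseteq> D" "card S = r"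
  shows "S = R"
proof (rule ccontr)
  assume neq: "S \<noteq> R"
  have r0: "r > 0" using D by (simp add: prime_gt_0_nat)
  then have fin: "finite R" "finite S" using R S by (auto intro: card_ge_0_finite)
  have sub: "subgroup (R \<inter> S) G" by (rule subgroups_Inter_pair[OF R(1) S(1)])
  have "card (R \<inter> S) dvd r" using card_subgroup_dvd[OF sub R(1)] R by auto
  moreover have "card (R \<inter> S) \<noteq> r"
    using neq R S fin by (metis Int_lower1 Int_lower2 card_subset_eq)
  ultimately have "card (R \<inter> S) = 1" using D(5) prime_nat_iff by blast
  then have RS: "R \<inter> S = {\<one>}"
    using subgroup.one_closed[OF sub] by (elim card_1_singletonE) (metis singletonD)
  have Rc: "R \<subseteq> carrier G" "S \<subseteq> carrier G" using R S by (auto simp: subgroup.subset)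
  have "inj_on (\<lambda>(a, b). a \<otimes> b) (R \<times> S)"
  proof (rule inj_onI, clarify)
    fix a b a' b' assume ab: "a \<in> R" "a' \<in> R" "b \<in> S" "b' \<in> S" and eq: "a \<otimes> b = a' \<otimes> b'"
    have c: "a \<in> carrier G" "a' \<in> carrier G" "b \<in> carrier G" "b' \<in> carrier G" using ab Rc by auto
    have "inv a' \<otimes> a = b' \<otimes> inv b" using eq c by (metis inv_closed inv_solve_left inv_solve_right m_assoc m_closed)
    moreover have "inv a' \<otimes> a \<in> R" "b' \<otimes> inv b \<in> S"
      using ab R(1) S(1) by (auto simp: subgroup.m_closed subgroup.m_inv_closed)
    ultimately have "inv a' \<otimes> a = \<one>" "b' \<otimes> inv b = \<one>" using RS by auto
    then show "a = a' \<and> b = b'" using c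
      by (metis inv_closed inv_equality inv_inv l_cancel_one')
  qed
  moreover have "(\<lambda>(a, b). a \<otimes> b) ` (R \<times> S) \<subseteq> D"
    using R S D(1) by (auto simp: subgroup.m_closed subset_iff)
  moreover have "finite D" using D r0 by (intro card_ge_0_finite) simp
  ultimately have "card (R \<times> S) \<le> card D" by (metis card_inj_on_le)
  then show False using D R S r0 by (simp add: card_cartesian_product)
qed

text \<open>Automorphisms of a cyclic group are power maps and therefore commute, so \<open>g h\<close> and \<open>h g\<close> act in
  the same way on \<open>R\<close> and the commutator of \<open>g\<close> and \<open>h\<close> acts trivially.\<close>

lemma derived_centralizes_normal_cyclic:
  assumes R: "subgroup R G" and nor: "\<And>g a. g \<in> carrier G \<Longrightarrow> a \<in> R \<Longrightarrow> g \<otimes> a \<otimes> inv g \<in> R"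
    and y: "y \<in> R" "\<And>a. a \<in> R \<Longrightarrow> \<exists>k::int. a = y [^] k"
    and d: "d \<in> derived G (carrier G)" and a: "a \<in> R"
  shows "d \<otimes> a = a \<otimes> d"
proof -
  have Rc: "R \<subseteq> carrier G" using R by (simp add: subgroup.subset)
  have yc: "y \<in> carrier G" using y Rc by auto
  have conj_pow: "g \<otimes> (b [^] (k::int)) \<otimes> inv g = (g \<otimes> b \<otimes> inv g) [^] k"
    if "g \<in> carrier G" "b \<in> carrier G" for g b k
  proof -
    have "(\<lambda>h. g \<otimes> h \<otimes> inv g) \<in> hom G G"
      by (rule homI) (use that in \<open>auto simp: conj_mult\<close>)
    then interpret c: group_hom G G "\<lambda>h. g \<otimes> h \<otimes> inv g" by unfold_locales
    show ?thesis using c.hom_int_pow that by simp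
  qed
  have key: "(g \<otimes> h) \<otimes> b \<otimes> inv (g \<otimes> h) = (h \<otimes> g) \<otimes> b \<otimes> inv (h \<otimes> g)"
    if g: "g \<in> carrier G" "h \<in> carrier G" "b \<in> R" for g h b
  proof -
    obtain i where i: "g \<otimes> y \<otimes> inv g = y [^] (i::int)" using y nor g by blast
    obtain j where j: "h \<otimes> y \<otimes> inv h = y [^] (j::int)" using y nor g by blast
    obtain k where k: "b = y [^] (k::int)" using y g by blast
    have "g \<otimes> (h \<otimes> b \<otimes> inv h) \<otimes> inv g = h \<otimes> (g \<otimes> b \<otimes> inv g) \<otimes> inv h"
      unfolding k using g yc i j by (simp add: conj_pow int_pow_pow mult.left_commute)
    then show ?thesis using g Rc by (simp add: conj_conj subset_iff)
  qed
  define C where "C = {g \<in> carrier G. \<forall>h\<in>R. g \<otimes> h \<otimes> inv g = h}"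
  have C: "subgroup C G" unfolding C_def by (rule centralizer_subgroup[OF Rc])
  have "derived G (carrier G) \<subseteq> C" unfolding derived_def
  proof (rule generate_subgroup_incl[OF _ C], safe)
    fix g h assume g: "g \<in> carrier G" "h \<in> carrier G"
    have "(g \<otimes> h \<otimes> inv g \<otimes> inv h) \<otimes> b \<otimes> inv (g \<otimes> h \<otimes> inv g \<otimes> inv h) = b" if b: "b \<in> R" for b
    proof -
      have bc: "b \<in> carrier G" using b Rc by auto
      have "(g \<otimes> h \<otimes> inv g \<otimes> inv h) \<otimes> b \<otimes> inv (g \<otimes> h \<otimes> inv g \<otimes> inv h)
         = (g \<otimes> h) \<otimes> (inv (h \<otimes> g) \<otimes> b \<otimes> inv (inv (h \<otimes> g))) \<otimes> inv (g \<otimes> h)"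
        using g bc by (simp add: conj_conj inv_mult_group m_assoc)
      also have "\<dots> = (h \<otimes> g) \<otimes> (inv (h \<otimes> g) \<otimes> b \<otimes> inv (inv (h \<otimes> g))) \<otimes> inv (h \<otimes> g)"
        by (rule key[OF g nor]) (use g b in auto)
      also have "\<dots> = b" using g bc conj_conj[of "h \<otimes> g" "inv (h \<otimes> g)" b] by simp
      finally show ?thesis .
    qed
    then show "g \<otimes> h \<otimes> inv g \<otimes> inv h \<in> C" using g by (simp add: C_def)
  qed
  then have "d \<in> carrier G" "d \<otimes> a \<otimes> inv d = a" using d a by (auto simp: C_def)
  then show ?thesis using a Rc by (subst conj_eq_iff[symmetric]) auto
qed

text \<open>The subgroup \<open>R\<close> of order \<open>r\<close> is the only one in the commutator subgroup, so it is normal in the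
  whole group and is centralized by the commutator subgroup. A generator of \<open>R\<close> and an element of order
  \<open>q\<close> thus commute, and their product has order \<open>q r\<close>.\<close>

lemma derived_cyclic_two_primes:
  assumes q: "Factorial_Ring.prime q" and r: "Factorial_Ring.prime r" and qr: "q < r"
    and cD: "card (derived G (carrier G)) = q * r"
  obtains z where "z \<in> derived G (carrier G)" "ord z = q * r"
proof -
  define D where "D = derived G (carrier G)"
  have D: "subgroup D G" unfolding D_def by (rule derived_is_subgroup) simp
  have cD': "card D = q * r" using cD by (simp add: D_def)
  have finD: "finite D" using cD' q r by (intro card_ge_0_finite) (simp add: prime_gt_0_nat)
  interpret GD: group "G\<lparr>carrier := D\<rparr>" using D by (rule subgroup_imp_group)
  have ex: "\<exists>H. subgroup H G \<and> H \<subseteq> D \<and> card H = l" if l: "Factorial_Ring.prime l" "card D = l * m" for l m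
  proof -
    have "\<exists>H. subgroup H (G\<lparr>carrier := D\<rparr>) \<and> card H = l ^ 1"
      by (rule sylow_thm[OF l(1)]) (use l finD in \<open>auto simp: order_def GD.is_group\<close>)
    then obtain H where H: "subgroup H (G\<lparr>carrier := D\<rparr>)" "card H = l" by auto
    then show ?thesis using incl_subgroup[OF D H(1)] subgroup.subset[OF H(1)] by auto
  qed
  obtain R where R: "subgroup R G" "R \<subseteq> D" "card R = r"
    using ex[OF r, of q] cD' by (auto simp: mult.commute)
  obtain Q where Q: "subgroup Q G" "Q \<subseteq> D" "card Q = q" using ex[OF q cD'] by auto
  obtain y where y: "y \<in> R" "ord y = r" using prime_order_subgroup_powers[OF R(1)] R r by metis
  obtain x where x: "x \<in> Q" "ord x = q" using prime_order_subgroup_powers[OF Q(1)] Q q by metis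
  have Rc: "R \<subseteq> carrier G" using R by (simp add: subgroup.subset)
  have nor: "g \<otimes> a \<otimes> inv g \<in> R" if g: "g \<in> carrier G" "a \<in> R" for g a
  proof -
    have "(\<lambda>h. g \<otimes> h \<otimes> inv g) \<in> hom G G"
      by (rule homI) (use that in \<open>auto simp: conj_mult\<close>)
    then interpret c: group_hom G G "\<lambda>h. g \<otimes> h \<otimes> inv g" by unfold_locales
    have "(\<lambda>h. g \<otimes> h \<otimes> inv g) ` R = R"
    proof (rule larger_prime_subgroup_unique[OF D cD' prime_gt_0_nat[OF q] qr r R])
      show "subgroup ((\<lambda>h. g \<otimes> h \<otimes> inv g) ` R) G" using R(1) by (rule c.subgroup_img_is_subgroup)
      show "(\<lambda>h. g \<otimes> h \<otimes> inv g) ` R \<subseteq> D"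
        using normal.inv_op_closed2[OF derived_self_is_normal g(1)] R(2) by (auto simp: D_def)
      show "card ((\<lambda>h. g \<otimes> h \<otimes> inv g) ` R) = r" unfolding R(3)[symmetric]
        by (rule card_image) (use g Rc in \<open>auto simp: inj_on_def subset_iff\<close>)
    qed
    then show ?thesis using g by blast
  qed
  have finR: "finite R" using R finD finite_subset by blast
  have "x \<otimes> y = y \<otimes> x"
    by (rule derived_centralizes_normal_cyclic[OF R(1) nor y(1)])
      (use subgroup_powers_of_full_order[OF R(1) finR y(1)] y R Q x in \<open>auto simp: D_def\<close>)
  then have "ord (x \<otimes> y) = q * r"
    using ord_mult_coprime[of x y] x y R Q D q r qr by (simp add: primes_coprime subgroup.mem_carrier)
  moreover have "x \<otimes> y \<in> D" using x y Q R D by (auto intro: subgroup.m_closed)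
  ultimately show ?thesis using that by (simp add: D_def)
qed

end

section \<open>The tensor square and its action\<close>

definition tensor :: "('a, 'b) monoid_scheme \<Rightarrow> 'a \<Rightarrow> 'a \<Rightarrow> ('a \<times> 'a) gword set" where
  "tensor G g h = pres_rel (carrier G \<times> carrier G) (tensor_square_relations G) `` {[((g, h), True)]}"

lemma (in group_hom) equalizer_subgroup:
  assumes "group_hom G H k"
  shows "subgroup {x \<in> carrier G. h x = k x} G"
proof -
  interpret k: group_hom G H k by fact
  show ?thesis by (rule G.subgroupI) auto
qed

context group
begin

lemma conj_by_closed [simp]: "x \<in> carrier G \<Longrightarrow> g \<in> carrier G \<Longrightarrow> conj_by G x g \<in> carrier G"
  by (simp add: conj_by_def)

lemma conj_by_one [simp]: "g \<in> carrier G \<Longrightarrow> conj_by G \<one> g = g"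
  by (simp add: conj_by_def)

lemma conj_by_mult:
  "x \<in> carrier G \<Longrightarrow> g \<in> carrier G \<Longrightarrow> h \<in> carrier G \<Longrightarrow>
    conj_by G x (g \<otimes> h) = conj_by G x g \<otimes> conj_by G x h"
  by (simp add: conj_by_def conj_mult)

lemma conj_by_conj_by:
  "x \<in> carrier G \<Longrightarrow> y \<in> carrier G \<Longrightarrow> g \<in> carrier G \<Longrightarrow>
    conj_by G x (conj_by G y g) = conj_by G (x \<otimes> y) g"
  by (simp add: conj_by_def conj_conj)

lemma conj_by_mult_self: "x \<in> carrier G \<Longrightarrow> g \<in> carrier G \<Longrightarrow> conj_by G x g \<otimes> x = x \<otimes> g"
  by (simp add: conj_by_def m_assoc)

abbreviation "T \<equiv> tensor_square G"

lemma group_tensor_square: "group T"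
  unfolding tensor_square_def by (rule group_presented_group)

interpretation T: group T by (rule group_tensor_square)

lemma tensor_closed [simp]:
  "g \<in> carrier G \<Longrightarrow> h \<in> carrier G \<Longrightarrow> tensor G g h \<in> carrier T"
  unfolding tensor_square_def tensor_def by (rule pres_class_in_carrier) simp

lemma tensor_mult_left:
  assumes "g1 \<in> carrier G" "g \<in> carrier G" "h \<in> carrier G"
  shows "tensor G (g1 \<otimes> g) h = tensor G (conj_by G g1 g) (conj_by G g1 h) \<otimes>\<^bsub>T\<^esub> tensor G g1 h"
proof -
  let ?S = "carrier G \<times> carrier G" and ?R = "tensor_square_relations G"
  have "([((g1 \<otimes> g, h), True)], [((conj_by G g1 g, conj_by G g1 h), True), ((g1, h), True)]) \<in> pres_rel ?S ?R"
    by (rule pres_rel.relator) (use assms in \<open>auto simp: tensor_square_relations_def\<close>)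
  from equiv_class_eq[OF equiv_pres_rel this] show ?thesis
    using assms unfolding tensor_square_def tensor_def by (subst pres_class_mult) auto
qed

lemma tensor_mult_right:
  assumes "g \<in> carrier G" "h1 \<in> carrier G" "h \<in> carrier G"
  shows "tensor G g (h1 \<otimes> h) = tensor G g h1 \<otimes>\<^bsub>T\<^esub> tensor G (conj_by G h1 g) (conj_by G h1 h)"
proof -
  let ?S = "carrier G \<times> carrier G" and ?R = "tensor_square_relations G"
  have "([((g, h1 \<otimes> h), True)], [((g, h1), True), ((conj_by G h1 g, conj_by G h1 h), True)]) \<in> pres_rel ?S ?R"
    by (rule pres_rel.relator) (use assms in \<open>auto simp: tensor_square_relations_def\<close>)
  from equiv_class_eq[OF equiv_pres_rel this] show ?thesis
    using assms unfolding tensor_square_def tensor_def by (subst pres_class_mult) auto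
qed

text \<open>Induction over words, phrased with subgroups: to prove a property of all elements of \<open>T\<close> it
  suffices that it holds for the symbols and defines a subgroup.\<close>

lemma tensor_generates:
  assumes K: "subgroup K T" and gen: "\<And>g h. g \<in> carrier G \<Longrightarrow> h \<in> carrier G \<Longrightarrow> tensor G g h \<in> K"
  shows "carrier T = K"
proof
  show "K \<subseteq> carrier T" using K by (rule subgroup.subset)
  let ?S = "carrier G \<times> carrier G" and ?R = "tensor_square_relations G"
  let ?c = "\<lambda>u. pres_rel ?S ?R `` {u}"
  have one: "?c [] = \<one>\<^bsub>T\<^esub>" by (simp add: tensor_square_def presented_group_def)
  have mult: "?c (u @ v) = ?c u \<otimes>\<^bsub>T\<^esub> ?c v" if "u \<in> gwords ?S" "v \<in> gwords ?S" for u v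
    unfolding tensor_square_def using pres_class_mult[OF that] by simp
  have "?c u \<in> K" if "u \<in> gwords ?S" for u
    using that
  proof (induction u)
    case Nil
    then show ?case using subgroup.one_closed[OF K] one by simp
  next
    case (Cons a u)
    obtain g h b where a: "a = ((g, h), b)" by (cases a) auto
    have gh: "g \<in> carrier G" "h \<in> carrier G" "u \<in> gwords ?S" using Cons.prems by (auto simp: a)
    have cK: "?c [((g, h), b)] \<in> K"
    proof (cases b)
      case True
      then show ?thesis using gen gh by (simp add: tensor_def)
    next
      case False
      have "?c [((g, h), False)] \<otimes>\<^bsub>T\<^esub> ?c [((g, h), True)] = \<one>\<^bsub>T\<^esub>"
        using gh one mult[of "[((g, h), False)]" "[((g, h), True)]"]
          equiv_class_eq[OF equiv_pres_rel pres_rel.cancel[of "(g, h)" ?S False ?R]] by simp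
      moreover have "?c [((g, h), False)] \<in> carrier T"
        unfolding tensor_square_def by (rule pres_class_in_carrier) (use gh in simp)
      ultimately have "?c [((g, h), False)] = inv\<^bsub>T\<^esub> tensor G g h"
        using gh tensor_closed[of g h] by (metis T.inv_equality tensor_def)
      then show ?thesis using False gen gh K by (simp add: subgroup.m_inv_closed)
    qed
    show ?case using mult[of "[a]" u] gh cK Cons.IH K by (simp add: a subgroup.m_closed)
  qed
  then show "carrier T \<subseteq> K"
    by (auto simp: tensor_square_def presented_group_def elim: quotientE)
qed

lemma tensor_universal:
  assumes H: "group H" and cl: "\<And>g h. g \<in> carrier G \<Longrightarrow> h \<in> carrier G \<Longrightarrow> f g h \<in> carrier H"
    and left: "\<And>g1 g h. g1 \<in> carrier G \<Longrightarrow> g \<in> carrier G \<Longrightarrow> h \<in> carrier G \<Longrightarrow>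
       f (g1 \<otimes> g) h = f (conj_by G g1 g) (conj_by G g1 h) \<otimes>\<^bsub>H\<^esub> f g1 h"
    and right: "\<And>g h1 h. g \<in> carrier G \<Longrightarrow> h1 \<in> carrier G \<Longrightarrow> h \<in> carrier G \<Longrightarrow>
       f g (h1 \<otimes> h) = f g h1 \<otimes>\<^bsub>H\<^esub> f (conj_by G h1 g) (conj_by G h1 h)"
  shows "\<exists>\<phi>. \<phi> \<in> hom T H \<and> (\<forall>g\<in>carrier G. \<forall>h\<in>carrier G. \<phi> (tensor G g h) = f g h)"
proof -
  interpret H: group H by fact
  have "\<exists>\<phi>\<in>hom (presented_group (carrier G \<times> carrier G) (tensor_square_relations G)) H.
    \<forall>x\<in>carrier G \<times> carrier G. \<phi> (pres_rel (carrier G \<times> carrier G) (tensor_square_relations G) `` {[(x, True)]}) = case_prod f x"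
  proof (rule presented_group_universal[OF H])
    show "case_prod f \<in> carrier G \<times> carrier G \<rightarrow> carrier H" using cl by auto
    show "gword_eval H (case_prod f) u = gword_eval H (case_prod f) v"
      if "(u, v) \<in> tensor_square_relations G" for u v
      using that unfolding tensor_square_relations_def
      by (auto simp: cl left right)
  qed
  then show ?thesis unfolding tensor_square_def tensor_def by fastforce
qed

lemma tensor_hom_eq:
  assumes "group H" "\<phi> \<in> hom T H" "\<psi> \<in> hom T H"
    and "\<And>g h. g \<in> carrier G \<Longrightarrow> h \<in> carrier G \<Longrightarrow> \<phi> (tensor G g h) = \<psi> (tensor G g h)"
    and "t \<in> carrier T"
  shows "\<phi> t = \<psi> t"
proof -
  interpret H: group H by fact
  interpret \<phi>: group_hom T H \<phi> by unfold_locales fact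
  have "group_hom T H \<psi>" by unfold_locales fact
  from tensor_generates[OF \<phi>.equalizer_subgroup[OF this]] assms(4,5) show ?thesis by auto
qed

lemma tensor_one_left [simp]: "h \<in> carrier G \<Longrightarrow> tensor G \<one> h = \<one>\<^bsub>T\<^esub>"
  using tensor_mult_left[of \<one> \<one> h] T.l_cancel_one' by auto

lemma tensor_one_right [simp]: "g \<in> carrier G \<Longrightarrow> tensor G g \<one> = \<one>\<^bsub>T\<^esub>"
  using tensor_mult_right[of g \<one> \<one>] by auto

text \<open>The action \<open>x \<cdot> (g \<otimes> h) = x g x\<^sup>-\<^sup>1 \<otimes> x h x\<^sup>-\<^sup>1\<close> of \<open>G\<close> on \<open>T\<close>. The universal property provides such a
  homomorphism for each \<open>x\<close>, and it is unique on the carrier of \<open>T\<close>.\<close>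

definition act :: "'a \<Rightarrow> ('a \<times> 'a) gword set \<Rightarrow> ('a \<times> 'a) gword set" where
  "act x = (SOME \<phi>. \<phi> \<in> hom T T \<and> (\<forall>g\<in>carrier G. \<forall>h\<in>carrier G.
     \<phi> (tensor G g h) = tensor G (conj_by G x g) (conj_by G x h)))"

text \<open>The crossed module map \<open>g \<otimes> h \<mapsto> g h g\<^sup>-\<^sup>1 h\<^sup>-\<^sup>1\<close>, denoted \<open>\<kappa>\<close> in the comments.\<close>

definition comm_map :: "('a \<times> 'a) gword set \<Rightarrow> 'a" where
  "comm_map = (SOME \<phi>. \<phi> \<in> hom T G \<and> (\<forall>g\<in>carrier G. \<forall>h\<in>carrier G.
     \<phi> (tensor G g h) = g \<otimes> h \<otimes> inv g \<otimes> inv h))"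

lemma act_props:
  assumes x: "x \<in> carrier G"
  shows "act x \<in> hom T T \<and> (\<forall>g\<in>carrier G. \<forall>h\<in>carrier G.
     act x (tensor G g h) = tensor G (conj_by G x g) (conj_by G x h))"
proof -
  have cc: "conj_by G x (conj_by G y g) = conj_by G (conj_by G x y) (conj_by G x g)"
    if "y \<in> carrier G" "g \<in> carrier G" for y g
    using that x by (simp add: conj_by_conj_by conj_by_mult_self)
  have "\<exists>\<phi>. \<phi> \<in> hom T T \<and> (\<forall>g\<in>carrier G. \<forall>h\<in>carrier G.
     \<phi> (tensor G g h) = tensor G (conj_by G x g) (conj_by G x h))"
    by (rule tensor_universal[OF T.is_group])
      (use x in \<open>simp_all add: conj_by_mult tensor_mult_left tensor_mult_right cc[symmetric]\<close>)
  then show ?thesis unfolding act_def by (rule someI_ex)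
qed

lemma act_hom: "x \<in> carrier G \<Longrightarrow> act x \<in> hom T T"
  and act_tensor: "x \<in> carrier G \<Longrightarrow> g \<in> carrier G \<Longrightarrow> h \<in> carrier G \<Longrightarrow>
     act x (tensor G g h) = tensor G (conj_by G x g) (conj_by G x h)"
  using act_props by auto

lemma group_hom_act: "x \<in> carrier G \<Longrightarrow> group_hom T T (act x)"
  using act_hom T.is_group by (simp add: group_hom_def group_hom_axioms_def)

lemma act_closed [simp]: "x \<in> carrier G \<Longrightarrow> t \<in> carrier T \<Longrightarrow> act x t \<in> carrier T"
  using act_hom by (auto simp: hom_def)

lemma act_mult: "x \<in> carrier G \<Longrightarrow> s \<in> carrier T \<Longrightarrow> t \<in> carrier T \<Longrightarrow>
    act x (s \<otimes>\<^bsub>T\<^esub> t) = act x s \<otimes>\<^bsub>T\<^esub> act x t"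
  using act_hom by (auto simp: hom_def)

lemma act_inv: "x \<in> carrier G \<Longrightarrow> t \<in> carrier T \<Longrightarrow> act x (inv\<^bsub>T\<^esub> t) = inv\<^bsub>T\<^esub> act x t"
  using group_hom_act[of x] by (simp add: group_hom.hom_inv)

lemma act_act:
  assumes "x \<in> carrier G" "y \<in> carrier G" "t \<in> carrier T"
  shows "act x (act y t) = act (x \<otimes> y) t"
proof -
  have "(act x \<circ> act y) t = act (x \<otimes> y) t"
    by (rule tensor_hom_eq[OF T.is_group Group.hom_compose[OF act_hom act_hom] act_hom])
      (use assms in \<open>auto simp: act_tensor conj_by_conj_by\<close>)
  then show ?thesis by simp
qed

lemma act_one [simp]: "t \<in> carrier T \<Longrightarrow> act \<one> t = t"
  using tensor_hom_eq[OF T.is_group act_hom[of \<one>], of "\<lambda>x. x" t] by (simp add: act_tensor hom_def)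

lemma comm_map_props:
  "comm_map \<in> hom T G \<and> (\<forall>g\<in>carrier G. \<forall>h\<in>carrier G. comm_map (tensor G g h) = g \<otimes> h \<otimes> inv g \<otimes> inv h)"
proof -
  have c: "a \<otimes> (inv a \<otimes> b) = b" "inv a \<otimes> (a \<otimes> b) = b" if "a \<in> carrier G" "b \<in> carrier G" for a b
    using that by (simp_all flip: m_assoc)
  have "\<exists>\<phi>. \<phi> \<in> hom T G \<and> (\<forall>g\<in>carrier G. \<forall>h\<in>carrier G. \<phi> (tensor G g h) = g \<otimes> h \<otimes> inv g \<otimes> inv h)"
    by (rule tensor_universal[OF is_group]) (simp_all add: conj_by_def inv_mult_group m_assoc c)
  then show ?thesis unfolding comm_map_def by (rule someI_ex)
qed

lemma comm_map_hom: "comm_map \<in> hom T G"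
  and comm_map_tensor: "g \<in> carrier G \<Longrightarrow> h \<in> carrier G \<Longrightarrow> comm_map (tensor G g h) = g \<otimes> h \<otimes> inv g \<otimes> inv h"
  using comm_map_props by auto

lemma group_hom_comm_map: "group_hom T G comm_map"
  using comm_map_hom T.is_group is_group by (simp add: group_hom_def group_hom_axioms_def)

interpretation \<kappa>: group_hom T G comm_map by (rule group_hom_comm_map)

lemma comm_map_image: "comm_map ` carrier T = derived G (carrier G)"
proof
  have "carrier T = {t \<in> carrier T. comm_map t \<in> derived G (carrier G)}"
  proof (rule tensor_generates)
    have D: "subgroup (derived G (carrier G)) G" by (rule derived_is_subgroup) simp
    show "subgroup {t \<in> carrier T. comm_map t \<in> derived G (carrier G)} T"
      by (rule T.subgroupI) (use D subgroup.one_closed[OF D] \<kappa>.hom_one T.one_closed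
        in \<open>auto simp: subgroup.m_closed subgroup.m_inv_closed\<close>)
    show "tensor G g h \<in> {t \<in> carrier T. comm_map t \<in> derived G (carrier G)}"
      if "g \<in> carrier G" "h \<in> carrier G" for g h
      using that by (auto simp: comm_map_tensor derived_def intro!: generate.incl)
  qed
  then show "comm_map ` carrier T \<subseteq> derived G (carrier G)" by blast
  show "derived G (carrier G) \<subseteq> comm_map ` carrier T"
    unfolding derived_def
  proof (rule generate_subgroup_incl)
    show "subgroup (comm_map ` carrier T) G" using \<kappa>.img_is_subgroup .
    show "(\<Union>h1\<in>carrier G. \<Union>h2\<in>carrier G. {h1 \<otimes> h2 \<otimes> inv h1 \<otimes> inv h2}) \<subseteq> comm_map ` carrier T"
    proof safe
      fix g h assume "g \<in> carrier G" "h \<in> carrier G"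
      then show "g \<otimes> h \<otimes> inv g \<otimes> inv h \<in> comm_map ` carrier T"
        by (intro image_eqI[of _ _ "tensor G g h"]) (auto simp: comm_map_tensor)
    qed
  qed
qed

text \<open>Expand \<open>g a \<otimes> h b\<close> in the two possible orders. The outer factors agree, and comparing the inner
  ones gives the claim for \<open>s = a \<otimes> b\<close>. It extends to all \<open>s\<close>, since \<open>s \<mapsto> g h \<cdot> s\<close> and
  \<open>s \<mapsto> (g \<otimes> h) (h g \<cdot> s) (g \<otimes> h)\<^sup>-\<^sup>1\<close> are homomorphisms.\<close>

lemma tensor_square_commutation:
  assumes gh: "g \<in> carrier G" "h \<in> carrier G" and s: "s \<in> carrier T"
  shows "act (g \<otimes> h) s \<otimes>\<^bsub>T\<^esub> tensor G g h = tensor G g h \<otimes>\<^bsub>T\<^esub> act (h \<otimes> g) s"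
proof -
  let ?t = "tensor G g h"
  have gen: "act (g \<otimes> h) (tensor G a b) \<otimes>\<^bsub>T\<^esub> ?t = ?t \<otimes>\<^bsub>T\<^esub> act (h \<otimes> g) (tensor G a b)"
    if ab: "a \<in> carrier G" "b \<in> carrier G" for a b
  proof -
    define A where "A = tensor G (conj_by G g a) (conj_by G g h)"
    define B where "B = tensor G (conj_by G h g) (conj_by G h b)"
    have AB: "A \<in> carrier T" "B \<in> carrier T" using gh ab by (auto simp: A_def B_def)
    have X: "act (g \<otimes> h) (tensor G a b) \<in> carrier T" "act (h \<otimes> g) (tensor G a b) \<in> carrier T" "?t \<in> carrier T"
      using gh ab by auto
    have "tensor G (g \<otimes> a) (h \<otimes> b) = (A \<otimes>\<^bsub>T\<^esub> act (g \<otimes> h) (tensor G a b)) \<otimes>\<^bsub>T\<^esub> (?t \<otimes>\<^bsub>T\<^esub> B)"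
      unfolding A_def B_def using gh ab
      by (subst tensor_mult_left) (simp_all add: tensor_mult_right conj_by_mult conj_by_conj_by conj_by_mult_self act_tensor)
    moreover have "tensor G (g \<otimes> a) (h \<otimes> b) = (A \<otimes>\<^bsub>T\<^esub> ?t) \<otimes>\<^bsub>T\<^esub> (act (h \<otimes> g) (tensor G a b) \<otimes>\<^bsub>T\<^esub> B)"
      unfolding A_def B_def using gh ab
      by (subst tensor_mult_right) (simp_all add: tensor_mult_left conj_by_mult conj_by_conj_by conj_by_mult_self act_tensor)
    ultimately have "A \<otimes>\<^bsub>T\<^esub> ((act (g \<otimes> h) (tensor G a b) \<otimes>\<^bsub>T\<^esub> ?t) \<otimes>\<^bsub>T\<^esub> B)
        = A \<otimes>\<^bsub>T\<^esub> ((?t \<otimes>\<^bsub>T\<^esub> act (h \<otimes> g) (tensor G a b)) \<otimes>\<^bsub>T\<^esub> B)"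
      using AB X by (simp add: T.m_assoc)
    then show ?thesis using AB X by simp
  qed
  have t: "?t \<in> carrier T" using gh by simp
  let ?\<psi> = "\<lambda>s. ?t \<otimes>\<^bsub>T\<^esub> act (h \<otimes> g) s \<otimes>\<^bsub>T\<^esub> inv\<^bsub>T\<^esub> ?t"
  have "act (g \<otimes> h) s = ?\<psi> s"
  proof (rule tensor_hom_eq[OF T.is_group act_hom _ _ s])
    show "?\<psi> \<in> hom T T"
      by (rule homI) (use gh t in \<open>auto simp: act_mult T.conj_mult\<close>)
    show "act (g \<otimes> h) (tensor G a b) = ?\<psi> (tensor G a b)" if "a \<in> carrier G" "b \<in> carrier G" for a b
      using gen[OF that] gh that t by (simp add: T.inv_solve_right)
  qed (use gh in simp)
  then show ?thesis using gh t s by (simp add: T.m_assoc)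
qed

text \<open>For \<open>t = g \<otimes> h\<close> this is \<open>tensor_square_commutation\<close> with \<open>s\<close> replaced by \<open>(h g)\<^sup>-\<^sup>1 \<cdot> s\<close>, because
  \<open>g h (h g)\<^sup>-\<^sup>1\<close> is the commutator. The elements \<open>t\<close> that satisfy the identity form a subgroup.\<close>

lemma peiffer:
  assumes t: "t \<in> carrier T" and s: "s \<in> carrier T"
  shows "t \<otimes>\<^bsub>T\<^esub> s \<otimes>\<^bsub>T\<^esub> inv\<^bsub>T\<^esub> t = act (comm_map t) s"
proof -
  define K where "K = {t \<in> carrier T. \<forall>s\<in>carrier T. t \<otimes>\<^bsub>T\<^esub> s \<otimes>\<^bsub>T\<^esub> inv\<^bsub>T\<^esub> t = act (comm_map t) s}"
  have "carrier T = K"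
  proof (rule tensor_generates)
    show "subgroup K T"
    proof (rule T.subgroupI)
      show "K \<subseteq> carrier T" "K \<noteq> {}" by (auto simp: K_def intro!: exI[of _ "\<one>\<^bsub>T\<^esub>"])
      show "a \<otimes>\<^bsub>T\<^esub> b \<in> K" if ab: "a \<in> K" "b \<in> K" for a b
        using ab by (auto simp: K_def T.conj_conj[symmetric] act_act)
      show "inv\<^bsub>T\<^esub> a \<in> K" if a: "a \<in> K" for a
      proof -
        have ac: "a \<in> carrier T" using a by (simp add: K_def)
        have "inv\<^bsub>T\<^esub> a \<otimes>\<^bsub>T\<^esub> s \<otimes>\<^bsub>T\<^esub> inv\<^bsub>T\<^esub> (inv\<^bsub>T\<^esub> a) = act (comm_map (inv\<^bsub>T\<^esub> a)) s"
          if s: "s \<in> carrier T" for s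
        proof -
          define r where "r = act (inv (comm_map a)) s"
          have r: "r \<in> carrier T" "s = act (comm_map a) r"
            using s ac by (simp_all add: r_def act_act)
          then have "s = a \<otimes>\<^bsub>T\<^esub> r \<otimes>\<^bsub>T\<^esub> inv\<^bsub>T\<^esub> a" using a by (simp add: K_def)
          then show ?thesis using ac r(1) T.conj_conj[of "inv\<^bsub>T\<^esub> a" a r] by (simp add: r_def)
        qed
        then show ?thesis using ac by (simp add: K_def)
      qed
    qed
    show "tensor G g h \<in> K" if gh: "g \<in> carrier G" "h \<in> carrier G" for g h
    proof -
      have "tensor G g h \<otimes>\<^bsub>T\<^esub> s \<otimes>\<^bsub>T\<^esub> inv\<^bsub>T\<^esub> tensor G g h = act (comm_map (tensor G g h)) s"
        if s: "s \<in> carrier T" for s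
      proof -
        have e: "g \<otimes> h \<otimes> inv (h \<otimes> g) = g \<otimes> h \<otimes> inv g \<otimes> inv h"
          using gh by (simp add: inv_mult_group m_assoc)
        have "act (g \<otimes> h) (act (inv (h \<otimes> g)) s) \<otimes>\<^bsub>T\<^esub> tensor G g h
           = tensor G g h \<otimes>\<^bsub>T\<^esub> act (h \<otimes> g) (act (inv (h \<otimes> g)) s)"
          by (rule tensor_square_commutation) (use gh s in auto)
        then have "act (comm_map (tensor G g h)) s \<otimes>\<^bsub>T\<^esub> tensor G g h = tensor G g h \<otimes>\<^bsub>T\<^esub> s"
          using gh s by (simp add: act_act comm_map_tensor e)
        then have "tensor G g h \<otimes>\<^bsub>T\<^esub> s \<otimes>\<^bsub>T\<^esub> inv\<^bsub>T\<^esub> tensor G g h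
           = act (comm_map (tensor G g h)) s \<otimes>\<^bsub>T\<^esub> tensor G g h \<otimes>\<^bsub>T\<^esub> inv\<^bsub>T\<^esub> tensor G g h" by simp
        then show ?thesis using gh s by (simp add: T.m_assoc)
      qed
      then show ?thesis using gh by (simp add: K_def)
    qed
  qed
  then show ?thesis using t s by (auto simp: K_def)
qed

end

context group
begin

interpretation T: group T by (rule group_tensor_square)
interpretation \<kappa>: group_hom T G comm_map by (rule group_hom_comm_map)

lemma tensor_inv_left:
  assumes "g \<in> carrier G" "h \<in> carrier G"
  shows "tensor G (inv g) h = inv\<^bsub>T\<^esub> act (inv g) (tensor G g h)"
proof -
  have "act (inv g) (tensor G g h) \<otimes>\<^bsub>T\<^esub> tensor G (inv g) h = \<one>\<^bsub>T\<^esub>"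
    using tensor_mult_left[of "inv g" g h] assms by (simp add: act_tensor)
  then show ?thesis using assms T.inv_equality[of "act (inv g) (tensor G g h)" "tensor G (inv g) h"]
    by (metis T.inv_inv T.inv_equality act_closed inv_closed tensor_closed)
qed

section \<open>Central kernel and commutativity of the tensor square\<close>

text \<open>Write the commutator as \<open>g k\<close> with \<open>k = h g\<^sup>-\<^sup>1 h\<^sup>-\<^sup>1\<close> and expand on the left. The factor that contains
  \<open>k\<close> is, by the rule for inverses and \<open>peiffer\<close>, the conjugate by \<open>g \<otimes> h\<close> of the inverse of
  \<open>c = (h g h\<^sup>-\<^sup>1) \<otimes> x\<close>. Expanding \<open>g \<otimes> x h = g \<otimes> h y\<close>, with \<open>y = h\<^sup>-\<^sup>1 x h\<close>, in two ways eliminates \<open>c\<close>.\<close>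

lemma tensor_commutator:
  assumes gh: "g \<in> carrier G" "h \<in> carrier G" and x: "x \<in> carrier G"
  shows "tensor G (g \<otimes> h \<otimes> inv g \<otimes> inv h) x
    = tensor G g h \<otimes>\<^bsub>T\<^esub> inv\<^bsub>T\<^esub> act x (tensor G g h)"
proof -
  let ?t = "tensor G g h" and ?z = "g \<otimes> h \<otimes> inv g \<otimes> inv h"
  define y where "y = conj_by G (inv h) x"
  define c where "c = tensor G (conj_by G h g) x"
  define k where "k = conj_by G h (inv g)"
  have cl: "y \<in> carrier G" "c \<in> carrier T" "k \<in> carrier G" "?t \<in> carrier T" "tensor G g x \<in> carrier T"
    "act x ?t \<in> carrier T" "?z \<in> carrier G"
    using gh x by (auto simp: y_def c_def k_def)
  have yx: "conj_by G h y = x" using gh x by (simp add: y_def conj_by_conj_by)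
  have "act g (tensor G k x) = inv\<^bsub>T\<^esub> act ?z c"
  proof -
    have "tensor G k x = act h (tensor G (inv g) y)"
      using gh cl by (simp add: act_tensor k_def yx)
    also have "\<dots> = inv\<^bsub>T\<^esub> act (h \<otimes> inv g) (tensor G g y)"
      using gh cl by (simp add: tensor_inv_left act_inv act_act)
    finally have "act g (tensor G k x) = inv\<^bsub>T\<^esub> act (g \<otimes> h \<otimes> inv g) (tensor G g y)"
      using gh cl by (simp add: act_inv act_act m_assoc)
    also have "act (g \<otimes> h \<otimes> inv g) (tensor G g y) = act ?z (act h (tensor G g y))"
      using gh cl by (simp add: act_act m_assoc)
    also have "act h (tensor G g y) = c" using gh cl by (simp add: act_tensor c_def yx)
    finally show ?thesis .
  qed
  also have "act ?z c = ?t \<otimes>\<^bsub>T\<^esub> c \<otimes>\<^bsub>T\<^esub> inv\<^bsub>T\<^esub> ?t"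
    using peiffer[OF cl(4,2)] gh by (simp add: comm_map_tensor)
  finally have k: "act g (tensor G k x) = inv\<^bsub>T\<^esub> (?t \<otimes>\<^bsub>T\<^esub> c \<otimes>\<^bsub>T\<^esub> inv\<^bsub>T\<^esub> ?t)" .
  have hy: "h \<otimes> y = x \<otimes> h" using conj_by_mult_self[of h y] yx gh cl by simp
  have two: "?t \<otimes>\<^bsub>T\<^esub> c = tensor G g x \<otimes>\<^bsub>T\<^esub> act x ?t"
    using tensor_mult_right[of g h y] tensor_mult_right[of g x h] gh x cl
    by (simp add: hy yx c_def act_tensor)
  have "?z = g \<otimes> k" using gh by (simp add: k_def conj_by_def m_assoc)
  then have "tensor G ?z x = act g (tensor G k x) \<otimes>\<^bsub>T\<^esub> tensor G g x"
    using gh x cl by (simp add: tensor_mult_left act_tensor)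
  also have "\<dots> = ?t \<otimes>\<^bsub>T\<^esub> inv\<^bsub>T\<^esub> (?t \<otimes>\<^bsub>T\<^esub> c) \<otimes>\<^bsub>T\<^esub> tensor G g x"
    unfolding k using cl by (simp add: T.inv_mult_group T.m_assoc)
  also have "\<dots> = ?t \<otimes>\<^bsub>T\<^esub> inv\<^bsub>T\<^esub> act x ?t"
    unfolding two using cl by (simp add: T.inv_mult_group T.m_assoc)
  finally show ?thesis .
qed

text \<open>By \<open>peiffer\<close>, both sides obey the rule \<open>f (a b) = a (f b) a\<^sup>-\<^sup>1 (f a)\<close>, so the elements for which they
  agree form a subgroup, and it contains the symbols by \<open>tensor_commutator\<close>.\<close>

lemma tensor_comm_map:
  assumes t: "t \<in> carrier T" and x: "x \<in> carrier G"
  shows "tensor G (comm_map t) x = t \<otimes>\<^bsub>T\<^esub> inv\<^bsub>T\<^esub> act x t"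
proof -
  define K where "K = {t \<in> carrier T. tensor G (comm_map t) x = t \<otimes>\<^bsub>T\<^esub> inv\<^bsub>T\<^esub> act x t}"
  have step: "tensor G (comm_map a \<otimes> comm_map b) x
     = a \<otimes>\<^bsub>T\<^esub> tensor G (comm_map b) x \<otimes>\<^bsub>T\<^esub> inv\<^bsub>T\<^esub> a \<otimes>\<^bsub>T\<^esub> tensor G (comm_map a) x"
    if "a \<in> carrier T" "b \<in> carrier T" for a b
    using that x by (simp add: tensor_mult_left peiffer act_tensor)
  have "carrier T = K"
  proof (rule tensor_generates)
    show "subgroup K T"
    proof (rule T.subgroupI)
      have "\<one>\<^bsub>T\<^esub> \<in> K" using x group_hom.hom_one[OF group_hom_act] by (simp add: K_def)
      then show "K \<noteq> {}" by auto
      show "K \<subseteq> carrier T" by (auto simp: K_def)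
      show "a \<otimes>\<^bsub>T\<^esub> b \<in> K" if ab: "a \<in> K" "b \<in> K" for a b
      proof -
        have c: "a \<in> carrier T" "b \<in> carrier T" "act x a \<in> carrier T" "act x b \<in> carrier T"
          using ab x by (auto simp: K_def)
        then have "tensor G (comm_map a \<otimes> comm_map b) x = (a \<otimes>\<^bsub>T\<^esub> b) \<otimes>\<^bsub>T\<^esub> inv\<^bsub>T\<^esub> (act x a \<otimes>\<^bsub>T\<^esub> act x b)"
          using step[OF c(1,2)] ab by (simp add: K_def T.m_assoc T.inv_mult_group)
            (simp flip: T.m_assoc)
        then show ?thesis using c x by (simp add: K_def act_mult)
      qed
      show "inv\<^bsub>T\<^esub> a \<in> K" if a: "a \<in> K" for a
      proof -
        have c: "a \<in> carrier T" "act x a \<in> carrier T" using a x by (auto simp: K_def)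
        define e where "e = tensor G (inv (comm_map a)) x"
        have e: "e \<in> carrier T" using c x by (simp add: e_def)
        have "inv\<^bsub>T\<^esub> a \<otimes>\<^bsub>T\<^esub> (a \<otimes>\<^bsub>T\<^esub> inv\<^bsub>T\<^esub> act x a) \<otimes>\<^bsub>T\<^esub> a \<otimes>\<^bsub>T\<^esub> e = \<one>\<^bsub>T\<^esub>"
          using step[of "inv\<^bsub>T\<^esub> a" a] a c x by (simp add: K_def e_def)
        then have "inv\<^bsub>T\<^esub> (inv\<^bsub>T\<^esub> a \<otimes>\<^bsub>T\<^esub> act x a) \<otimes>\<^bsub>T\<^esub> e = \<one>\<^bsub>T\<^esub>"
          using c e by (simp add: T.inv_mult_group T.m_assoc) (simp flip: T.m_assoc)
        then have "e = inv\<^bsub>T\<^esub> a \<otimes>\<^bsub>T\<^esub> act x a"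
          using c e by (metis T.inv_closed T.inv_equality T.inv_inv T.m_closed)
        then show ?thesis using c x by (simp add: K_def e_def act_inv)
      qed
    qed
    show "tensor G g h \<in> K" if "g \<in> carrier G" "h \<in> carrier G" for g h
      using that x by (simp add: K_def comm_map_tensor tensor_commutator)
  qed
  then show ?thesis using t by (auto simp: K_def)
qed

text \<open>The left-hand side of \<open>tensor_comm_map\<close> depends on \<open>t\<close> only through \<open>\<kappa> t\<close>, so for \<open>\<kappa> t = \<one>\<close> it is
  \<open>\<one> \<otimes> x\<close>, which is trivial.\<close>

lemma act_comm_map_kernel:
  assumes "t \<in> carrier T" "comm_map t = \<one>" "x \<in> carrier G"
  shows "act x t = t"
proof -
  have "\<one>\<^bsub>T\<^esub> = t \<otimes>\<^bsub>T\<^esub> inv\<^bsub>T\<^esub> act x t" using tensor_comm_map[of t x] assms by simp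
  then show ?thesis using assms by (metis T.inv_closed T.inv_equality T.inv_inv act_closed)
qed

lemma comm_map_kernel_central:
  assumes "j \<in> carrier T" "comm_map j = \<one>" "t \<in> carrier T"
  shows "j \<otimes>\<^bsub>T\<^esub> t = t \<otimes>\<^bsub>T\<^esub> j"
  using peiffer[OF assms(1,3)] assms T.conj_eq_iff[of j t] by simp

text \<open>The kernel of \<open>\<kappa>\<close> is central and the quotient by it is cyclic: every element is a power of a
  preimage \<open>s\<close> of \<open>z\<close> times a central element.\<close>

lemma tensor_square_comm:
  assumes z: "\<And>c. c \<in> derived G (carrier G) \<Longrightarrow> \<exists>k::int. c = z [^] k" "z \<in> derived G (carrier G)"
  shows "comm_group T"
proof -
  obtain s where s: "s \<in> carrier T" "comm_map s = z"
    using z(2) unfolding comm_map_image[symmetric] by blast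
  have split: "t \<in> K" if K: "subgroup K T" "s \<in> K" "\<And>j. j \<in> carrier T \<Longrightarrow> comm_map j = \<one> \<Longrightarrow> j \<in> K"
    and t: "t \<in> carrier T" for K t
  proof -
    have "comm_map t \<in> derived G (carrier G)" using t comm_map_image by blast
    then obtain k :: int where k: "comm_map t = z [^] k" using z(1) by blast
    let ?j = "inv\<^bsub>T\<^esub> (s [^]\<^bsub>T\<^esub> k) \<otimes>\<^bsub>T\<^esub> t"
    have "comm_map ?j = \<one>" using s t k by (simp add: \<kappa>.hom_int_pow) (metis \<kappa>.hom_closed int_pow_closed l_inv)
    then have "?j \<in> K" using s t by (intro K(3)) auto
    then have "s [^]\<^bsub>T\<^esub> k \<otimes>\<^bsub>T\<^esub> ?j \<in> K"
      by (rule subgroup.m_closed[OF K(1) T.subgroup_int_pow_closed[OF K(1,2)]])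
    then show ?thesis using s t by (simp flip: T.m_assoc)
  qed
  have com: "a \<otimes>\<^bsub>T\<^esub> b = b \<otimes>\<^bsub>T\<^esub> a" if b: "b \<in> carrier T" "s \<otimes>\<^bsub>T\<^esub> b = b \<otimes>\<^bsub>T\<^esub> s" and a: "a \<in> carrier T" for a b
  proof -
    have "a \<in> {g \<in> carrier T. \<forall>h\<in>{b}. g \<otimes>\<^bsub>T\<^esub> h \<otimes>\<^bsub>T\<^esub> inv\<^bsub>T\<^esub> g = h}" (is "a \<in> ?C")
    proof (rule split[OF _ _ _ a])
      show "subgroup ?C T" by (rule T.centralizer_subgroup) (use b in simp)
      show "s \<in> ?C" using b s T.conj_eq_iff[of s b] by simp
      show "j \<in> ?C" if "j \<in> carrier T" "comm_map j = \<one>" for j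
        using that b comm_map_kernel_central[of j b] T.conj_eq_iff[of j b] by simp
    qed
    then have "a \<otimes>\<^bsub>T\<^esub> b \<otimes>\<^bsub>T\<^esub> inv\<^bsub>T\<^esub> a = b" by simp
    then show ?thesis using a b T.conj_eq_iff[of a b] by simp
  qed
  show ?thesis
    by (rule T.group_comm_groupI) (use com s in metis)
qed

section \<open>Splitting off the coinvariants\<close>

text \<open>The kernel of the projection from \<open>T\<close> to its coinvariants under \<open>G\<close>.\<close>

definition coinv_ker :: "('a \<times> 'a) gword set set" where
  "coinv_ker = generate T {t \<otimes>\<^bsub>T\<^esub> inv\<^bsub>T\<^esub> act x t | t x. t \<in> carrier T \<and> x \<in> carrier G}"

lemma coinv_ker_subgroup: "subgroup coinv_ker T"
  unfolding coinv_ker_def by (rule T.generate_is_subgroup) auto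

lemma coinv_ker_generator: "t \<in> carrier T \<Longrightarrow> x \<in> carrier G \<Longrightarrow> t \<otimes>\<^bsub>T\<^esub> inv\<^bsub>T\<^esub> act x t \<in> coinv_ker"
  unfolding coinv_ker_def by (rule generate.incl) blast

lemma coinv_ker_minimal:
  assumes "subgroup K T" "\<And>t x. t \<in> carrier T \<Longrightarrow> x \<in> carrier G \<Longrightarrow> t \<otimes>\<^bsub>T\<^esub> inv\<^bsub>T\<^esub> act x t \<in> K"
  shows "coinv_ker \<subseteq> K"
  unfolding coinv_ker_def by (rule T.generate_subgroup_incl) (use assms in auto)

lemma hom_comm_group_derived:
  assumes B: "comm_group B" and f: "f \<in> hom G B" and c: "c \<in> derived G (carrier G)"
  shows "f c = \<one>\<^bsub>B\<^esub>"
proof -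
  interpret B: comm_group B by fact
  interpret f: group_hom G B f by unfold_locales fact
  have "derived G (carrier G) \<subseteq> kernel G B f" unfolding derived_def
  proof (rule generate_subgroup_incl[OF _ f.subgroup_kernel], safe)
    fix g h assume gh: "g \<in> carrier G" "h \<in> carrier G"
    then have "f (g \<otimes> h \<otimes> inv g \<otimes> inv h) = (f g \<otimes>\<^bsub>B\<^esub> f h) \<otimes>\<^bsub>B\<^esub> inv\<^bsub>B\<^esub> (f g \<otimes>\<^bsub>B\<^esub> f h)"
      by (simp add: B.inv_mult B.m_assoc)
    also have "\<dots> = \<one>\<^bsub>B\<^esub>" using gh by (intro B.r_inv) simp
    finally show "g \<otimes> h \<otimes> inv g \<otimes> inv h \<in> kernel G B f" using gh by (simp add: kernel_def)
  qed
  then show ?thesis using c by (auto simp: kernel_def)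
qed

lemma pow_index_derived:
  assumes "g \<in> carrier G"
  shows "g [^] card (rcosets (derived G (carrier G))) \<in> derived G (carrier G)"
proof -
  let ?D = "derived G (carrier G)"
  interpret D: normal ?D G by (rule derived_self_is_normal)
  interpret Q: group "G Mod ?D" by (rule D.factorgroup_is_group)
  let ?n = "card (rcosets ?D)"
  have "(?D #> g) [^]\<^bsub>G Mod ?D\<^esub> ?n = ?D"
    using Q.pow_order_eq_1[of "?D #> g"] assms by (simp add: order_def FactGroup_def RCOSETS_def)
      blast
  then have "?D #> (g [^] ?n) = ?D" using assms by (simp add: D.FactGroup_pow)
  then show ?thesis using assms D.subgroup_axioms by (metis nat_pow_closed rcos_self)
qed

context
  fixes z
  assumes z: "\<And>c. c \<in> derived G (carrier G) \<Longrightarrow> \<exists>k::int. c = z [^] k" "z \<in> derived G (carrier G)"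
begin

interpretation T: comm_group T by (rule tensor_square_comm[OF z])

interpretation M: normal coinv_ker T by (rule T.subgroup_imp_normal[OF coinv_ker_subgroup])

interpretation B: comm_group "T Mod coinv_ker" by (rule T.abelian_FactGroup[OF coinv_ker_subgroup])

abbreviation "pairing g h \<equiv> coinv_ker #>\<^bsub>T\<^esub> tensor G g h"

lemma coset_closed [simp]: "t \<in> carrier T \<Longrightarrow> coinv_ker #>\<^bsub>T\<^esub> t \<in> carrier (T Mod coinv_ker)"
  by (auto simp: carrier_FactGroup)

lemma coset_act: "t \<in> carrier T \<Longrightarrow> x \<in> carrier G \<Longrightarrow> coinv_ker #>\<^bsub>T\<^esub> act x t = coinv_ker #>\<^bsub>T\<^esub> t"
  using coinv_ker_generator[of t x] T.repr_independence[OF _ _ coinv_ker_subgroup]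
  by (metis M.rcos_module T.is_group act_closed subgroup.rcos_module coinv_ker_subgroup T.rcos_self)

lemma coset_mult: "s \<in> carrier T \<Longrightarrow> t \<in> carrier T \<Longrightarrow>
    coinv_ker #>\<^bsub>T\<^esub> (s \<otimes>\<^bsub>T\<^esub> t) = (coinv_ker #>\<^bsub>T\<^esub> s) \<otimes>\<^bsub>T Mod coinv_ker\<^esub> (coinv_ker #>\<^bsub>T\<^esub> t)"
  using M.rcos_sum by simp

lemma pairing_hom_left: "h \<in> carrier G \<Longrightarrow> (\<lambda>g. pairing g h) \<in> hom G (T Mod coinv_ker)"
proof (rule homI)
  fix g1 g assume g: "h \<in> carrier G" "g1 \<in> carrier G" "g \<in> carrier G"
  then have "pairing (g1 \<otimes> g) h = (coinv_ker #>\<^bsub>T\<^esub> act g1 (tensor G g h)) \<otimes>\<^bsub>T Mod coinv_ker\<^esub> pairing g1 h"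
    by (simp add: tensor_mult_left coset_mult act_tensor del: mult_FactGroup)
  also have "\<dots> = pairing g1 h \<otimes>\<^bsub>T Mod coinv_ker\<^esub> pairing g h"
    using g by (simp add: coset_act B.m_comm del: mult_FactGroup)
  finally show "pairing (g1 \<otimes> g) h = pairing g1 h \<otimes>\<^bsub>T Mod coinv_ker\<^esub> pairing g h" .
qed simp

lemma pairing_hom_right: "g \<in> carrier G \<Longrightarrow> (\<lambda>h. pairing g h) \<in> hom G (T Mod coinv_ker)"
proof (rule homI)
  fix h1 h assume g: "g \<in> carrier G" "h1 \<in> carrier G" "h \<in> carrier G"
  then have "pairing g (h1 \<otimes> h) = pairing g h1 \<otimes>\<^bsub>T Mod coinv_ker\<^esub> (coinv_ker #>\<^bsub>T\<^esub> act h1 (tensor G g h))"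
    by (simp add: tensor_mult_right coset_mult act_tensor del: mult_FactGroup)
  then show "pairing g (h1 \<otimes> h) = pairing g h1 \<otimes>\<^bsub>T Mod coinv_ker\<^esub> pairing g h"
    using g by (simp add: coset_act del: mult_FactGroup)
qed simp

text \<open>Modulo \<open>coinv_ker\<close> the symbol \<open>g \<otimes> h\<close> is bimultiplicative and vanishes for \<open>g\<close> in the commutator
  subgroup \<open>D\<close>, so its power with exponent \<open>n = \<bar>G : D\<bar>\<close> is trivial. Hence \<open>n\<close>-th powers of elements of
  \<open>D\<close> are in the image of \<open>coinv_ker\<close>, and \<open>n\<close> is prime to \<open>\<bar>D\<bar>\<close>.\<close>

lemma comm_map_coinv_ker:
  assumes co: "coprime (card (rcosets (derived G (carrier G)))) (card (derived G (carrier G)))"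
  shows "derived G (carrier G) \<subseteq> comm_map ` coinv_ker"
proof
  fix c assume c: "c \<in> derived G (carrier G)"
  let ?D = "derived G (carrier G)"
  let ?n = "card (rcosets ?D)"
  have D: "subgroup ?D G" by (rule derived_is_subgroup) simp
  interpret D: group "G\<lparr>carrier := ?D\<rparr>" using D by (rule subgroup_imp_group)
  have "carrier T = {t \<in> carrier T. t [^]\<^bsub>T\<^esub> ?n \<in> coinv_ker}"
  proof (rule tensor_generates)
    show "subgroup {t \<in> carrier T. t [^]\<^bsub>T\<^esub> ?n \<in> coinv_ker} T"
      by (rule T.subgroupI)
        (use subgroup.one_closed[OF coinv_ker_subgroup] subgroup.m_closed[OF coinv_ker_subgroup]
          subgroup.m_inv_closed[OF coinv_ker_subgroup] T.nat_pow_one T.one_closed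
          in \<open>auto simp: T.nat_pow_distrib T.nat_pow_inv\<close>)
    fix g h assume gh: "g \<in> carrier G" "h \<in> carrier G"
    interpret b: group_hom G "T Mod coinv_ker" "\<lambda>g. pairing g h"
      by unfold_locales (rule pairing_hom_left[OF gh(2)])
    have "coinv_ker #>\<^bsub>T\<^esub> (tensor G g h [^]\<^bsub>T\<^esub> ?n) = (pairing g h) [^]\<^bsub>T Mod coinv_ker\<^esub> ?n"
      using gh by (simp add: M.FactGroup_pow)
    also have "\<dots> = pairing (g [^] ?n) h" using b.hom_nat_pow[OF gh(1)] by simp
    also have "\<dots> = coinv_ker"
      using hom_comm_group_derived[OF B.comm_group_axioms pairing_hom_left[OF gh(2)] pow_index_derived[OF gh(1)]]
      by simp
    finally show "tensor G g h \<in> {t \<in> carrier T. t [^]\<^bsub>T\<^esub> ?n \<in> coinv_ker}"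
      using gh T.rcos_self[OF _ coinv_ker_subgroup, of "tensor G g h [^]\<^bsub>T\<^esub> ?n"] by auto
  qed
  then have pow: "t [^]\<^bsub>T\<^esub> ?n \<in> coinv_ker" if "t \<in> carrier T" for t using that by blast
  have "c \<in> comm_map ` carrier T" using c comm_map_image by simp
  then obtain t where t: "t \<in> carrier T" "comm_map t = c" by blast
  have cn: "c [^] ?n \<in> comm_map ` coinv_ker" using t pow[OF t(1)] \<kappa>.hom_nat_pow[OF t(1), of ?n] by force
  have sub: "subgroup (comm_map ` coinv_ker) G" by (rule \<kappa>.subgroup_img_is_subgroup[OF coinv_ker_subgroup])
  obtain e f :: int where ef: "e * int ?n + f * int (card ?D) = 1"
    using bezout_int[of "int ?n" "int (card ?D)"] co
    by (metis coprime_imp_gcd_eq_1 gcd_int_int_eq of_nat_1)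
  have cc: "c \<in> carrier G" by (rule subgroup.mem_carrier[OF D c])
  have c1: "c [^] card ?D = \<one>"
    using D.pow_order_eq_1[of c] c by (simp add: order_def flip: nat_pow_consistent)
  have "c = c [^] (int ?n * e + int (card ?D) * f)" 
    using ef cc by (simp only: mult.commute[of _ e] mult.commute[of _ f] int_pow_1)
  also have "\<dots> = (c [^] ?n) [^] e \<otimes> (c [^] card ?D) [^] f"
    using cc by (simp add: int_pow_mult int_pow_pow flip: int_pow_int)
  also have "\<dots> = (c [^] ?n) [^] e" using c1 cc by simp
  finally show "c \<in> comm_map ` coinv_ker" using subgroup_int_pow_closed[OF sub cn] by metis
qed

text \<open>There is an equivariant endomorphism \<open>\<phi>\<close> of \<open>T\<close> that kills \<open>J = ker \<kappa>\<close> and satisfies \<open>\<kappa> \<circ> \<phi> = \<kappa>\<close>.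
  Such a \<open>\<phi>\<close> changes every \<open>t\<close> by an element of \<open>J\<close> only, on which \<open>G\<close> acts trivially, so it fixes all
  \<open>t (x \<cdot> t)\<^sup>-\<^sup>1\<close> and hence all of \<open>coinv_ker\<close>; an element of \<open>coinv_ker \<inter> J\<close> is both fixed and killed.

  To find \<open>\<phi>\<close>, fix \<open>s\<close> with \<open>\<kappa> s = z\<close>. Every \<open>w\<close> in \<open>coinv_ker\<close> is \<open>\<phi> s\<close> for an equivariant \<open>\<phi>\<close> that kills
  \<open>J\<close>: on generators, \<open>t = s\<^sup>k j\<close> with \<open>j \<in> J\<close>, take \<open>\<phi> u = (u (x \<cdot> u)\<^sup>-\<^sup>1)\<^sup>k\<close>. It is equivariant because \<open>D\<close>
  acts trivially on the abelian group \<open>T\<close>, so the actions of any two elements of \<open>G\<close> commute. Now take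
  \<open>w\<close> with \<open>\<kappa> w = z\<close>.\<close>

lemma coinv_ker_inter_kernel:
  assumes co: "coprime (card (rcosets (derived G (carrier G)))) (card (derived G (carrier G)))"
    and m: "m \<in> coinv_ker" "comm_map m = \<one>"
  shows "m = \<one>\<^bsub>T\<^esub>"
proof -
  obtain s where s: "s \<in> carrier T" "comm_map s = z"
    using z(2) unfolding comm_map_image[symmetric] by blast
  have augc: "w \<in> carrier T" if "w \<in> coinv_ker" for w by (rule subgroup.mem_carrier[OF coinv_ker_subgroup that])
  have split: "\<exists>(k::int) j. j \<in> carrier T \<and> comm_map j = \<one> \<and> t = s [^]\<^bsub>T\<^esub> k \<otimes>\<^bsub>T\<^esub> j"
    if t: "t \<in> carrier T" for t
  proof -
    have "comm_map t \<in> derived G (carrier G)" using t comm_map_image by blast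
    then obtain k :: int where k: "comm_map t = z [^] k" using z(1) by blast
    let ?j = "inv\<^bsub>T\<^esub> (s [^]\<^bsub>T\<^esub> k) \<otimes>\<^bsub>T\<^esub> t"
    have "comm_map ?j = \<one>" using s t k by (simp add: \<kappa>.hom_int_pow) (metis \<kappa>.hom_closed int_pow_closed l_inv)
    moreover have "t = s [^]\<^bsub>T\<^esub> k \<otimes>\<^bsub>T\<^esub> ?j" using s t by (simp flip: T.m_assoc)
    ultimately show ?thesis using s t by (intro exI[of _ k] exI[of _ ?j]) auto
  qed
  have actD: "act c t = t" if c: "c \<in> derived G (carrier G)" and t: "t \<in> carrier T" for c t
  proof -
    obtain t' where t': "t' \<in> carrier T" "c = comm_map t'" using c unfolding comm_map_image[symmetric] by blast
    show ?thesis using peiffer[OF t'(1) t] t' t T.conj_eq_iff[of t' t] T.m_comm by simp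
  qed
  have act_comm: "act x (act y t) = act y (act x t)"
    if x: "x \<in> carrier G" "y \<in> carrier G" "t \<in> carrier T" for x y t
  proof -
    have "x \<otimes> y \<otimes> inv x \<otimes> inv y \<in> derived G (carrier G)"
      using x by (auto simp: derived_def intro!: generate.incl)
    moreover have "x \<otimes> y = (x \<otimes> y \<otimes> inv x \<otimes> inv y) \<otimes> (y \<otimes> x)"
      using x by (simp add: m_assoc) (simp flip: m_assoc)
    ultimately show ?thesis using x actD[of "x \<otimes> y \<otimes> inv x \<otimes> inv y" "act (y \<otimes> x) t"]
      by (simp add: act_act)
  qed
  define good where "good \<phi> \<longleftrightarrow> \<phi> \<in> hom T T \<and> (\<forall>j\<in>carrier T. comm_map j = \<one> \<longrightarrow> \<phi> j = \<one>\<^bsub>T\<^esub>)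
     \<and> (\<forall>x\<in>carrier G. \<forall>t\<in>carrier T. \<phi> (act x t) = act x (\<phi> t))" for \<phi>
  define W where "W = {w \<in> carrier T. \<exists>\<phi>. good \<phi> \<and> \<phi> s = w}"
  have act1: "act x \<one>\<^bsub>T\<^esub> = \<one>\<^bsub>T\<^esub>" if "x \<in> carrier G" for x
    using group_hom.hom_one[OF group_hom_act[OF that]] .
  have homc: "\<phi> t \<in> carrier T" if "good \<phi>" "t \<in> carrier T" for \<phi> t
    using that by (auto simp: good_def hom_def)
  have "subgroup W T"
  proof (rule T.subgroupI)
    have "good (\<lambda>_. \<one>\<^bsub>T\<^esub>)" by (auto simp: good_def hom_def act1)
    then have "\<one>\<^bsub>T\<^esub> \<in> W" unfolding W_def by auto
    then show "W \<noteq> {}" by blast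
    show "a \<otimes>\<^bsub>T\<^esub> b \<in> W" if ab: "a \<in> W" "b \<in> W" for a b
    proof -
      obtain \<phi> \<psi> where *: "good \<phi>" "\<phi> s = a" "good \<psi>" "\<psi> s = b" using ab by (auto simp: W_def)
      then have "good (\<lambda>t. \<phi> t \<otimes>\<^bsub>T\<^esub> \<psi> t)"
        using homc[OF *(1)] homc[OF *(3)] unfolding good_def hom_def by (auto simp: act_mult T.m_ac)
      then show ?thesis using ab * by (auto simp: W_def intro!: exI[of _ "\<lambda>t. \<phi> t \<otimes>\<^bsub>T\<^esub> \<psi> t"])
    qed
    show "inv\<^bsub>T\<^esub> a \<in> W" if a: "a \<in> W" for a
    proof -
      obtain \<phi> where *: "good \<phi>" "\<phi> s = a" using a by (auto simp: W_def)
      then have "good (\<lambda>t. inv\<^bsub>T\<^esub> \<phi> t)"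
        using homc[OF *(1)] unfolding good_def hom_def by (auto simp: act_inv T.inv_mult)
      then show ?thesis using a * by (auto simp: W_def intro!: exI[of _ "\<lambda>t. inv\<^bsub>T\<^esub> \<phi> t"])
    qed
  qed (auto simp: W_def)
  moreover have "t \<otimes>\<^bsub>T\<^esub> inv\<^bsub>T\<^esub> act x t \<in> W" if t: "t \<in> carrier T" and x: "x \<in> carrier G" for t x
  proof -
    obtain k :: int and j where j: "j \<in> carrier T" "comm_map j = \<one>" "t = s [^]\<^bsub>T\<^esub> k \<otimes>\<^bsub>T\<^esub> j"
      using split[OF t] by blast
    interpret ax: group_hom T T "act x" by (rule group_hom_act[OF x])
    define \<phi> where "\<phi> u = (u \<otimes>\<^bsub>T\<^esub> inv\<^bsub>T\<^esub> act x u) [^]\<^bsub>T\<^esub> k" for u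
    have "\<phi> \<in> hom T T"
      by (rule homI) (use x in \<open>auto simp: \<phi>_def act_mult T.inv_mult T.m_ac simp flip: T.int_pow_distrib\<close>)
    moreover have "\<phi> (act y u) = act y (\<phi> u)" if "y \<in> carrier G" "u \<in> carrier T" for y u
    proof -
      interpret ay: group_hom T T "act y" by (rule group_hom_act[OF that(1)])
      show ?thesis using that x by (simp add: \<phi>_def ay.hom_int_pow act_mult act_inv act_comm[of x y])
    qed
    ultimately have "good \<phi>" using x by (auto simp: good_def \<phi>_def act_comm_map_kernel)
    moreover have "\<phi> s = t \<otimes>\<^bsub>T\<^esub> inv\<^bsub>T\<^esub> act x t"
    proof -
      have c: "s [^]\<^bsub>T\<^esub> k \<in> carrier T" "act x s [^]\<^bsub>T\<^esub> k \<in> carrier T" using s x by auto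
      have "t \<otimes>\<^bsub>T\<^esub> inv\<^bsub>T\<^esub> act x t = s [^]\<^bsub>T\<^esub> k \<otimes>\<^bsub>T\<^esub> inv\<^bsub>T\<^esub> (act x s [^]\<^bsub>T\<^esub> k)"
        using j x s c act_comm_map_kernel[OF j(1,2) x]
        by (simp add: ax.hom_int_pow T.inv_mult_group T.m_assoc) (simp flip: T.m_assoc)
      also have "\<dots> = \<phi> s" using s x by (simp add: \<phi>_def T.int_pow_distrib T.int_pow_inv)
      finally show ?thesis ..
    qed
    ultimately show ?thesis using t x by (auto simp: W_def)
  qed
  ultimately have augW: "coinv_ker \<subseteq> W" by (rule coinv_ker_minimal)
  obtain w where w: "w \<in> coinv_ker" "comm_map w = z" using comm_map_coinv_ker[OF co] z(2) by blast
  then obtain \<phi> where \<phi>: "good \<phi>" "\<phi> s = w" using augW by (auto simp: W_def)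
  interpret \<phi>: group_hom T T \<phi> by unfold_locales (use \<phi> in \<open>simp add: good_def\<close>)
  have \<kappa>\<phi>: "comm_map (\<phi> t) = comm_map t" if t: "t \<in> carrier T" for t
  proof -
    obtain k :: int and j where j: "j \<in> carrier T" "comm_map j = \<one>" "t = s [^]\<^bsub>T\<^esub> k \<otimes>\<^bsub>T\<^esub> j"
      using split[OF t] by blast
    have "\<phi> t = w [^]\<^bsub>T\<^esub> k" using j s \<phi> augc[OF w(1)] by (simp add: \<phi>.hom_int_pow good_def)
    then have "comm_map (\<phi> t) = z [^] k" using w augc[OF w(1)] by (simp add: \<kappa>.hom_int_pow)
    moreover have "comm_map t = z [^] k \<otimes> \<one>" using j s by (simp add: \<kappa>.hom_int_pow)
    moreover have "z \<in> carrier G" using s by auto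
    ultimately show ?thesis by simp
  qed
  have id: "group_hom T T (\<lambda>x. x)"
    by (simp add: group_hom_def group_hom_axioms_def hom_def T.is_group)
  have "coinv_ker \<subseteq> {t \<in> carrier T. \<phi> t = t}"
  proof (rule coinv_ker_minimal[OF \<phi>.equalizer_subgroup[OF id]])
    fix t x assume t: "t \<in> carrier T" and x: "x \<in> carrier G"
    define j where "j = inv\<^bsub>T\<^esub> t \<otimes>\<^bsub>T\<^esub> \<phi> t"
    have j: "j \<in> carrier T" "comm_map j = \<one>" "\<phi> t = t \<otimes>\<^bsub>T\<^esub> j"
      using t \<kappa>\<phi>[OF t] by (auto simp: j_def simp flip: T.m_assoc)
    have "\<phi> (t \<otimes>\<^bsub>T\<^esub> inv\<^bsub>T\<^esub> act x t) = \<phi> t \<otimes>\<^bsub>T\<^esub> inv\<^bsub>T\<^esub> act x (\<phi> t)"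
      using \<phi>(1) t x by (simp add: good_def)
    also have "\<dots> = t \<otimes>\<^bsub>T\<^esub> (j \<otimes>\<^bsub>T\<^esub> inv\<^bsub>T\<^esub> j) \<otimes>\<^bsub>T\<^esub> inv\<^bsub>T\<^esub> act x t"
      unfolding j(3) using t x j act_comm_map_kernel[OF j(1,2) x]
      by (simp add: act_mult T.inv_mult_group T.m_assoc) (simp flip: T.m_assoc)
    also have "\<dots> = t \<otimes>\<^bsub>T\<^esub> inv\<^bsub>T\<^esub> act x t" using t x j by simp
    finally show "t \<otimes>\<^bsub>T\<^esub> inv\<^bsub>T\<^esub> act x t \<in> {t \<in> carrier T. \<phi> t = t}" using t x by simp
  qed
  then have "\<phi> m = m" using m by blast
  then show ?thesis using \<phi>(1) m augc[OF m(1)] by (simp add: good_def)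
qed

end
end

section \<open>The tensor square in coordinates\<close>

text \<open>Surjectivity is where the exponents enter: raising to suitable multiples of \<open>N\<close> and \<open>C\<close> isolates
  either component.\<close>

lemma iso_DirProd_coprime:
  assumes T: "group T" and K: "group K" and D: "group D"
    and f: "f \<in> hom T K" "f ` carrier T = carrier K" and g: "g \<in> hom T D" "g ` carrier T = carrier D"
    and N: "\<And>x. x \<in> carrier K \<Longrightarrow> x [^]\<^bsub>K\<^esub> N = \<one>\<^bsub>K\<^esub>" and C: "\<And>y. y \<in> carrier D \<Longrightarrow> y [^]\<^bsub>D\<^esub> C = \<one>\<^bsub>D\<^esub>"
    and co: "coprime (N :: nat) C"
    and ker: "\<And>t. t \<in> carrier T \<Longrightarrow> f t = \<one>\<^bsub>K\<^esub> \<Longrightarrow> g t = \<one>\<^bsub>D\<^esub> \<Longrightarrow> t = \<one>\<^bsub>T\<^esub>"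
  shows "T \<cong> K \<times>\<times> D"
proof -
  interpret T: group T by fact
  interpret K: group K by fact
  interpret D: group D by fact
  interpret KD: group "K \<times>\<times> D" by (rule DirProd_group[OF K D])
  interpret f: group_hom T K f by unfold_locales fact
  interpret g: group_hom T D g by unfold_locales fact
  let ?h = "\<lambda>t. (f t, g t)"
  have "?h \<in> hom T (K \<times>\<times> D)" by (rule homI) auto
  then interpret h: group_hom T "K \<times>\<times> D" ?h by unfold_locales
  obtain a b :: int where ab: "a * int N + b * int C = 1"
    using bezout_int[of "int N" "int C"] co by (metis coprime_imp_gcd_eq_1 gcd_int_int_eq of_nat_1)
  have KN: "x [^]\<^bsub>K\<^esub> (int N * a) = \<one>\<^bsub>K\<^esub>" if "x \<in> carrier K" for x
    using that N by (simp add: int_pow_int flip: K.int_pow_pow)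
  have DC: "x [^]\<^bsub>D\<^esub> (int C * b) = \<one>\<^bsub>D\<^esub>" if "x \<in> carrier D" for x
    using that C by (simp add: int_pow_int flip: D.int_pow_pow)
  have K1: "x [^]\<^bsub>K\<^esub> (int C * b) = x" if x: "x \<in> carrier K" for x
    using K.int_pow_mult[OF x, of "int N * a" "int C * b"] ab KN[OF x] x by (simp add: mult.commute)
  have D1: "x [^]\<^bsub>D\<^esub> (int N * a) = x" if x: "x \<in> carrier D" for x
    using D.int_pow_mult[OF x, of "int N * a" "int C * b"] ab DC[OF x] x by (simp add: mult.commute)
  have "(x, y) \<in> ?h ` carrier T" if xy: "x \<in> carrier K" "y \<in> carrier D" for x y
  proof -
    obtain s t where st: "s \<in> carrier T" "x = f s" "t \<in> carrier T" "y = g t" using f g xy by blast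
    have "?h (s [^]\<^bsub>T\<^esub> (int C * b) \<otimes>\<^bsub>T\<^esub> t [^]\<^bsub>T\<^esub> (int N * a)) = (x, y)"
      using st by (simp add: f.hom_int_pow g.hom_int_pow K1 D1 KN DC)
    then show ?thesis using st by (metis (no_types, lifting) T.int_pow_closed T.m_closed imageI)
  qed
  moreover have "?h ` carrier T \<subseteq> carrier (K \<times>\<times> D)" by auto
  moreover have "inj_on ?h (carrier T)"
    by (rule h.trivial_ker_imp_inj) (use ker in \<open>auto simp: kernel_def\<close>)
  ultimately have "?h \<in> iso T (K \<times>\<times> D)"
    using h.homh by (auto simp: iso_def bij_betw_def)
  then show ?thesis by (rule is_isoI)
qed

lemma hom_comm_group_conj_by:
  assumes "group G" "comm_group B" "f \<in> hom G B" "x \<in> carrier G" "g \<in> carrier G"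
  shows "f (conj_by G x g) = f g"
proof -
  interpret G: group G by fact
  interpret B: comm_group B by fact
  interpret f: group_hom G B f by unfold_locales fact
  have "f (conj_by G x g) = (f x \<otimes>\<^bsub>B\<^esub> inv\<^bsub>B\<^esub> f x) \<otimes>\<^bsub>B\<^esub> f g"
    using assms(4,5) by (simp add: conj_by_def B.m_ac)
  then show ?thesis using assms(4,5) by simp
qed

context group
begin

interpretation T: group T by (rule group_tensor_square)
interpretation \<kappa>: group_hom T G comm_map by (rule group_hom_comm_map)

text \<open>Homomorphisms to abelian groups are invariant under conjugation, so for a product of two of them the
  defining relations of \<open>T\<close> become additivity in each argument.\<close>

lemma bilinear_tensor_hom:
  assumes a: "a \<in> hom G (integer_mod_group m)" and b: "b \<in> hom G (integer_mod_group n)"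
    and d: "d dvd m" "d dvd n"
  shows "\<exists>\<theta>. \<theta> \<in> hom T (integer_mod_group d) \<and>
     (\<forall>g\<in>carrier G. \<forall>h\<in>carrier G. \<theta> (tensor G g h) = (a g * b h) mod int d)"
proof (rule tensor_universal)
  have am: "a (g \<otimes> h) = (a g + a h) mod int m" and bm: "b (g \<otimes> h) = (b g + b h) mod int n"
    if "g \<in> carrier G" "h \<in> carrier G" for g h
    using hom_mult[OF a that] hom_mult[OF b that] by simp_all
  have dm: "x mod int m mod int d = x mod int d" "x mod int n mod int d = x mod int d" for x
    using d by (simp_all add: mod_mod_cancel)
  have ac: "a (conj_by G x g) = a g" and bc: "b (conj_by G x g) = b g"
    if "x \<in> carrier G" "g \<in> carrier G" for x g
    using hom_comm_group_conj_by[OF is_group abelian_integer_mod_group _ that] a b by blast+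
  fix g g1 h assume g: "g1 \<in> carrier G" "g \<in> carrier G" "h \<in> carrier G"
  have "(a (g1 \<otimes> g) * b h) mod int d = ((a g1 + a g) * b h) mod int d"
    using g by (metis am dm(1) mod_mult_left_eq)
  then show "(a (g1 \<otimes> g) * b h) mod int d = ((a (conj_by G g1 g) * b (conj_by G g1 h)) mod int d)
     \<otimes>\<^bsub>integer_mod_group d\<^esub> ((a g1 * b h) mod int d)"
    using g by (simp add: ac bc distrib_right mod_add_left_eq mod_add_right_eq add.commute)
  have "(a g1 * b (g \<otimes> h)) mod int d = (a g1 * (b g + b h)) mod int d"
    using g by (metis bm dm(2) mod_mult_right_eq)
  then show "(a g1 * b (g \<otimes> h)) mod int d = ((a g1 * b g) mod int d)
     \<otimes>\<^bsub>integer_mod_group d\<^esub> ((a (conj_by G g g1) * b (conj_by G g h)) mod int d)"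
    using g by (simp add: ac bc distrib_left mod_add_left_eq mod_add_right_eq)
qed (use d in \<open>auto simp: carrier_integer_mod_group\<close>)

text \<open>With \<open>a\<close>, \<open>b\<close> as coordinates of the abelianization along \<open>u\<close>, \<open>v\<close>, the four products of coordinates of
  \<open>g\<close> and \<open>h\<close> define homomorphisms out of \<open>T\<close>. Modulo \<open>coinv_ker\<close> every element is a product of powers of
  \<open>u \<otimes> u\<close>, \<open>u \<otimes> v\<close>, \<open>v \<otimes> u\<close>, \<open>v \<otimes> v\<close>, whose exponents are these four values; the first power
  depends on its exponent modulo \<open>n\<close> only, the others modulo \<open>d\<close>. So an element on which all four vanish
  is in \<open>coinv_ker\<close>, and if \<open>\<kappa>\<close> vanishes as well it is trivial.\<close>

lemma tensor_square_iso:
  assumes z: "\<And>c. c \<in> derived G (carrier G) \<Longrightarrow> \<exists>k::int. c = z [^] k" "z \<in> derived G (carrier G)"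
    and co: "coprime (card (rcosets (derived G (carrier G)))) (card (derived G (carrier G)))"
    and con: "coprime n (card (derived G (carrier G)))"
    and n: "n > 0" and d: "d dvd n"
    and a: "a \<in> hom G (integer_mod_group n)" and b: "b \<in> hom G (integer_mod_group d)"
    and u: "u \<in> carrier G" "a u = 1 mod int n" "b u = 0"
    and v: "v \<in> carrier G" "a v = 0" "b v = 1 mod int d"
    and ker: "\<And>g. g \<in> carrier G \<Longrightarrow> a g = 0 \<Longrightarrow> b g = 0 \<Longrightarrow> g \<in> derived G (carrier G)"
  shows "T \<cong> (integer_mod_group n \<times>\<times> (integer_mod_group d \<times>\<times> (integer_mod_group d \<times>\<times> integer_mod_group d)))
     \<times>\<times> G\<lparr>carrier := derived G (carrier G)\<rparr>"
proof -
  define D where "D = derived G (carrier G)"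
  have D: "subgroup D G" unfolding D_def by (rule derived_is_subgroup) simp
  interpret D: group "G\<lparr>carrier := D\<rparr>" using D by (rule subgroup_imp_group)
  interpret T: comm_group T by (rule tensor_square_comm[OF z])
  interpret M: normal coinv_ker T by (rule T.subgroup_imp_normal[OF coinv_ker_subgroup])
  interpret B: comm_group "T Mod coinv_ker" by (rule T.abelian_FactGroup[OF coinv_ker_subgroup])
  let ?Z = "integer_mod_group" and ?B = "T Mod coinv_ker"
  let ?K = "?Z n \<times>\<times> (?Z d \<times>\<times> (?Z d \<times>\<times> ?Z d))"
  have d0: "d > 0" using d n by (metis dvd_0_left_iff gr0I)
  interpret a: group_hom G "?Z n" a by (simp add: group_hom_def group_hom_axioms_def is_group a)
  interpret b: group_hom G "?Z d" b by (simp add: group_hom_def group_hom_axioms_def is_group b)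
  have ar: "a g mod int n = a g" if "g \<in> carrier G" for g
    using a.hom_closed[OF that] n by (simp add: carrier_integer_mod_group)
  have br: "b g mod int d = b g" if "g \<in> carrier G" for g
    using b.hom_closed[OF that] d0 by (simp add: carrier_integer_mod_group)
  define \<beta> where "\<beta> g h = coinv_ker #>\<^bsub>T\<^esub> tensor G g h" for g h
  have \<beta>l: "group_hom G ?B (\<lambda>g. \<beta> g h)" if "h \<in> carrier G" for h
    using pairing_hom_left[OF z that] B.is_group is_group by (simp add: \<beta>_def group_hom_def group_hom_axioms_def)
  have \<beta>r: "group_hom G ?B (\<lambda>h. \<beta> g h)" if "g \<in> carrier G" for g
    using pairing_hom_right[OF z that] B.is_group is_group by (simp add: \<beta>_def group_hom_def group_hom_axioms_def)
  have coord: "f g = f u [^]\<^bsub>?B\<^esub> (a g) \<otimes>\<^bsub>?B\<^esub> f v [^]\<^bsub>?B\<^esub> (b g)"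
    if f: "group_hom G ?B f" and g: "g \<in> carrier G" for f g
  proof -
    interpret f: group_hom G ?B f by (rule f)
    define w where "w = u [^] (a g) \<otimes> v [^] (b g)"
    have w: "w \<in> carrier G" using u v by (simp add: w_def)
    have "a w = a g" using u v ar[OF g]
      by (simp add: w_def a.hom_int_pow int_pow_integer_mod_group mod_mult_right_eq)
    moreover have "b w = b g" using u v br[OF g]
      by (simp add: w_def b.hom_int_pow int_pow_integer_mod_group mod_mult_right_eq)
    ultimately have "inv w \<otimes> g \<in> D"
      unfolding D_def using w g n d0 a.hom_closed[OF g] b.hom_closed[OF g]
      by (intro ker) (simp_all add: a.hom_inv b.hom_inv mod_add_left_eq)
    then have "f (inv w \<otimes> g) = \<one>\<^bsub>?B\<^esub>"
      unfolding D_def by (rule hom_comm_group_derived[OF B.comm_group_axioms f.homh])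
    then have "f g = f w" using w g
      by (metis B.inv_solve_left' B.r_one f.hom_closed f.hom_inv f.hom_mult inv_closed B.inv_equality B.inv_inv B.inv_closed)
    then show ?thesis using u v by (simp add: w_def f.hom_int_pow del: mult_FactGroup)
  qed
  have tor: "\<beta> u u [^]\<^bsub>?B\<^esub> int n = \<one>\<^bsub>?B\<^esub>" "\<beta> u v [^]\<^bsub>?B\<^esub> int d = \<one>\<^bsub>?B\<^esub>"
     "\<beta> v u [^]\<^bsub>?B\<^esub> int d = \<one>\<^bsub>?B\<^esub>" "\<beta> v v [^]\<^bsub>?B\<^esub> int d = \<one>\<^bsub>?B\<^esub>"
  proof -
    have un: "u [^] int n \<in> D" unfolding D_def
      by (rule ker) (use u in \<open>auto simp: a.hom_int_pow b.hom_int_pow int_pow_integer_mod_group\<close>)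
    have vd: "v [^] int d \<in> D" unfolding D_def
      by (rule ker) (use v in \<open>auto simp: a.hom_int_pow b.hom_int_pow int_pow_integer_mod_group\<close>)
    have *: "f w [^]\<^bsub>?B\<^esub> int k = \<one>\<^bsub>?B\<^esub>" if f: "group_hom G ?B f" and w: "w \<in> carrier G" "w [^] int k \<in> D" for f w k
    proof -
      interpret f: group_hom G ?B f by (rule f)
      have "f w [^]\<^bsub>?B\<^esub> int k = f (w [^] int k)" using w by (simp add: f.hom_int_pow)
      then show ?thesis
        using hom_comm_group_derived[OF B.comm_group_axioms f.homh] w(2) unfolding D_def by simp
    qed
    show "\<beta> u u [^]\<^bsub>?B\<^esub> int n = \<one>\<^bsub>?B\<^esub>" "\<beta> v u [^]\<^bsub>?B\<^esub> int d = \<one>\<^bsub>?B\<^esub>" "\<beta> v v [^]\<^bsub>?B\<^esub> int d = \<one>\<^bsub>?B\<^esub>"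
      using *[OF \<beta>l[OF u(1)] u(1) un] *[OF \<beta>l[OF u(1)] v(1) vd] *[OF \<beta>l[OF v(1)] v(1) vd] by auto
    show "\<beta> u v [^]\<^bsub>?B\<^esub> int d = \<one>\<^bsub>?B\<^esub>" using *[OF \<beta>r[OF u(1)] v(1) vd] .
  qed
  obtain t1 where t1: "t1 \<in> hom T (?Z n)" "\<And>g h. g \<in> carrier G \<Longrightarrow> h \<in> carrier G \<Longrightarrow> t1 (tensor G g h) = (a g * a h) mod int n"
    using bilinear_tensor_hom[OF a a, of n] by auto
  obtain t2 where t2: "t2 \<in> hom T (?Z d)" "\<And>g h. g \<in> carrier G \<Longrightarrow> h \<in> carrier G \<Longrightarrow> t2 (tensor G g h) = (a g * b h) mod int d"
    using bilinear_tensor_hom[OF a b, of d] d by auto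
  obtain t3 where t3: "t3 \<in> hom T (?Z d)" "\<And>g h. g \<in> carrier G \<Longrightarrow> h \<in> carrier G \<Longrightarrow> t3 (tensor G g h) = (b g * a h) mod int d"
    using bilinear_tensor_hom[OF b a, of d] d by auto
  obtain t4 where t4: "t4 \<in> hom T (?Z d)" "\<And>g h. g \<in> carrier G \<Longrightarrow> h \<in> carrier G \<Longrightarrow> t4 (tensor G g h) = (b g * b h) mod int d"
    using bilinear_tensor_hom[OF b b, of d] by auto
  interpret t1: group_hom T "?Z n" t1 by (simp add: group_hom_def group_hom_axioms_def T.is_group t1)
  interpret t2: group_hom T "?Z d" t2 by (simp add: group_hom_def group_hom_axioms_def T.is_group t2)
  interpret t3: group_hom T "?Z d" t3 by (simp add: group_hom_def group_hom_axioms_def T.is_group t3)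
  interpret t4: group_hom T "?Z d" t4 by (simp add: group_hom_def group_hom_axioms_def T.is_group t4)
  define F where "F i j k l = \<beta> u u [^]\<^bsub>?B\<^esub> i \<otimes>\<^bsub>?B\<^esub> (\<beta> u v [^]\<^bsub>?B\<^esub> j \<otimes>\<^bsub>?B\<^esub> (\<beta> v u [^]\<^bsub>?B\<^esub> k \<otimes>\<^bsub>?B\<^esub> \<beta> v v [^]\<^bsub>?B\<^esub> l))"
    for i j k l :: int
  have \<beta>c: "\<beta> g h \<in> carrier ?B" if "g \<in> carrier G" "h \<in> carrier G" for g h
    using that by (auto simp: \<beta>_def carrier_FactGroup)
  note bc = \<beta>c[OF u(1) u(1)] \<beta>c[OF u(1) v(1)] \<beta>c[OF v(1) u(1)] \<beta>c[OF v(1) v(1)]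
  \<comment> \<open>the elements whose class has the values of the four homomorphisms as exponents\<close>
  define W where "W = {t \<in> carrier T. \<exists>i j k l. coinv_ker #>\<^bsub>T\<^esub> t = F i j k l \<and> t1 t = i mod int n
     \<and> t2 t = j mod int d \<and> t3 t = k mod int d \<and> t4 t = l mod int d}"
  have WI: "t \<in> W" if "t \<in> carrier T" "coinv_ker #>\<^bsub>T\<^esub> t = F i j k l" "t1 t = i mod int n"
     "t2 t = j mod int d" "t3 t = k mod int d" "t4 t = l mod int d" for t i j k l
    using that unfolding W_def by blast
  have WE: "\<exists>i j k l. coinv_ker #>\<^bsub>T\<^esub> t = F i j k l \<and> t1 t = i mod int n
     \<and> t2 t = j mod int d \<and> t3 t = k mod int d \<and> t4 t = l mod int d" if "t \<in> W" for t
    using that unfolding W_def by blast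
  have cosm: "coinv_ker #>\<^bsub>T\<^esub> (s \<otimes>\<^bsub>T\<^esub> t) = (coinv_ker #>\<^bsub>T\<^esub> s) \<otimes>\<^bsub>?B\<^esub> (coinv_ker #>\<^bsub>T\<^esub> t)"
    if "s \<in> carrier T" "t \<in> carrier T" for s t
    using M.rcos_sum that by simp
  have "carrier T = W"
  proof (rule tensor_generates)
    show "subgroup W T"
    proof (rule T.subgroupI)
      have "F 0 0 0 0 = \<one>\<^bsub>?B\<^esub>" by (simp add: F_def del: mult_FactGroup one_FactGroup)
      then have "\<one>\<^bsub>T\<^esub> \<in> W" by (intro WI[of _ 0 0 0 0]) (simp_all add: M.subset T.coset_mult_one)
      then show "W \<noteq> {}" by blast
      show "W \<subseteq> carrier T" unfolding W_def by blast
      show "s \<otimes>\<^bsub>T\<^esub> t \<in> W" if s: "s \<in> W" and t: "t \<in> W" for s t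
      proof -
        have c: "s \<in> carrier T" "t \<in> carrier T" using s t unfolding W_def by auto
        obtain i j k l where s': "coinv_ker #>\<^bsub>T\<^esub> s = F i j k l" "t1 s = i mod int n"
           "t2 s = j mod int d" "t3 s = k mod int d" "t4 s = l mod int d" using WE[OF s] by blast
        obtain i' j' k' l' where t': "coinv_ker #>\<^bsub>T\<^esub> t = F i' j' k' l'" "t1 t = i' mod int n"
           "t2 t = j' mod int d" "t3 t = k' mod int d" "t4 t = l' mod int d" using WE[OF t] by blast
        show ?thesis
        proof (rule WI[of _ "i + i'" "j + j'" "k + k'" "l + l'"])
          show "coinv_ker #>\<^bsub>T\<^esub> (s \<otimes>\<^bsub>T\<^esub> t) = F (i + i') (j + j') (k + k') (l + l')"
            using bc by (simp add: cosm[OF c] s' t' F_def B.int_pow_mult B.m_ac del: mult_FactGroup)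
        qed (use c s' t' in \<open>auto simp: mod_add_eq\<close>)
      qed
      show "inv\<^bsub>T\<^esub> s \<in> W" if s: "s \<in> W" for s
      proof -
        have c: "s \<in> carrier T" using s unfolding W_def by auto
        obtain i j k l where s': "coinv_ker #>\<^bsub>T\<^esub> s = F i j k l" "t1 s = i mod int n"
           "t2 s = j mod int d" "t3 s = k mod int d" "t4 s = l mod int d" using WE[OF s] by blast
        have iz: "inv\<^bsub>?Z m\<^esub> (x mod int m) = - x mod int m" if "m > 0" for m x
          using that by (subst inv_integer_mod_group) (auto simp: carrier_integer_mod_group mod_minus_eq)
        show ?thesis
        proof (rule WI[of _ "- i" "- j" "- k" "- l"])
          have "coinv_ker #>\<^bsub>T\<^esub> inv\<^bsub>T\<^esub> s = inv\<^bsub>?B\<^esub> (coinv_ker #>\<^bsub>T\<^esub> s)"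
            using group_hom.hom_inv[of T ?B "\<lambda>t. coinv_ker #>\<^bsub>T\<^esub> t" s] c M.r_coset_hom_Mod
            by (simp add: group_hom_def group_hom_axioms_def T.is_group B.is_group)
          then show "coinv_ker #>\<^bsub>T\<^esub> inv\<^bsub>T\<^esub> s = F (- i) (- j) (- k) (- l)"
            using bc by (simp add: s' F_def B.int_pow_neg B.inv_mult del: mult_FactGroup)
        qed (use c s' n d0 iz in \<open>auto simp: t1.hom_inv t2.hom_inv t3.hom_inv t4.hom_inv\<close>)
      qed
    qed
    show "tensor G g h \<in> W" if gh: "g \<in> carrier G" "h \<in> carrier G" for g h
    proof (rule WI[of _ "a g * a h" "a g * b h" "b g * a h" "b g * b h"])
      have "\<beta> g h = \<beta> u h [^]\<^bsub>?B\<^esub> a g \<otimes>\<^bsub>?B\<^esub> \<beta> v h [^]\<^bsub>?B\<^esub> b g"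
        by (rule coord[OF \<beta>l gh(1)]) (rule gh)
      also have "\<beta> u h = \<beta> u u [^]\<^bsub>?B\<^esub> a h \<otimes>\<^bsub>?B\<^esub> \<beta> u v [^]\<^bsub>?B\<^esub> b h"
        by (rule coord[OF \<beta>r gh(2)]) (rule u)
      also have "\<beta> v h = \<beta> v u [^]\<^bsub>?B\<^esub> a h \<otimes>\<^bsub>?B\<^esub> \<beta> v v [^]\<^bsub>?B\<^esub> b h"
        by (rule coord[OF \<beta>r gh(2)]) (rule v)
      finally show "coinv_ker #>\<^bsub>T\<^esub> tensor G g h = F (a g * a h) (a g * b h) (b g * a h) (b g * b h)"
        using bc by (simp add: \<beta>_def[symmetric] F_def B.int_pow_distrib B.int_pow_pow B.m_assoc mult.commute del: mult_FactGroup)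
    qed (use gh t1 t2 t3 t4 in auto)
  qed
  note WT = this
  have inaug: "t \<in> coinv_ker" if t: "t \<in> carrier T" "t1 t = 0" "t2 t = 0" "t3 t = 0" "t4 t = 0" for t
  proof -
    obtain i j k l where i: "coinv_ker #>\<^bsub>T\<^esub> t = F i j k l" "t1 t = i mod int n"
           "t2 t = j mod int d" "t3 t = k mod int d" "t4 t = l mod int d" using WE[of t] t(1) WT by blast
    have pow: "x [^]\<^bsub>?B\<^esub> i = \<one>\<^bsub>?B\<^esub>" if "x \<in> carrier ?B" "x [^]\<^bsub>?B\<^esub> int m = \<one>\<^bsub>?B\<^esub>" "0 = i mod int m" for x i m
    proof -
      have "int m dvd i" using that(3) by (simp add: dvd_eq_mod_eq_0)
      then obtain e where "i = int m * e" ..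
      then show ?thesis using that B.int_pow_pow[of x "int m" e] by (simp del: one_FactGroup)
    qed
    have "F i j k l = \<one>\<^bsub>?B\<^esub>"
      unfolding F_def using pow[OF bc(1) tor(1)] pow[OF bc(2) tor(2)] pow[OF bc(3) tor(3)] pow[OF bc(4) tor(4)]
        i t by (simp del: mult_FactGroup one_FactGroup)
    then have "coinv_ker #>\<^bsub>T\<^esub> t = coinv_ker" using i by simp
    then show ?thesis using T.rcos_self[OF t(1) coinv_ker_subgroup] by simp
  qed
  let ?\<theta> = "\<lambda>t. (t1 t, t2 t, t3 t, t4 t)"
  have "T \<cong> ?K \<times>\<times> G\<lparr>carrier := D\<rparr>"
  proof (rule iso_DirProd_coprime[where f = ?\<theta> and g = comm_map and N = n and C = "card D"])
    show "group ?K" by (intro DirProd_group group_integer_mod_group)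
    show "group T" "group (G\<lparr>carrier := D\<rparr>)" by unfold_locales
    show \<theta>: "?\<theta> \<in> hom T ?K" by (rule homI) (auto simp del: mult_integer_mod_group)
    show "comm_map \<in> hom T (G\<lparr>carrier := D\<rparr>)"
      using comm_map_hom comm_map_image by (auto simp: hom_def D_def)
    show "comm_map ` carrier T = carrier (G\<lparr>carrier := D\<rparr>)" using comm_map_image by (simp add: D_def)
    show "?\<theta> ` carrier T = carrier ?K"
    proof
      show "?\<theta> ` carrier T \<subseteq> carrier ?K" using \<theta> by (auto simp: hom_def)
      show "carrier ?K \<subseteq> ?\<theta> ` carrier T"
      proof
        fix x assume "x \<in> carrier ?K"
        then obtain i j k l where x: "x = (i, j, k, l)" "i \<in> carrier (?Z n)" "j \<in> carrier (?Z d)"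
          "k \<in> carrier (?Z d)" "l \<in> carrier (?Z d)" by auto
        let ?t = "tensor G u u [^]\<^bsub>T\<^esub> i \<otimes>\<^bsub>T\<^esub> (tensor G u v [^]\<^bsub>T\<^esub> j \<otimes>\<^bsub>T\<^esub>
           (tensor G v u [^]\<^bsub>T\<^esub> k \<otimes>\<^bsub>T\<^esub> tensor G v v [^]\<^bsub>T\<^esub> l))"
        have i: "i mod int n = i" "j mod int d = j" "k mod int d = k" "l mod int d = l"
          using x n d0 by (auto simp: carrier_integer_mod_group)
        have md: "1 mod int n mod int d = 1 mod int d" using d by (simp add: mod_mod_cancel)
        have one: "(1 mod int n * (1 mod int n)) mod int n = 1 mod int n"
          "(1 mod int n * (1 mod int d)) mod int d = 1 mod int d"
          "(1 mod int d * (1 mod int n)) mod int d = 1 mod int d"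
          "(1 mod int d * (1 mod int d)) mod int d = 1 mod int d"
          using md mod_mult_eq[of 1 "int n" 1] mod_mult_eq[of 1 "int d" 1]
            mod_mult_left_eq[of "1 mod int n" "int d" "1 mod int d"]
            mod_mult_right_eq[of "1 mod int d" "1 mod int n" "int d"] by simp_all
        have val: "t1 (tensor G u u) = 1 mod int n" "t1 (tensor G u v) = 0" "t1 (tensor G v u) = 0" "t1 (tensor G v v) = 0"
          "t2 (tensor G u u) = 0" "t2 (tensor G u v) = 1 mod int d" "t2 (tensor G v u) = 0" "t2 (tensor G v v) = 0"
          "t3 (tensor G u u) = 0" "t3 (tensor G u v) = 0" "t3 (tensor G v u) = 1 mod int d" "t3 (tensor G v v) = 0"
          "t4 (tensor G u u) = 0" "t4 (tensor G u v) = 0" "t4 (tensor G v u) = 0" "t4 (tensor G v v) = 1 mod int d"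
          using u v t1(2) t2(2) t3(2) t4(2) one by simp_all
        have eq: "?\<theta> ?t = (i, j, k, l)"
          using u(1) v(1) i by (simp add: t1.hom_int_pow t2.hom_int_pow t3.hom_int_pow t4.hom_int_pow
              int_pow_integer_mod_group val mod_mult_right_eq)
        have "?t \<in> carrier T" using u(1) v(1) by simp
        then show "x \<in> ?\<theta> ` carrier T"
          by (rule image_eqI[rotated]) (simp only: x(1) eq)
      qed
    qed
    show "x [^]\<^bsub>?K\<^esub> n = \<one>\<^bsub>?K\<^esub>" if "x \<in> carrier ?K" for x
    proof -
      have "x [^]\<^bsub>?K\<^esub> m = (fst x [^]\<^bsub>?Z n\<^esub> m, fst (snd x) [^]\<^bsub>?Z d\<^esub> m, fst (snd (snd x)) [^]\<^bsub>?Z d\<^esub> m, snd (snd (snd x)) [^]\<^bsub>?Z d\<^esub> m)"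
        for m :: nat
        by (induction m) (simp_all add: mult_DirProd' del: pow_integer_mod_group mult_integer_mod_group)
      moreover have "(int n * y) mod int d = 0" for y
        using d by (simp add: dvd_eq_mod_eq_0[symmetric])
      ultimately show ?thesis by (simp only: pow_integer_mod_group) (simp del: mult_integer_mod_group)
    qed
    show "y [^]\<^bsub>G\<lparr>carrier := D\<rparr>\<^esub> card D = \<one>\<^bsub>G\<lparr>carrier := D\<rparr>\<^esub>" if "y \<in> carrier (G\<lparr>carrier := D\<rparr>)" for y
      using D.pow_order_eq_1[OF that] by (simp add: order_def)
    show "coprime n (card D)" using con by (simp add: D_def)
    show "t = \<one>\<^bsub>T\<^esub>" if "t \<in> carrier T" "?\<theta> t = \<one>\<^bsub>?K\<^esub>" "comm_map t = \<one>\<^bsub>G\<lparr>carrier := D\<rparr>\<^esub>" for t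
      using coinv_ker_inter_kernel[OF z co inaug] that by simp
  qed
  then show ?thesis by (simp add: D_def)
qed

end

section \<open>Cyclic factors of finite abelian groups\<close>

text \<open>The coordinates are the components of the inverse of the isomorphism
  \<open>(i, j) \<mapsto> x\<^sup>i y\<^sup>j\<close>.\<close>

lemma (in comm_group) two_generator_coordinates:
  assumes x: "x \<in> carrier G" "ord x = n" and y: "y \<in> carrier G" "ord y = d"
    and ord: "order G = n * d" and pos: "n * d > 0"
    and indep: "\<And>(i::int) (j::int). x [^] i \<otimes> y [^] j = \<one> \<Longrightarrow> x [^] i = \<one>"
  shows "\<exists>a b. a \<in> hom G (integer_mod_group n) \<and> b \<in> hom G (integer_mod_group d) \<and>
     a x = 1 mod int n \<and> b x = 0 \<and> a y = 0 \<and> b y = 1 mod int d \<and>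
     (\<forall>g\<in>carrier G. a g = 0 \<longrightarrow> b g = 0 \<longrightarrow> g = \<one>)"
proof -
  let ?Z = "integer_mod_group n \<times>\<times> integer_mod_group d"
  have n: "n > 0" "d > 0" using pos by auto
  have powx: "x [^] (i mod int n) = x [^] i" and powy: "y [^] (i mod int d) = y [^] i" for i :: int
    using x y by (auto simp: int_pow_eq simp flip: mod_eq_dvd_iff)
  define h where "h = (\<lambda>(i::int, j::int). x [^] i \<otimes> y [^] j)"
  interpret Z: group ?Z by (intro DirProd_group group_integer_mod_group)
  have hom: "h \<in> hom ?Z G"
    by (rule homI) (use x y powx powy in \<open>auto simp: h_def int_pow_mult m_ac\<close>)
  interpret h: group_hom ?Z G h by unfold_locales (rule hom)
  have inj: "inj_on h (carrier ?Z)"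
  proof (rule h.trivial_ker_imp_inj)
    have "ij = (0, 0)" if ij: "ij \<in> carrier ?Z" "h ij = \<one>" for ij
    proof -
      obtain i j where e: "ij = (i, j)" by force
      have x1: "x [^] i = \<one>" using indep[of i j] ij by (simp add: e h_def)
      then have y1: "y [^] j = \<one>" using ij y by (simp add: e h_def)
      have "int n dvd i" "int d dvd j" using x1 y1 x y by (simp_all add: int_pow_eq_id)
      moreover have "0 \<le> i" "i < int n" "0 \<le> j" "j < int d"
        using ij n by (auto simp: e carrier_integer_mod_group)
      ultimately have "i = 0" "j = 0" by (metis mod_pos_pos_trivial dvd_eq_mod_eq_0)+
      then show ?thesis by (simp add: e)
    qed
    then show "kernel ?Z G h = {\<one>\<^bsub>?Z\<^esub>}" by (auto simp: kernel_def) (auto simp: h_def)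
  qed
  have "card (carrier ?Z) = order G" using n ord by (simp add: carrier_integer_mod_group card_cartesian_product)
  then have "card (h ` carrier ?Z) = card (carrier G)" using card_image[OF inj] by (simp add: order_def)
  moreover have "finite (carrier G)" using pos ord by (metis order_gt_0_iff_finite)
  ultimately have surj: "h ` carrier ?Z = carrier G"
    by (intro card_subset_eq) auto
  have iso: "h \<in> iso ?Z G" using hom inj surj by (auto simp: iso_def bij_betw_def)
  define k where "k = inv_into (carrier ?Z) h"
  have k: "k \<in> hom G ?Z" using Z.iso_set_sym[OF iso] by (simp add: k_def iso_def)
  have kh: "k (h ij) = ij" if "ij \<in> carrier ?Z" for ij using inj that by (simp add: k_def)
  have hk: "h (k g) = g" if "g \<in> carrier G" for g using surj that by (simp add: k_def f_inv_into_f)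
  have kx: "k x = (1 mod int n, 0)"
    using kh[of "(1 mod int n, 0)"] powx[of 1] x n by (simp add: h_def carrier_integer_mod_group)
  have ky: "k y = (0, 1 mod int d)"
    using kh[of "(0, 1 mod int d)"] powy[of 1] y n by (simp add: h_def carrier_integer_mod_group)
  have kc: "k g \<in> carrier ?Z" if "g \<in> carrier G" for g using k that by (auto simp: hom_def)
  have km: "k (g \<otimes> g') = k g \<otimes>\<^bsub>?Z\<^esub> k g'" if "g \<in> carrier G" "g' \<in> carrier G" for g g'
    using k that by (auto simp: hom_def)
  have "fst \<circ> k \<in> hom G (integer_mod_group n)" "snd \<circ> k \<in> hom G (integer_mod_group d)"
    using kc km by (auto intro!: homI simp: mult_DirProd' simp del: mult_integer_mod_group) (metis SigmaE fst_conv snd_conv)+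
  moreover have "g = \<one>" if "g \<in> carrier G" "fst (k g) = 0" "snd (k g) = 0" for g
  proof -
    have "k g = (0, 0)" using that by (simp add: prod_eq_iff)
    then show ?thesis using hk[OF that(1)] by (simp add: h_def)
  qed
  ultimately show ?thesis using kx ky by (intro exI[of _ "fst \<circ> k"] exI[of _ "snd \<circ> k"]) auto
qed

context group
begin

lemma cyclic_group_of_ord:
  assumes "finite (carrier G)" "x \<in> carrier G" "ord x = order G"
  shows "cyclic_group G"
proof -
  have "\<exists>k::int. c = x [^] k" if "c \<in> carrier G" for c
    by (rule subgroup_powers_of_full_order[OF subgroup_self assms(1,2) _ that]) (use assms(3) in \<open>simp add: order_def\<close>)
  then have "carrier G = range (\<lambda>k::int. x [^] k)" using assms(2) by auto
  then show ?thesis using assms(2) unfolding cyclic_group by blast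
qed

lemma cyclic_group_generator_ord:
  assumes "finite (carrier G)" "cyclic_group G"
  obtains x where "x \<in> carrier G" "ord x = order G"
proof -
  obtain x where x: "x \<in> carrier G" "carrier G = range (\<lambda>n::int. x [^] n)"
    using assms(2) by (auto simp: cyclic_group)
  then have "generate G {x} = carrier G" using generate_pow[OF x(1)] by auto
  then have "ord x = order G" using generate_pow_card[OF x(1)] by (simp add: order_def)
  then show ?thesis using that x by blast
qed

lemma iso_integer_mod_group:
  assumes x: "x \<in> carrier G" "ord x = order G" and fin: "finite (carrier G)"
  shows "integer_mod_group (order G) \<cong> G"
proof -
  let ?n = "order G"
  have n: "?n > 0" using fin order_gt_0_iff_finite by blast
  have pow: "x [^] (i mod int ?n) = x [^] i" for i :: int
    using x by (auto simp: int_pow_eq simp flip: mod_eq_dvd_iff)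
  have hom: "(\<lambda>i::int. x [^] i) \<in> hom (integer_mod_group ?n) G"
    by (rule homI) (use x pow in \<open>auto simp: int_pow_mult\<close>)
  have surj: "(\<lambda>i::int. x [^] i) ` carrier (integer_mod_group ?n) = carrier G"
  proof
    show "carrier G \<subseteq> (\<lambda>i::int. x [^] i) ` carrier (integer_mod_group ?n)"
    proof
      fix c assume "c \<in> carrier G"
      then obtain k :: int where "c = x [^] k"
        using subgroup_powers_of_full_order[OF subgroup_self fin x(1), of c] x by (auto simp: order_def)
      then show "c \<in> (\<lambda>i::int. x [^] i) ` carrier (integer_mod_group ?n)"
        using pow[of k] n by (intro image_eqI[of _ _ "k mod int ?n"]) (auto simp: carrier_integer_mod_group)
    qed
  qed (use x in auto)
  have "inj_on (\<lambda>i::int. x [^] i) (carrier (integer_mod_group ?n))"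
    by (rule eq_card_imp_inj_on) (use surj n in \<open>simp_all add: carrier_integer_mod_group order_def\<close>)
  then show ?thesis using hom surj by (intro is_isoI[of "\<lambda>i::int. x [^] i"]) (auto simp: iso_def bij_betw_def)
qed

end

lemma integer_mod_group_coprime_iso:
  assumes co: "coprime a b" and pos: "a > 0" "b > 0"
  shows "integer_mod_group (a * b) \<cong> integer_mod_group a \<times>\<times> integer_mod_group b"
proof -
  let ?h = "\<lambda>i. (i mod int a, i mod int b)"
  have m: "x mod (int a * int b) mod int a = x mod int a" "x mod (int a * int b) mod int b = x mod int b" for x
    by (simp_all add: mod_mod_cancel)
  have "?h \<in> hom (integer_mod_group (a * b)) (integer_mod_group a \<times>\<times> integer_mod_group b)"
    by (rule homI) (use pos m in \<open>auto simp: carrier_integer_mod_group mod_add_eq\<close>)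
  moreover have inj: "inj_on ?h (carrier (integer_mod_group (a * b)))"
  proof (rule inj_onI)
    fix i j assume ij: "i \<in> carrier (integer_mod_group (a * b))" "j \<in> carrier (integer_mod_group (a * b))" "?h i = ?h j"
    then have "int a dvd i - j" "int b dvd i - j" by (auto simp: mod_eq_dvd_iff)
    then have "int a * int b dvd i - j" using co by (intro divides_mult) auto
    then have "i mod (int a * int b) = j mod (int a * int b)" by (simp add: mod_eq_dvd_iff)
    then show "i = j" using ij pos by (simp add: carrier_integer_mod_group)
  qed
  moreover have "?h ` carrier (integer_mod_group (a * b)) = carrier (integer_mod_group a \<times>\<times> integer_mod_group b)"
    by (rule card_subset_eq) (use pos card_image[OF inj] in \<open>auto simp: carrier_integer_mod_group card_cartesian_product nat_mult_distrib\<close>)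
  ultimately show ?thesis by (intro is_isoI[of ?h]) (auto simp: iso_def bij_betw_def)
qed

lemma DirProd_trivial_left_iso:
  assumes "group K"
  shows "integer_mod_group 1 \<times>\<times> K \<cong> K"
proof -
  interpret K: group K by fact
  have "snd \<in> iso (integer_mod_group 1 \<times>\<times> K) K"
    by (auto simp: iso_def hom_def bij_betw_def inj_on_def carrier_integer_mod_group image_iff)
  then show ?thesis by (rule is_isoI)
qed

lemma DirProd_trivial_triple_iso:
  assumes "group K"
  shows "K \<times>\<times> (integer_mod_group 1 \<times>\<times> (integer_mod_group 1 \<times>\<times> integer_mod_group 1)) \<cong> K"
proof -
  interpret K: group K by fact
  have "fst \<in> iso (K \<times>\<times> (integer_mod_group 1 \<times>\<times> (integer_mod_group 1 \<times>\<times> integer_mod_group 1))) K"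
    by (auto simp: iso_def hom_def bij_betw_def inj_on_def carrier_integer_mod_group image_iff)
  then show ?thesis by (rule is_isoI)
qed

text \<open>Only a rearrangement of factors; the four copies of \<open>Z\<close> become the values of a function on
  \<open>{0, 1, 2, 3}\<close>.\<close>

lemma group_power_4_iso:
  assumes Z: "group Z"
  shows "((Z \<times>\<times> M) \<times>\<times> (Z \<times>\<times> (Z \<times>\<times> Z))) \<times>\<times> C \<cong> group_power Z 4 \<times>\<times> (M \<times>\<times> C)"
proof -
  interpret Z: group Z by fact
  define t where "t a b c d = (\<lambda>i\<in>{..<4::nat}. if i = 0 then a else if i = 1 then b else if i = 2 then c else d)"
    for a b c d :: 'a
  have t_inj: "t a b c d = t a' b' c' d' \<longleftrightarrow> a = a' \<and> b = b' \<and> c = c' \<and> d = d'" for a b c d a' b' c' d'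
  proof
    assume e: "t a b c d = t a' b' c' d'"
    show "a = a' \<and> b = b' \<and> c = c' \<and> d = d'"
      using fun_cong[OF e, of 0] fun_cong[OF e, of 1] fun_cong[OF e, of 2] fun_cong[OF e, of 3]
      by (simp add: t_def)
  qed simp
  let ?h = "\<lambda>(((a, m), (b, (c, d))), e). (t a b c d, (m, e))"
  let ?L = "((Z \<times>\<times> M) \<times>\<times> (Z \<times>\<times> (Z \<times>\<times> Z))) \<times>\<times> C" and ?R = "group_power Z 4 \<times>\<times> (M \<times>\<times> C)"
  have tc: "t a b c d \<in> carrier (group_power Z 4)"
    if "a \<in> carrier Z" "b \<in> carrier Z" "c \<in> carrier Z" "d \<in> carrier Z" for a b c d
    using that by (auto simp: t_def group_power_def)
  have tm: "t (a \<otimes>\<^bsub>Z\<^esub> a') (b \<otimes>\<^bsub>Z\<^esub> b') (c \<otimes>\<^bsub>Z\<^esub> c') (d \<otimes>\<^bsub>Z\<^esub> d')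
     = t a b c d \<otimes>\<^bsub>group_power Z 4\<^esub> t a' b' c' d'" for a b c d a' b' c' d'
    by (auto simp: t_def group_power_def)
  have ts: "f = t (f 0) (f 1) (f 2) (f 3)" "f 0 \<in> carrier Z" "f 1 \<in> carrier Z" "f 2 \<in> carrier Z" "f 3 \<in> carrier Z"
    if f: "f \<in> carrier (group_power Z 4)" for f
  proof -
    have f': "f \<in> {..<4} \<rightarrow>\<^sub>E carrier Z" using f by (simp add: group_power_def)
    show "f 0 \<in> carrier Z" "f 1 \<in> carrier Z" "f 2 \<in> carrier Z" "f 3 \<in> carrier Z"
      using PiE_mem[OF f', of 0] PiE_mem[OF f', of 1] PiE_mem[OF f', of 2] PiE_mem[OF f', of 3]
      by simp_all
    show "f = t (f 0) (f 1) (f 2) (f 3)"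
    proof
      fix i
      show "f i = t (f 0) (f 1) (f 2) (f 3) i"
      proof (cases "i < 4")
        case True
        then have "i = 0 \<or> i = 1 \<or> i = 2 \<or> i = 3" by auto
        then show ?thesis by (auto simp: t_def)
      next
        case False
        then show ?thesis using PiE_arb[OF f', of i] by (simp add: t_def)
      qed
    qed
  qed
  have "?h \<in> hom ?L ?R"
  proof (rule homI)
    show "?h x \<in> carrier ?R" if "x \<in> carrier ?L" for x
      using that by (cases x) (simp only: prod.case carrier_DirProd mem_Sigma_iff split: prod.splits, blast intro: tc)
    show "?h (x \<otimes>\<^bsub>?L\<^esub> y) = ?h x \<otimes>\<^bsub>?R\<^esub> ?h y" for x y
      by (simp only: mult_DirProd' case_prod_unfold tm fst_conv snd_conv)
  qed
  moreover have "inj_on ?h (carrier ?L)" by (auto simp: inj_on_def t_inj)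
  moreover have "?h ` carrier ?L = carrier ?R"
  proof
    show "?h ` carrier ?L \<subseteq> carrier ?R" by (auto simp: tc)
    show "carrier ?R \<subseteq> ?h ` carrier ?L"
    proof
      fix w assume "w \<in> carrier ?R"
      then obtain f m e where w: "w = (f, m, e)" "f \<in> carrier (group_power Z 4)" "m \<in> carrier M" "e \<in> carrier C"
        by auto
      have "w = ?h (((f 0, m), f 1, f 2, f 3), e)" using w ts(1)[OF w(2)] by simp
      then show "w \<in> ?h ` carrier ?L"
        by (rule image_eqI) (use w ts(2-)[OF w(2)] in simp)
    qed
  qed
  ultimately show ?thesis by (intro is_isoI[of ?h]) (auto simp: iso_def bij_betw_def)
qed

text \<open>In a Sylow \<open>p\<close>-subgroup \<open>V\<close> all nontrivial elements have order \<open>p\<close>, since the group is not cyclic.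
  Take \<open>x\<^sub>1 \<noteq> \<one>\<close> in \<open>V\<close>, \<open>y \<in> V\<close> outside the subgroup generated by \<open>x\<^sub>1\<close>, an element \<open>w\<close> of order \<open>m\<close>, and
  \<open>x = x\<^sub>1 w\<close>.\<close>

lemma (in comm_group) noncyclic_two_generators:
  assumes fin: "finite (carrier G)" and p: "Factorial_Ring.prime p" and ord: "order G = p\<^sup>2 * m"
    and m: "m = 1 \<or> Factorial_Ring.prime m" "\<not> p dvd m" and nc: "\<not> cyclic_group G"
  obtains x y where "x \<in> carrier G" "ord x = p * m" "y \<in> carrier G" "ord y = p"
    "\<And>(i::int) (j::int). x [^] i \<otimes> y [^] j = \<one> \<Longrightarrow> x [^] i = \<one>"
proof -
  have p1: "p > 1" using p by (rule prime_gt_1_nat)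
  have cop: "coprime p m" using m(2) p by (simp add: prime_imp_coprime)
  obtain w where w: "w \<in> carrier G" "ord w = m"
  proof (cases "m = 1")
    case True
    then show ?thesis using that[of \<one>] by simp
  next
    case False
    then have pm: "Factorial_Ring.prime m" using m by blast
    have "order G = m ^ 1 * p\<^sup>2" using ord by simp
    from sylow_thm[OF pm is_group this fin] obtain S where S: "subgroup S G" "card S = m" by auto
    then obtain w where "w \<in> S" "ord w = m" using prime_order_subgroup_powers[of S] pm by metis
    then show ?thesis using that[of w] subgroup.mem_carrier[OF S(1)] by blast
  qed
  obtain V where V: "subgroup V G" "card V = p\<^sup>2" using sylow_thm[OF p is_group ord fin] by blast
  have Vc: "V \<subseteq> carrier G" using V by (simp add: subgroup.subset)
  have finV: "finite V" using fin Vc finite_subset by blast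
  interpret V: group "G\<lparr>carrier := V\<rparr>" using V(1) by (rule subgroup_imp_group)
  have ordV: "ord v = p" if v: "v \<in> V" "v \<noteq> \<one>" for v
  proof -
    have vc: "v \<in> carrier G" using v Vc by auto
    have "v [^] (p\<^sup>2) = \<one>" using V.pow_order_eq_1[of v] v V(2)
      by (simp add: order_def flip: nat_pow_consistent)
    then have "ord v dvd p\<^sup>2" using vc by (simp add: pow_eq_id)
    then obtain j where j: "j \<le> 2" "ord v = p ^ j" using divides_primepow_nat[OF p] by blast
    have "j \<noteq> 0" using j v vc ord_eq_1[OF vc] by auto
    \<comment> \<open>An element of order \<open>p\<^sup>2\<close> in \<open>V\<close> times one of order \<open>m\<close> would generate the whole group.\<close>
    moreover have "j \<noteq> 2"
    proof
      assume "j = 2"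
      then have "ord (v \<otimes> w) = order G"
        using ord_mult_coprime[of v w] vc w j cop ord by (simp add: m_comm)
      then show False using cyclic_group_of_ord[OF fin, of "v \<otimes> w"] vc w nc by simp
    qed
    ultimately have "j = 1" using j by auto
    then show ?thesis using j by simp
  qed
  have "card V > 1" using V one_less_power[OF p1, of 2] by simp
  then have "V \<noteq> {\<one>}" by auto
  then obtain x1 where x1: "x1 \<in> V" "x1 \<noteq> \<one>" using subgroup.one_closed[OF V(1)] by blast
  have x1c: "x1 \<in> carrier G" using x1 Vc by auto
  have ox1: "ord x1 = p" by (rule ordV[OF x1])
  have "card (generate G {x1}) = p" using generate_pow_card[OF x1c] ox1 by simp
  moreover have "generate G {x1} \<subseteq> V" using generate_subgroup_incl[OF _ V(1)] x1 by simp
  moreover have "p < p\<^sup>2" using p1 by (simp add: power2_eq_square)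
  ultimately have "\<not> V \<subseteq> generate G {x1}" using V(2) by (metis less_irrefl subset_antisym)
  then obtain y where y: "y \<in> V" "y \<notin> generate G {x1}" by blast
  have yc: "y \<in> carrier G" using y Vc by auto
  have "y \<noteq> \<one>" using y(2) generate.one by metis
  then have oy: "ord y = p" using ordV y by blast
  let ?x = "x1 \<otimes> w"
  have xw: "?x \<in> carrier G" "ord ?x = p * m"
    using ord_mult_coprime[of x1 w] x1c w ox1 cop by (simp_all add: m_comm)
  moreover have "?x [^] i = \<one>" if e: "?x [^] i \<otimes> y [^] j = \<one>" for i j :: int
  proof -
    have e': "x1 [^] i \<otimes> w [^] i \<otimes> y [^] j = \<one>" using e x1c w yc by (simp add: int_pow_distrib)
    have "(x1 [^] i \<otimes> w [^] i \<otimes> y [^] j) [^] int p = x1 [^] (int p * i) \<otimes> w [^] (i * int p) \<otimes> y [^] (int p * j)"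
      using x1c w yc by (simp add: int_pow_distrib int_pow_pow mult.commute)
    moreover have "x1 [^] (int p * i) = \<one>" "y [^] (int p * j) = \<one>"
      using x1c yc ox1 oy by (simp_all add: int_pow_eq_id)
    ultimately have "w [^] (i * int p) = \<one>" using e' w by simp
    then have "int m dvd i * int p" using w by (simp add: int_pow_eq_id)
    then have "int m dvd i" using cop by (simp add: coprime_dvd_mult_left_iff coprime_commute)
    then have wi: "w [^] i = \<one>" using w by (simp add: int_pow_eq_id)
    then have xy: "x1 [^] i \<otimes> y [^] j = \<one>" using e' x1c by simp
    have "int p dvd j"
    proof (rule ccontr)
      assume "\<not> int p dvd j"
      then have "coprime (int p) j" using p by (simp add: prime_imp_coprime)
      then obtain a b :: int where ab: "a * int p + b * j = 1"
        using bezout_int[of "int p" j] by auto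
      have "y [^] j = x1 [^] (- i)" using xy x1c yc by (metis inv_equality int_pow_closed int_pow_neg m_comm inv_inv)
      then have yj: "y [^] j \<in> generate G {x1}" using generate_pow[OF x1c] by auto
      have "y [^] (int p * a) = \<one>" using yc oy by (simp add: int_pow_eq_id)
      moreover have "int p * a + j * b = 1" using ab by (simp only: mult.commute)
      ultimately have "y [^] (j * b) = y"
        using int_pow_mult[OF yc, of "int p * a" "j * b"] yc by simp
      then have "y = (y [^] j) [^] b" using yc by (simp add: int_pow_pow)
      also have "\<dots> \<in> generate G {x1}"
        by (rule subgroup_int_pow_closed[OF generate_is_subgroup yj]) (use x1c in simp)
      finally show False using y by simp
    qed
    then have "y [^] j = \<one>" using yc oy by (simp add: int_pow_eq_id)
    then show ?thesis using e xw by simp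
  qed
  ultimately show ?thesis using that[of ?x y] yc oy by blast
qed

context group
begin

section \<open>From the abelianization to the stated groups\<close>

lemma abelianization_coordinates:
  assumes x: "x \<in> carrier (abelianization G)" "group.ord (abelianization G) x = n"
    and y: "y \<in> carrier (abelianization G)" "group.ord (abelianization G) y = d"
    and ord: "card (rcosets (derived G (carrier G))) = n * d" "n * d > 0"
    and indep: "\<And>(i::int) (j::int). x [^]\<^bsub>abelianization G\<^esub> i \<otimes>\<^bsub>abelianization G\<^esub> y [^]\<^bsub>abelianization G\<^esub> j
       = \<one>\<^bsub>abelianization G\<^esub> \<Longrightarrow> x [^]\<^bsub>abelianization G\<^esub> i = \<one>\<^bsub>abelianization G\<^esub>"
  obtains a b u v where "a \<in> hom G (integer_mod_group n)" "b \<in> hom G (integer_mod_group d)"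
    "u \<in> carrier G" "a u = 1 mod int n" "b u = 0" "v \<in> carrier G" "a v = 0" "b v = 1 mod int d"
    "\<And>g. g \<in> carrier G \<Longrightarrow> a g = 0 \<Longrightarrow> b g = 0 \<Longrightarrow> g \<in> derived G (carrier G)"
proof -
  let ?D = "derived G (carrier G)" and ?A = "abelianization G"
  interpret N: normal ?D G by (rule derived_self_is_normal)
  interpret A: comm_group ?A by (rule derived_quot_is_comm_group)
  have oA: "order ?A = n * d" using ord by (simp add: order_def FactGroup_def)
  have "\<exists>a b. a \<in> hom ?A (integer_mod_group n) \<and> b \<in> hom ?A (integer_mod_group d) \<and>
     a x = 1 mod int n \<and> b x = 0 \<and> a y = 0 \<and> b y = 1 mod int d \<and>
     (\<forall>g\<in>carrier ?A. a g = 0 \<longrightarrow> b g = 0 \<longrightarrow> g = \<one>\<^bsub>?A\<^esub>)"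
    by (rule A.two_generator_coordinates[OF x y oA ord(2)]) (rule indep)
  then obtain a b where ab: "a \<in> hom ?A (integer_mod_group n)" "b \<in> hom ?A (integer_mod_group d)"
    "a x = 1 mod int n" "b x = 0" "a y = 0" "b y = 1 mod int d"
    "\<forall>g\<in>carrier ?A. a g = 0 \<longrightarrow> b g = 0 \<longrightarrow> g = \<one>\<^bsub>?A\<^esub>"
    by (elim exE conjE)
  obtain u v where uv: "u \<in> carrier G" "x = ?D #> u" "v \<in> carrier G" "y = ?D #> v"
    using x(1) y(1) by (auto simp: carrier_FactGroup)
  have pr: "(\<lambda>g. ?D #> g) \<in> hom G ?A" by (rule N.r_coset_hom_Mod)
  have memb: "g \<in> ?D" if g: "g \<in> carrier G" "a (?D #> g) = 0" "b (?D #> g) = 0" for g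
  proof -
    have "?D #> g = ?D" using ab(7) g by (auto simp: carrier_FactGroup)
    then show ?thesis using rcos_self[OF g(1) N.subgroup_axioms] by simp
  qed
  show ?thesis
    by (rule that[of "a \<circ> (\<lambda>g. ?D #> g)" "b \<circ> (\<lambda>g. ?D #> g)" u v])
      (use uv ab memb Group.hom_compose[OF pr ab(1)] Group.hom_compose[OF pr ab(2)] in auto)
qed

text \<open>The case \<open>d = 1\<close> of \<open>tensor_square_iso\<close>, with \<open>v\<close> in the trivial class.\<close>

lemma tensor_square_cyclic_abelianization:
  assumes fin: "finite (carrier G)"
    and z: "\<And>c. c \<in> derived G (carrier G) \<Longrightarrow> \<exists>k::int. c = z [^] k" "z \<in> derived G (carrier G)"
    and co: "coprime (card (rcosets (derived G (carrier G)))) (card (derived G (carrier G)))"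
    and cyc: "cyclic_group (abelianization G)"
  shows "T \<cong> integer_mod_group (card (rcosets (derived G (carrier G)))) \<times>\<times> G\<lparr>carrier := derived G (carrier G)\<rparr>"
proof -
  let ?D = "derived G (carrier G)" and ?A = "abelianization G"
  let ?n = "card (rcosets ?D)"
  have D: "subgroup ?D G" by (rule derived_is_subgroup) simp
  interpret T: group T by (rule group_tensor_square)
  interpret D: group "G\<lparr>carrier := ?D\<rparr>" using D by (rule subgroup_imp_group)
  interpret A: comm_group ?A by (rule derived_quot_is_comm_group)
  have n: "?n > 0" using lagrange[OF D] fin order_gt_0_iff_finite by (metis gr0I mult_0)
  have oA: "order ?A = ?n" by (simp add: order_def FactGroup_def)
  then have finA: "finite (carrier ?A)" using n A.order_gt_0_iff_finite by simp
  obtain x where x: "x \<in> carrier ?A" "A.ord x = ?n"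
    using A.cyclic_group_generator_ord[OF finA cyc] oA by metis
  have o1: "A.ord \<one>\<^bsub>?A\<^esub> = 1" by (simp del: one_FactGroup)
  obtain a b u v where ab: "a \<in> hom G (integer_mod_group ?n)" "b \<in> hom G (integer_mod_group 1)"
    "u \<in> carrier G" "a u = 1 mod int ?n" "b u = 0" "v \<in> carrier G" "a v = 0" "b v = 1 mod int 1"
    "\<And>g. g \<in> carrier G \<Longrightarrow> a g = 0 \<Longrightarrow> b g = 0 \<Longrightarrow> g \<in> ?D"
  proof (rule abelianization_coordinates[OF x A.one_closed o1])
    fix i j :: int
    assume "x [^]\<^bsub>?A\<^esub> i \<otimes>\<^bsub>?A\<^esub> \<one>\<^bsub>?A\<^esub> [^]\<^bsub>?A\<^esub> j = \<one>\<^bsub>?A\<^esub>"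
    then show "x [^]\<^bsub>?A\<^esub> i = \<one>\<^bsub>?A\<^esub>" using x(1) by (simp del: one_FactGroup mult_FactGroup)
  qed (use n in simp_all)
  have "T \<cong> (integer_mod_group ?n \<times>\<times> (integer_mod_group 1 \<times>\<times> (integer_mod_group 1 \<times>\<times> integer_mod_group 1)))
     \<times>\<times> G\<lparr>carrier := ?D\<rparr>"
    by (rule tensor_square_iso[OF z co co n _ ab]) simp_all
  also have "\<dots> \<cong> integer_mod_group ?n \<times>\<times> G\<lparr>carrier := ?D\<rparr>"
    by (rule group.DirProd_iso_trans[OF _ DirProd_trivial_triple_iso])
      (simp_all add: DirProd_group iso_refl)
  finally show ?thesis .
qed

text \<open>The case \<open>n = p m\<close>, \<open>d = p\<close> of \<open>tensor_square_iso\<close>; splitting \<open>\<int>\<^sub>p\<^sub>m\<close> yields the fourth copy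
  of \<open>\<int>\<^sub>p\<close>.\<close>

lemma tensor_square_noncyclic_abelianization:
  assumes z: "\<And>c. c \<in> derived G (carrier G) \<Longrightarrow> \<exists>k::int. c = z [^] k" "z \<in> derived G (carrier G)"
    and co: "coprime (card (rcosets (derived G (carrier G)))) (card (derived G (carrier G)))"
    and p: "Factorial_Ring.prime p" and idx: "card (rcosets (derived G (carrier G))) = p\<^sup>2 * m"
    and m: "m = 1 \<or> Factorial_Ring.prime m" "\<not> p dvd m"
    and nc: "\<not> cyclic_group (abelianization G)"
  shows "T \<cong> group_power (integer_mod_group p) 4 \<times>\<times>
    (integer_mod_group m \<times>\<times> G\<lparr>carrier := derived G (carrier G)\<rparr>)"
proof -
  let ?D = "derived G (carrier G)" and ?A = "abelianization G"
  have D: "subgroup ?D G" by (rule derived_is_subgroup) simp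
  interpret T: group T by (rule group_tensor_square)
  interpret D: group "G\<lparr>carrier := ?D\<rparr>" using D by (rule subgroup_imp_group)
  interpret A: comm_group ?A by (rule derived_quot_is_comm_group)
  have m0: "m > 0" using m(1) by (auto simp: prime_gt_0_nat)
  have p0: "p > 0" using p by (rule prime_gt_0_nat)
  have oA: "order ?A = p\<^sup>2 * m" using idx by (simp add: order_def FactGroup_def)
  then have finA: "finite (carrier ?A)" using m0 p0 A.order_gt_0_iff_finite by simp
  obtain x y where xy: "x \<in> carrier ?A" "A.ord x = p * m" "y \<in> carrier ?A" "A.ord y = p"
    "\<And>(i::int) (j::int). x [^]\<^bsub>?A\<^esub> i \<otimes>\<^bsub>?A\<^esub> y [^]\<^bsub>?A\<^esub> j = \<one>\<^bsub>?A\<^esub> \<Longrightarrow> x [^]\<^bsub>?A\<^esub> i = \<one>\<^bsub>?A\<^esub>"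
    using A.noncyclic_two_generators[OF finA p oA m nc] by metis
  obtain a b u v where ab: "a \<in> hom G (integer_mod_group (p * m))" "b \<in> hom G (integer_mod_group p)"
    "u \<in> carrier G" "a u = 1 mod int (p * m)" "b u = 0" "v \<in> carrier G" "a v = 0" "b v = 1 mod int p"
    "\<And>g. g \<in> carrier G \<Longrightarrow> a g = 0 \<Longrightarrow> b g = 0 \<Longrightarrow> g \<in> ?D"
    by (rule abelianization_coordinates[OF xy(1-4) _ _ xy(5)])
      (use idx m0 p0 in \<open>simp_all add: power2_eq_square ac_simps\<close>)
  have co': "coprime (p * m) (card ?D)"
    by (rule coprime_divisors[OF _ dvd_refl co]) (simp add: idx power2_eq_square)
  let ?Z = "integer_mod_group p"
  have cpm: "coprime p m" using m(2) p by (simp add: prime_imp_coprime)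
  have "T \<cong> (integer_mod_group (p * m) \<times>\<times> (?Z \<times>\<times> (?Z \<times>\<times> ?Z))) \<times>\<times> G\<lparr>carrier := ?D\<rparr>"
    by (rule tensor_square_iso[OF z co co' _ _ ab]) (use m0 p0 in simp_all)
  also have "\<dots> \<cong> ((?Z \<times>\<times> integer_mod_group m) \<times>\<times> (?Z \<times>\<times> (?Z \<times>\<times> ?Z))) \<times>\<times> G\<lparr>carrier := ?D\<rparr>"
    by (intro group.DirProd_iso_trans DirProd_group group_integer_mod_group iso_refl
        integer_mod_group_coprime_iso[OF cpm p0 m0])
  also have "\<dots> \<cong> group_power ?Z 4 \<times>\<times> (integer_mod_group m \<times>\<times> G\<lparr>carrier := ?D\<rparr>)"
    by (rule group_power_4_iso) simp
  finally show ?thesis .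
qed

end

theorem theoremD:
  fixes p q r :: nat and G :: "('a, 'b) monoid_scheme"
  assumes "Factorial_Ring.prime p" and "Factorial_Ring.prime q" and "Factorial_Ring.prime r"
    and "p < q" and "q < r" and "p * q \<noteq> 6"
    and "group G" and "\<not> comm_group G" and "order G = p\<^sup>2 * q * r"
  shows
    "let c = card (commutator_subgroup G);
         case_i = (c = q \<or> c = r \<or> (c = q * r \<and> \<not> q dvd r - 1));
         case_ii = (c = q * r \<and> q dvd r - 1)
     in (case_i \<or> case_ii)
      \<and> (case_i \<longrightarrow>
          (cyclic_group (abelianization G) \<longrightarrow>
            tensor_square G \<cong> integer_mod_group (p\<^sup>2 * q * r)) \<and>
          (\<not> cyclic_group (abelianization G) \<longrightarrow>
            tensor_square G \<cong> group_power (integer_mod_group p) 4 \<times>\<times> integer_mod_group (q * r)))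
      \<and> (case_ii \<longrightarrow>
          (cyclic_group (abelianization G) \<longrightarrow>
            tensor_square G \<cong>
              integer_mod_group (p\<^sup>2) \<times>\<times> G\<lparr>carrier := commutator_subgroup G\<rparr>) \<and>
          (\<not> cyclic_group (abelianization G) \<longrightarrow>
            tensor_square G \<cong>
              group_power (integer_mod_group p) 4 \<times>\<times> G\<lparr>carrier := commutator_subgroup G\<rparr>))"
proof -
  interpret G: group G by fact
  define D where "D = derived G (carrier G)"
  have D: "subgroup D G" unfolding D_def by (rule G.derived_is_subgroup) simp
  have p: "p > 1" and q: "q > 1" and r: "r > 1" using assms(1-3) prime_gt_1_nat by blast+
  have "order G > 0" using assms(9) p q r by simp
  then have fin: "finite (carrier G)" by (simp add: G.order_gt_0_iff_finite)
  have ord: "order G = p\<^sup>2 * (q * r)" using assms(9) by (simp add: mult.assoc)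
  have dq: "\<not> p dvd q" "\<not> p dvd r" "\<not> q dvd r" "\<not> q dvd p" "\<not> r dvd p" "\<not> r dvd q"
    using assms(1-5) by (metis primes_dvd_imp_eq less_irrefl less_trans)+
  have lcase: "l = q \<or> l = r" if "Factorial_Ring.prime l" "l dvd q * r" for l
    using that assms(2,3) by (meson prime_dvd_mult_iff primes_dvd_imp_eq)
  have primes: "\<not> l dvd p\<^sup>2 - 1 \<and> \<not> l dvd p - 1 \<and> l \<noteq> p \<and> \<not> l * l dvd q * r"
    if l: "Factorial_Ring.prime l" "l dvd q * r" for l
  proof -
    have lp: "l > p" using lcase[OF l] assms(4,5) by auto
    have 1: "\<not> l dvd p - 1" using lp p by (auto dest!: dvd_imp_le)
    \<comment> \<open>Here \<open>p q \<noteq> 6\<close> enters: \<open>p\<close> and \<open>p + 1\<close> are both prime only for \<open>p = 2\<close>.\<close>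
    have "\<not> l dvd p + 1"
    proof
      assume "l dvd p + 1"
      then have "l = p + 1" using lp by (auto dest!: dvd_imp_le)
      then have "even p \<or> even l" by simp
      moreover have "odd l" using lp p l(1) prime_odd_nat[of l] by simp
      ultimately have "p = 2" using assms(1) primes_dvd_imp_eq two_is_prime_nat by blast
      then have "l = 3" using \<open>l = p + 1\<close> by simp
      then have "q = 3" using lcase[OF l] assms(4,5) \<open>p = 2\<close> by auto
      then show False using \<open>p = 2\<close> assms(6) by simp
    qed
    moreover have "p\<^sup>2 - 1 = (p - 1) * (p + 1)"
      by (simp add: power2_eq_square algebra_simps)
    ultimately have 2: "\<not> l dvd p\<^sup>2 - 1" using 1 prime_dvd_mult_iff[OF l(1)] by metis
    have "\<not> l * l dvd q * r"
      using lcase[OF l] dq q r by (auto simp: mult.commute[of q r])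
    then show ?thesis using 1 2 lp by simp
  qed
  have cd: "card D dvd q * r"
    unfolding D_def by (rule G.derived_card_dvd_complement[OF fin assms(1) ord primes])
  have c1: "card D \<noteq> 1"
  proof
    assume "card D = 1"
    then have D1: "D = {\<one>\<^bsub>G\<^esub>}" using subgroup.one_closed[OF D] by (elim card_1_singletonE) (metis singletonD)
    have "comm_group G"
    proof (rule G.group_comm_groupI)
      fix g h assume gh: "g \<in> carrier G" "h \<in> carrier G"
      have "g \<otimes>\<^bsub>G\<^esub> h \<otimes>\<^bsub>G\<^esub> inv\<^bsub>G\<^esub> g \<otimes>\<^bsub>G\<^esub> inv\<^bsub>G\<^esub> h \<in> D"
        unfolding D_def derived_def using gh by (auto intro!: generate.incl)
      then have "(g \<otimes>\<^bsub>G\<^esub> h) \<otimes>\<^bsub>G\<^esub> inv\<^bsub>G\<^esub> (h \<otimes>\<^bsub>G\<^esub> g) = \<one>\<^bsub>G\<^esub>"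
        using gh D1 by (simp add: G.inv_mult_group G.m_assoc)
      then show "g \<otimes>\<^bsub>G\<^esub> h = h \<otimes>\<^bsub>G\<^esub> g"
        using gh by (metis G.inv_closed G.inv_equality G.inv_inv G.m_closed)
    qed
    with assms(8) show False ..
  qed
  have cases: "card D = q \<or> card D = r \<or> card D = q * r"
  proof -
    obtain a b where ab: "card D = a * b" "a dvd q" "b dvd r"
      using cd division_decomp by blast
    then have "a = 1 \<or> a = q" "b = 1 \<or> b = r" using assms(2,3) by (auto simp: prime_nat_iff)
    then show ?thesis using ab(1) c1 by (elim disjE) simp_all
  qed
  \<comment> \<open>\<open>m\<close> is the part of the order of the abelianization prime to \<open>p\<close>.\<close>
  obtain m where m: "card D * m = q * r" "m = 1 \<or> Factorial_Ring.prime m" "m = q \<or> m = r \<or> m = 1"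
    "coprime m (card D)"
  proof -
    have "coprime q r" using assms(2,3,5) by (simp add: primes_coprime)
    from cases show ?thesis
    proof (elim disjE)
      assume "card D = q"
      then show ?thesis using that[of r] assms(3) \<open>coprime q r\<close> by (simp add: coprime_commute)
    next
      assume "card D = r"
      then show ?thesis using that[of q] assms(2) \<open>coprime q r\<close> by (simp add: mult.commute)
    next
      assume "card D = q * r"
      then show ?thesis using that[of 1] by simp
    qed
  qed
  have npm: "\<not> p dvd m" using m(3) dq p by auto
  have cD0: "card D > 0" using cases q r by auto
  have finD: "finite D" using cD0 by (rule card_ge_0_finite)
  have idx: "card (rcosets\<^bsub>G\<^esub> D) = p\<^sup>2 * m"
  proof -
    have "card (rcosets\<^bsub>G\<^esub> D) * card D = (p\<^sup>2 * m) * card D"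
      using G.lagrange[OF D] ord m(1) by (simp add: ac_simps)
    then show ?thesis using cD0 by simp
  qed
  have cop: "coprime p (card D)"
    using cases dq assms(1) by (auto simp: prime_imp_coprime)
  then have co: "coprime (card (rcosets\<^bsub>G\<^esub> D)) (card D)" unfolding idx using m(4) by simp
  obtain z where z: "z \<in> D" "G.ord z = card D"
  proof (cases "card D = q * r")
    case True
    then show ?thesis
      using G.derived_cyclic_two_primes[OF assms(2,3,5)] that unfolding D_def by metis
  next
    case False
    then have "Factorial_Ring.prime (card D)" using cases assms(2,3) by auto
    then show ?thesis using G.prime_order_subgroup_powers[OF D] that by blast
  qed
  have zpow: "\<exists>k::int. c = z [^]\<^bsub>G\<^esub> k" if "c \<in> D" for c
    by (rule G.subgroup_powers_of_full_order[OF D finD z that])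
  interpret D: group "G\<lparr>carrier := D\<rparr>" using D by (rule G.subgroup_imp_group)
  have isoD: "integer_mod_group (card D) \<cong> G\<lparr>carrier := D\<rparr>"
  proof -
    have zc: "z \<in> carrier G" using subgroup.mem_carrier[OF D z(1)] .
    have oD: "order (G\<lparr>carrier := D\<rparr>) = card D" by (simp add: order_def)
    have "D.ord z = card D"
      using D.ord_unique[of z "card D"] z zc G.pow_eq_id[OF zc]
      by (simp flip: G.nat_pow_consistent)
    then show ?thesis using D.iso_integer_mod_group[of z] z(1) oD finD by simp
  qed
  note isoD' = group.iso_sym[OF group_integer_mod_group isoD]
  have cyc: "tensor_square G \<cong> integer_mod_group (p\<^sup>2 * m) \<times>\<times> G\<lparr>carrier := D\<rparr>"
    if "cyclic_group (abelianization G)"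
    using G.tensor_square_cyclic_abelianization[OF fin, of z] zpow z(1) co that idx
    unfolding D_def by simp
  have noncyc: "tensor_square G \<cong> group_power (integer_mod_group p) 4 \<times>\<times>
      (integer_mod_group m \<times>\<times> G\<lparr>carrier := D\<rparr>)"
    if "\<not> cyclic_group (abelianization G)"
    using G.tensor_square_noncyclic_abelianization[of z p m] zpow z(1) co that idx
      assms(1) m(2) npm unfolding D_def by simp
  have gP: "group (group_power (integer_mod_group p) 4)" by (simp add: group_power_def)
  have m0: "m > 0" using m(1) q r by (intro gr0I) simp
  have ZD: "integer_mod_group k \<times>\<times> G\<lparr>carrier := D\<rparr> \<cong> integer_mod_group (k * card D)"
    if k: "coprime k (card D)" "k > 0" for k
  proof -
    have "integer_mod_group k \<times>\<times> G\<lparr>carrier := D\<rparr> \<cong> integer_mod_group k \<times>\<times> integer_mod_group (card D)"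
      by (rule group.DirProd_iso_trans[OF group_integer_mod_group iso_refl isoD'])
    also have "\<dots> \<cong> integer_mod_group (k * card D)"
      by (rule group.iso_sym[OF group_integer_mod_group integer_mod_group_coprime_iso[OF k cD0]])
    finally show ?thesis .
  qed
  have i_cyc: "tensor_square G \<cong> integer_mod_group (p\<^sup>2 * q * r)" if "cyclic_group (abelianization G)"
  proof -
    have "integer_mod_group (p\<^sup>2 * m) \<times>\<times> G\<lparr>carrier := D\<rparr> \<cong> integer_mod_group (p\<^sup>2 * m * card D)"
      by (rule ZD) (use co idx m0 p in simp_all)
    moreover have "p\<^sup>2 * m * card D = p\<^sup>2 * q * r" using m(1) by (simp add: mult.commute mult.assoc)
    ultimately show ?thesis using iso_trans[OF cyc[OF that]] by simp
  qed
  have i_non: "tensor_square G \<cong> group_power (integer_mod_group p) 4 \<times>\<times> integer_mod_group (q * r)"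
    if "\<not> cyclic_group (abelianization G)"
  proof -
    have "integer_mod_group m \<times>\<times> G\<lparr>carrier := D\<rparr> \<cong> integer_mod_group (q * r)"
      using ZD[OF m(4) m0] m(1) by (simp add: mult.commute)
    from iso_trans[OF noncyc[OF that] group.DirProd_iso_trans[OF gP iso_refl this]]
    show ?thesis .
  qed
  have ii: "m = 1" if "card D = q * r" using m(1) that q r by simp
  have ii_cyc: "tensor_square G \<cong> integer_mod_group (p\<^sup>2) \<times>\<times> G\<lparr>carrier := D\<rparr>"
    if "card D = q * r" "cyclic_group (abelianization G)"
    using cyc[OF that(2)] ii[OF that(1)] by simp
  have ii_non: "tensor_square G \<cong> group_power (integer_mod_group p) 4 \<times>\<times> G\<lparr>carrier := D\<rparr>"
    if "card D = q * r" "\<not> cyclic_group (abelianization G)"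
  proof -
    have "integer_mod_group m \<times>\<times> G\<lparr>carrier := D\<rparr> \<cong> G\<lparr>carrier := D\<rparr>"
      unfolding ii[OF that(1)] by (rule DirProd_trivial_left_iso) (rule D.is_group)
    from iso_trans[OF noncyc[OF that(2)] group.DirProd_iso_trans[OF gP iso_refl this]]
    show ?thesis .
  qed
  show ?thesis
    using cases i_cyc i_non ii_cyc ii_non unfolding Let_def D_def by blast
qed

end
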